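(* For every $n\ge 5$ and every odd $d\ge 3$, with respect to the extended $S_{n+1}$-action there is an isomorphism of $S_{n+1}$-modules $$H^{2(d-1)}(C_n(d);\mathbb{C})\cong V_{(n-3,1,1,1,1)}\oplus V_{(n-2,2,1)}\oplus V_{(n-3,2,2)}\oplus V_{(n-1,2)}.$$
   Context: For $d\ge 2$, $C_n(d)=\{(p_1,\dots,p_n)\in(\mathbb{R}^d)^n : p_i\ne p_j \text{ for } i\neq j\}$ is the configuration space of $n$ points in $\mathbb{R}^d$; $S_n$ acts on it by permuting coordinates, hence on $H^*(C_n(d);\mathbb{C})$ (the natural action). The algebra $H^*(C_n(d);\mathbb{C})$ is presented as the associative graded algebra with generators $A_{i,j}$, $1\le i,j\le n$ (with $A_{i,i}=0$), of degree $d-1$ and relations $A_{i,j}=(-1)^dA_{j,i}$, $A_{i,j}A_{h,k}=(-1)^{d-1}A_{h,k}A_{i,j}$, $A_{i,j}A_{i,k}=A_{k,j}(A_{i,k}-A_{i,j})$ for $1\le i\le n$, $j\le k$; the natural action of $\sigma\in S_n$ is $\sigma A_{i,j}=A_{\sigma i,\sigma j}$. Extended action for $d$ odd: regard $S_{n+1}$ as the permutation group of $\{0,1,\dots,n\}$ and $S_n$ as the stabilizer of $0$. $S_{n+1}$ acts on $H^*(C_n(d);\mathbb{C})$ by graded algebra automorphisms, extending the natural $S_n$-action, with the transposition $(0,1)$ acting by $(0,1)A_{i,j}=A_{i,j}-A_{1,j}+A_{1,i}$ for $1<i<j$ and $(0,1)A_{1,j}=-A_{1,j}$. For a partition $\lambda$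 of $m$, $V_\lambda$ denotes the irreducible complex representation of $S_m$ indexed by $\lambda$, with $V_{(m)}$ the trivial representation and $V_{(m-1,1)}$ the standard representation. *)

theory Defs
  imports
    "HOL-Homology.Homology"
    "HOL-Algebra.QuotRing"
    "HOL-Algebra.Module"
    "HOL-Combinatorics.Permutations"
begin

section \<open>Graded complex algebras\<close>

text \<open>
  An associative graded algebra over the complex numbers, not necessarily commutative;
  \<open>hpart R p\<close> is the homogeneous component of degree \<open>p\<close>.
\<close>

record 'a graded_algebra = "(complex, 'a) module" +
  hpart :: "nat \<Rightarrow> 'a set"

definition graded_quot ::
    "('a, 'm) graded_algebra_scheme \<Rightarrow> 'a set \<Rightarrow> 'a set graded_algebra"
  where "graded_quot R I =
    \<lparr>carrier = carrier (R Quot I), monoid.mult = monoid.mult (R Quot I), one = one (R Quot I),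
     zero = zero (R Quot I), add = add (R Quot I),
     smult = (\<lambda>a C. \<Union>c\<in>C. I +>\<^bsub>R\<^esub> (a \<odot>\<^bsub>R\<^esub> c)),
     hpart = (\<lambda>p. (\<lambda>x. I +>\<^bsub>R\<^esub> x) ` hpart R p)\<rparr>"

definition graded_algebra_iso ::
    "('a, 'm) graded_algebra_scheme \<Rightarrow> ('b, 'k) graded_algebra_scheme \<Rightarrow> ('a \<Rightarrow> 'b) set"
  where "graded_algebra_iso R S =
    {h \<in> ring_iso R S.
       (\<forall>a. \<forall>x\<in>carrier R. h (a \<odot>\<^bsub>R\<^esub> x) = a \<odot>\<^bsub>S\<^esub> h x) \<and>
       (\<forall>p. h ` hpart R p = hpart S p)}"

text \<open>
  The free associative algebra on generators \<open>I\<close>, all of degree \<open>e\<close>: an element is the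
  finitely supported family of its coefficients on the words in \<open>I\<close>.
\<close>

definition free_algebra :: "'g set \<Rightarrow> nat \<Rightarrow> ('g list \<Rightarrow> complex) graded_algebra"
  where "free_algebra I e =
    \<lparr>carrier = {f. finite {w. f w \<noteq> 0} \<and> (\<forall>w. f w \<noteq> 0 \<longrightarrow> set w \<subseteq> I)},
     monoid.mult = (\<lambda>f g w. \<Sum>k\<le>length w. f (take k w) * g (drop k w)),
     one = (\<lambda>w. if w = [] then 1 else 0),
     zero = (\<lambda>w. 0),
     add = (\<lambda>f g w. f w + g w),
     smult = (\<lambda>a f w. a * f w),
     hpart = (\<lambda>p. {f. finite {w. f w \<noteq> 0} \<and>
                      (\<forall>w. f w \<noteq> 0 \<longrightarrow> set w \<subseteq> I \<and> e * length w = p)})\<rparr>"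

definition free_gen :: "'g \<Rightarrow> 'g list \<Rightarrow> complex"
  where "free_gen g = (\<lambda>w. if w = [g] then 1 else 0)"


section \<open>Singular cohomology with complex coefficients\<close>

text \<open>
  A cochain is the family of its homogeneous components: \<open>c p f\<close> is the value of the
  degree \<open>p\<close> component on the singular \<open>p\<close>-simplex \<open>f\<close>, and is \<open>0\<close> when \<open>f\<close> is not a singular
  \<open>p\<close>-simplex.
\<close>

type_synonym 'a cochain = "nat \<Rightarrow> ((nat \<Rightarrow> real) \<Rightarrow> 'a) \<Rightarrow> complex"

definition singular_cochains :: "'a topology \<Rightarrow> 'a cochain set"
  where "singular_cochains X =
    {c. finite {p. c p \<noteq> (\<lambda>f. 0)} \<and> (\<forall>p f. c p f \<noteq> 0 \<longrightarrow> singular_simplex p X f)}"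

definition coboundary :: "'a topology \<Rightarrow> 'a cochain \<Rightarrow> 'a cochain"
  where "coboundary X c = (\<lambda>p f.
    if 0 < p \<and> singular_simplex p X f
    then \<Sum>k\<le>p. (-1) ^ k * c (p - 1) (singular_face p k f) else 0)"

definition front_face :: "nat \<Rightarrow> ((nat \<Rightarrow> real) \<Rightarrow> 'a) \<Rightarrow> (nat \<Rightarrow> real) \<Rightarrow> 'a"
  where "front_face p f = restrict f (standard_simplex p)"

text \<open>The face spanned by the vertices \<open>p, \<dots>, p + q\<close> of a singular \<open>(p + q)\<close>-simplex.\<close>

definition back_face :: "nat \<Rightarrow> nat \<Rightarrow> ((nat \<Rightarrow> real) \<Rightarrow> 'a) \<Rightarrow> (nat \<Rightarrow> real) \<Rightarrow> 'a"
  where "back_face p q f =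
    restrict (\<lambda>x. f (\<lambda>i. if i < p then 0 else x (i - p))) (standard_simplex q)"

definition cup :: "'a topology \<Rightarrow> 'a cochain \<Rightarrow> 'a cochain \<Rightarrow> 'a cochain"
  where "cup X c d = (\<lambda>r f.
    if singular_simplex r X f
    then \<Sum>p\<le>r. c p (front_face p f) * d (r - p) (back_face p (r - p) f) else 0)"

definition cocycle_algebra :: "'a topology \<Rightarrow> 'a cochain graded_algebra"
  where "cocycle_algebra X =
    \<lparr>carrier = {c \<in> singular_cochains X. coboundary X c = (\<lambda>p f. 0)},
     monoid.mult = cup X,
     one = (\<lambda>p f. if p = 0 \<and> singular_simplex 0 X f then 1 else 0),
     zero = (\<lambda>p f. 0),
     add = (\<lambda>c d p f. c p f + d p f),
     smult = (\<lambda>a c p f. a * c p f),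
     hpart = (\<lambda>p. {c \<in> singular_cochains X.
                coboundary X c = (\<lambda>p f. 0) \<and> (\<forall>q. q \<noteq> p \<longrightarrow> c q = (\<lambda>f. 0))})\<rparr>"

definition coboundaries :: "'a topology \<Rightarrow> 'a cochain set"
  where "coboundaries X = coboundary X ` singular_cochains X"

definition cohomology :: "'a topology \<Rightarrow> 'a cochain set graded_algebra"
  where "cohomology X = graded_quot (cocycle_algebra X) (coboundaries X)"

definition pullback :: "'a topology \<Rightarrow> ('a \<Rightarrow> 'b) \<Rightarrow> 'b cochain \<Rightarrow> 'a cochain"
  where "pullback X g c = (\<lambda>p f. if singular_simplex p X f then c p (simplex_map p g f) else 0)"

definition cohomology_map ::
    "'a topology \<Rightarrow> ('a \<Rightarrow> 'b) \<Rightarrow> 'b cochain set \<Rightarrow> 'a cochain set"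
  where "cohomology_map X g C =
    (\<Union>c\<in>C. coboundaries X +>\<^bsub>cocycle_algebra X\<^esub> pullback X g c)"


section \<open>Configuration spaces\<close>

type_synonym config = "nat \<Rightarrow> nat \<Rightarrow> real"

definition config_space :: "nat \<Rightarrow> nat \<Rightarrow> config topology"
  where "config_space n d =
    subtopology (product_topology (\<lambda>i. Euclidean_space d) {1..n}) {p. inj_on p {1..n}}"

abbreviation config_cohomology :: "nat \<Rightarrow> nat \<Rightarrow> config cochain set graded_algebra"
  where "config_cohomology n d \<equiv> cohomology (config_space n d)"

text \<open>
  A permutation \<open>\<sigma>\<close> moves the point with label \<open>i\<close> to the label \<open>\<sigma> i\<close>, i.e. it maps the
  configuration \<open>p\<close> to \<open>p \<circ> inv \<sigma>\<close>; the induced left action on cohomology is the pullback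
  along the inverse of this map.
\<close>

definition natural_action ::
    "nat \<Rightarrow> nat \<Rightarrow> (nat \<Rightarrow> nat) \<Rightarrow> config cochain set \<Rightarrow> config cochain set"
  where "natural_action n d \<sigma> = cohomology_map (config_space n d) (\<lambda>p. p \<circ> \<sigma>)"

definition config_relators :: "nat \<Rightarrow> nat \<Rightarrow> ((nat \<times> nat) list \<Rightarrow> complex) set"
  where "config_relators n d =
    (let F = free_algebra ({1..n} \<times> {1..n}) (d - 1); A = (\<lambda>i j. free_gen (i, j)) in
      {A i i | i. i \<in> {1..n}} \<union>
      {A i j \<ominus>\<^bsub>F\<^esub> ((-1) ^ d \<odot>\<^bsub>F\<^esub> A j i) | i j. i \<in> {1..n} \<and> j \<in> {1..n}} \<union>
      {(A i j \<otimes>\<^bsub>F\<^esub> A h k) \<ominus>\<^bsub>F\<^esub> ((-1) ^ (d - 1) \<odot>\<^bsub>F\<^esub> (A h k \<otimes>\<^bsub>F\<^esub> A i j)) | i j h k.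
         i \<in> {1..n} \<and> j \<in> {1..n} \<and> h \<in> {1..n} \<and> k \<in> {1..n}} \<union>
      {(A i j \<otimes>\<^bsub>F\<^esub> A i k) \<ominus>\<^bsub>F\<^esub> (A k j \<otimes>\<^bsub>F\<^esub> (A i k \<ominus>\<^bsub>F\<^esub> A i j)) | i j k.
         i \<in> {1..n} \<and> j \<in> {1..n} \<and> k \<in> {1..n} \<and> j \<le> k})"

definition config_ideal :: "nat \<Rightarrow> nat \<Rightarrow> ((nat \<times> nat) list \<Rightarrow> complex) set"
  where "config_ideal n d =
    Idl\<^bsub>free_algebra ({1..n} \<times> {1..n}) (d - 1)\<^esub> (config_relators n d)"

definition presented_algebra :: "nat \<Rightarrow> nat \<Rightarrow> ((nat \<times> nat) list \<Rightarrow> complex) set graded_algebra"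
  where "presented_algebra n d =
    graded_quot (free_algebra ({1..n} \<times> {1..n}) (d - 1)) (config_ideal n d)"

definition presented_gen :: "nat \<Rightarrow> nat \<Rightarrow> nat \<Rightarrow> nat \<Rightarrow> ((nat \<times> nat) list \<Rightarrow> complex) set"
  where "presented_gen n d i j =
    config_ideal n d +>\<^bsub>free_algebra ({1..n} \<times> {1..n}) (d - 1)\<^esub> free_gen (i, j)"

text \<open>
  The classes \<open>A i j\<close> in the cohomology of the configuration space are generators for the
  standard presentation (Arnold, Cohen), and the natural action permutes their indices.
\<close>

definition standard_generators :: "nat \<Rightarrow> nat \<Rightarrow> (nat \<Rightarrow> nat \<Rightarrow> config cochain set) \<Rightarrow> bool"
  where "standard_generators n d A \<longleftrightarrow>
    (\<exists>\<Phi> \<in> graded_algebra_iso (presented_algebra n d) (config_cohomology n d).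
       \<forall>i\<in>{1..n}. \<forall>j\<in>{1..n}. \<Phi> (presented_gen n d i j) = A i j) \<and>
    (\<forall>\<sigma>. \<sigma> permutes {1..n} \<longrightarrow>
       (\<forall>i\<in>{1..n}. \<forall>j\<in>{1..n}. natural_action n d \<sigma> (A i j) = A (\<sigma> i) (\<sigma> j)))"

text \<open>
  The action of the permutations of \<open>{0..n}\<close> that exists for odd \<open>d\<close>. The conditions
  determine \<open>\<rho>\<close> on cohomology, since the classes \<open>A i j\<close> generate the algebra and
  \<open>(0 1)\<close> together with the permutations of \<open>{1..n}\<close> generates the group.
\<close>

definition extended_action ::
    "nat \<Rightarrow> nat \<Rightarrow> (nat \<Rightarrow> nat \<Rightarrow> config cochain set) \<Rightarrow>
     ((nat \<Rightarrow> nat) \<Rightarrow> config cochain set \<Rightarrow> config cochain set) \<Rightarrow> bool"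
  where "extended_action n d A \<rho> \<longleftrightarrow>
    (let H = config_cohomology n d in
      (\<forall>\<sigma>. \<sigma> permutes {0..n} \<longrightarrow> \<rho> \<sigma> \<in> graded_algebra_iso H H) \<and>
      (\<forall>\<sigma> \<tau>. \<sigma> permutes {0..n} \<longrightarrow> \<tau> permutes {0..n} \<longrightarrow>
         (\<forall>x\<in>carrier H. \<rho> (\<sigma> \<circ> \<tau>) x = \<rho> \<sigma> (\<rho> \<tau> x))) \<and>
      (\<forall>\<sigma>. \<sigma> permutes {1..n} \<longrightarrow> (\<forall>x\<in>carrier H. \<rho> \<sigma> x = natural_action n d \<sigma> x)) \<and>
      (\<forall>i j. 1 < i \<and> i < j \<and> j \<le> n \<longrightarrow>
         \<rho> (Transposition.transpose 0 1) (A i j) = (A i j \<ominus>\<^bsub>H\<^esub> A 1 j) \<oplus>\<^bsub>H\<^esub> A 1 i) \<and>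
      (\<forall>j. 1 < j \<and> j \<le> n \<longrightarrow> \<rho> (Transposition.transpose 0 1) (A 1 j) = \<ominus>\<^bsub>H\<^esub> A 1 j))"


section \<open>Representations of permutation groups and Specht modules\<close>

text \<open>
  A complex vector space with operators indexed by permutations. The multiplicative fields
  inherited from \<^typ>\<open>(complex, 'a) module\<close> play no role and are ignored by
  \<open>rep_isomorphic\<close>.
\<close>

record 'a perm_rep = "(complex, 'a) module" +
  act :: "(nat \<Rightarrow> nat) \<Rightarrow> 'a \<Rightarrow> 'a"

definition rep_isomorphic :: "nat set \<Rightarrow> 'a perm_rep \<Rightarrow> 'b perm_rep \<Rightarrow> bool"
  where "rep_isomorphic S V W \<longleftrightarrow>
    (\<exists>h. bij_betw h (carrier V) (carrier W) \<and>
       (\<forall>x\<in>carrier V. \<forall>y\<in>carrier V. h (x \<oplus>\<^bsub>V\<^esub> y) = h x \<oplus>\<^bsub>W\<^esub> h y) \<and>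
       (\<forall>a. \<forall>x\<in>carrier V. h (a \<odot>\<^bsub>V\<^esub> x) = a \<odot>\<^bsub>W\<^esub> h x) \<and>
       (\<forall>\<sigma>. \<sigma> permutes S \<longrightarrow> (\<forall>x\<in>carrier V. h (act V \<sigma> x) = act W \<sigma> (h x))))"

definition rep_sum :: "'a perm_rep \<Rightarrow> 'b perm_rep \<Rightarrow> ('a \<times> 'b) perm_rep"
    (infixr \<open>\<oplus>\<^sub>R\<close> 65)
  where "V \<oplus>\<^sub>R W =
    \<lparr>carrier = carrier V \<times> carrier W, monoid.mult = undefined, one = undefined,
     zero = (\<zero>\<^bsub>V\<^esub>, \<zero>\<^bsub>W\<^esub>),
     add = (\<lambda>x y. (fst x \<oplus>\<^bsub>V\<^esub> fst y, snd x \<oplus>\<^bsub>W\<^esub> snd y)),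
     smult = (\<lambda>a x. (a \<odot>\<^bsub>V\<^esub> fst x, a \<odot>\<^bsub>W\<^esub> snd x)),
     act = (\<lambda>\<sigma> x. (act V \<sigma> (fst x), act W \<sigma> (snd x)))\<rparr>"

definition hpart_rep ::
    "('a, 'm) graded_algebra_scheme \<Rightarrow> nat \<Rightarrow> ((nat \<Rightarrow> nat) \<Rightarrow> 'a \<Rightarrow> 'a) \<Rightarrow> 'a perm_rep"
  where "hpart_rep R p \<rho> =
    \<lparr>carrier = hpart R p, monoid.mult = undefined, one = undefined,
     zero = zero R, add = add R, smult = smult R, act = \<rho>\<rparr>"

definition young_diagram :: "nat list \<Rightarrow> (nat \<times> nat) set"
  where "young_diagram l = {(r, c). r < length l \<and> c < l ! r}"

text \<open>A tableau is given by the cell (row, column) in which each entry is placed.\<close>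

definition tableaux :: "nat set \<Rightarrow> nat list \<Rightarrow> (nat \<Rightarrow> nat \<times> nat) set"
  where "tableaux S l = {T. bij_betw T S (young_diagram l)}"

text \<open>A tabloid is encoded as the function assigning to each entry its row.\<close>

definition tabloid :: "nat set \<Rightarrow> (nat \<Rightarrow> nat \<times> nat) \<Rightarrow> nat \<Rightarrow> nat"
  where "tabloid S T = restrict (fst \<circ> T) S"

definition column_stabilizer :: "nat set \<Rightarrow> (nat \<Rightarrow> nat \<times> nat) \<Rightarrow> (nat \<Rightarrow> nat) set"
  where "column_stabilizer S T = {\<pi>. \<pi> permutes S \<and> (\<forall>i\<in>S. snd (T (\<pi> i)) = snd (T i))}"

text \<open>
  Vectors of the permutation module on tabloids are functions on tabloids. The tableau
  \<open>\<pi> T\<close> has entry \<open>\<pi> i\<close> in the cell of \<open>i\<close> in \<open>T\<close>, so it is \<open>T \<circ> inv \<pi>\<close>.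
\<close>

definition polytabloid :: "nat set \<Rightarrow> (nat \<Rightarrow> nat \<times> nat) \<Rightarrow> (nat \<Rightarrow> nat) \<Rightarrow> complex"
  where "polytabloid S T = (\<lambda>t.
    \<Sum>\<pi>\<in>column_stabilizer S T. of_int (sign \<pi>) * (if t = tabloid S (T \<circ> inv_into UNIV \<pi>) then 1 else 0))"

text \<open>
  The irreducible representation indexed by a partition \<open>l\<close> of \<open>card S\<close>, realised as the
  Specht module; a one-row \<open>l\<close> gives the trivial representation.
\<close>

definition specht :: "nat set \<Rightarrow> nat list \<Rightarrow> ((nat \<Rightarrow> nat) \<Rightarrow> complex) perm_rep"
  where "specht S l =
    \<lparr>carrier = {v. \<exists>B a. finite B \<and> B \<subseteq> tableaux S l \<and>
                     v = (\<lambda>t. \<Sum>T\<in>B. a T * polytabloid S T t)},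
     monoid.mult = undefined, one = undefined,
     zero = (\<lambda>t. 0),
     add = (\<lambda>v w t. v t + w t),
     smult = (\<lambda>a v t. a * v t),
     act = (\<lambda>\<sigma> v t. v (t \<circ> \<sigma>))\<rparr>"

end

theory Submission
  imports Defs
begin

text \<open>A linear form on \<open>H\<^bsup>2(d - 1)\<^esup>\<close> is recorded by its values \<open>\<phi> a b c d\<close> on the products
  \<open>A\<^sub>a\<^sub>b A\<^sub>c\<^sub>d\<close>, where \<open>A\<^sub>a\<^sub>b\<close> is \<open>0\<close> if \<open>a\<close> or \<open>b\<close> is \<open>0\<close>. The relations of the algebra say that \<open>\<phi>\<close>
  is antisymmetric in each edge, symmetric in the two edges, and zero on the square of every triangle
  class \<open>A\<^sub>a\<^sub>b + A\<^sub>b\<^sub>c + A\<^sub>c\<^sub>a\<close>; a permutation \<open>\<sigma>\<close> of \<open>{0..n}\<close> maps \<open>A\<^sub>a\<^sub>b\<close> to the triangle class on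
  \<open>\<sigma> 0, \<sigma> a, \<sigma> b\<close>, so that all vertices including \<open>0\<close> play the same role.

  Products of two triangles with a common edge are permuted by the full group, and so are the
  alternating products on five vertices. Summing them over the entries in prescribed rows of a tabloid
  gives an equivariant map from the sum of the four Specht modules. It is injective since column
  antisymmetrizers isolate one shape at a time and do not annihilate the polytabloids. It is
  surjective since a form that vanishes on the image has, one shape after the other, all its
  contractions equal to zero.\<close>

section \<open>Forms on pairs of edges\<close>

text \<open>Working with linear forms turns the relations into conditions on a function of four
  labels, and it replaces a dimension count by separation: a vector missing from the image would
  leave a nonzero form that vanishes there. The shapes have two sources. Products of two triangles
  with a common edge behave like a curvature tensor, of Young symmetry (2,2). Since their indices
  run over finitely many vertices, they can be contracted with the constant function: the twofold
  contraction belongs to \<open>(n - 1, 2)\<close>, the simple one to \<open>(n - 2, 2, 1)\<close>,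
  and what remains without contractions to \<open>(n - 3, 2, 2)\<close>. The alternating products
  are coboundaries of alternating functions of four vertices; these form a copy of the fourth
  exterior power of the standard representation, which has shape \<open>(n - 3, 1, 1, 1, 1)\<close>.
  For odd \<open>d\<close> the generators commute and are antisymmetric in their labels; this is why
  the forms are symmetric in the two edges and why edges can be added up to oriented triangles.
  Topology enters only through the given isomorphism with the presented algebra.\<close>

type_synonym quad_form = "nat \<Rightarrow> nat \<Rightarrow> nat \<Rightarrow> nat \<Rightarrow> complex"

text \<open>The bilinear extension of \<open>\<phi>\<close> to the product of the triangle class on
  \<open>a, b, c\<close> with the one on \<open>d, e, f\<close>.\<close>

definition triangle_form :: "quad_form \<Rightarrow>
    nat \<Rightarrow> nat \<Rightarrow> nat \<Rightarrow> nat \<Rightarrow> nat \<Rightarrow> nat \<Rightarrow> complex"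
  where "triangle_form \<phi> a b c d e f =
    \<phi> a b d e + \<phi> a b e f + \<phi> a b f d +
    \<phi> b c d e + \<phi> b c e f + \<phi> b c f d +
    \<phi> c a d e + \<phi> c a e f + \<phi> c a f d"

definition edge_form :: "quad_form \<Rightarrow> bool"
  where "edge_form \<phi> \<longleftrightarrow>
    (\<forall>a b c d. \<phi> a b c d = - \<phi> b a c d) \<and> (\<forall>a b c d. \<phi> a b c d = \<phi> c d a b)"

text \<open>Labels range over all natural numbers and no bound \<open>n\<close> occurs; only values
  on labels up to \<open>n\<close> ever meet the algebra. A triangle with vertex \<open>0\<close> is
  a single edge, so the last condition contains the relation that each generator has square
  zero.\<close>

definition config_forms :: "quad_form set"
  where "config_forms =
    {\<phi>. edge_form \<phi> \<and> (\<forall>b c d. \<phi> 0 b c d = 0) \<and> (\<forall>a b c. triangle_form \<phi> a b c a b c = 0)}"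

text \<open>The transpose of the extended action: \<open>\<phi>\<close> evaluated on the product of
  the images of the edges \<open>a b\<close> and \<open>c d\<close>, each image being a triangle
  with first vertex \<open>\<sigma> 0\<close>.\<close>

definition pull_form :: "(nat \<Rightarrow> nat) \<Rightarrow> quad_form \<Rightarrow>
    nat \<Rightarrow> nat \<Rightarrow> nat \<Rightarrow> nat \<Rightarrow> complex"
  where "pull_form \<sigma> \<phi> a b c d = triangle_form \<phi> (\<sigma> 0) (\<sigma> a) (\<sigma> b) (\<sigma> 0) (\<sigma> c) (\<sigma> d)"

lemma edge_form_antisym1: "edge_form \<phi> \<Longrightarrow> \<phi> a b c d = - \<phi> b a c d"
  unfolding edge_form_def by blast

lemma edge_form_sym: "edge_form \<phi> \<Longrightarrow> \<phi> a b c d = \<phi> c d a b"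
  unfolding edge_form_def by blast

lemma edge_form_antisym2: "edge_form \<phi> \<Longrightarrow> \<phi> a b c d = - \<phi> a b d c"
  by (metis edge_form_antisym1 edge_form_sym)

lemma edge_form_refl1: "edge_form \<phi> \<Longrightarrow> \<phi> a a c d = 0"
  using edge_form_antisym1[of \<phi> a a c d] by simp

lemma triangle_form_swap12: "edge_form \<phi> \<Longrightarrow> triangle_form \<phi> b a c d e f = - triangle_form \<phi> a b c d e f"
  unfolding triangle_form_def
  using edge_form_antisym1[of \<phi> b a] edge_form_antisym1[of \<phi> a c] edge_form_antisym1[of \<phi> c b]
  by simp

lemma triangle_form_rotate: "triangle_form \<phi> b c a d e f = triangle_form \<phi> a b c d e f"
  unfolding triangle_form_def by simp

lemma triangle_form_swap23: "edge_form \<phi> \<Longrightarrow> triangle_form \<phi> a c b d e f = - triangle_form \<phi> a b c d e f"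
  by (metis triangle_form_swap12 triangle_form_rotate)

lemma triangle_form_sym: "edge_form \<phi> \<Longrightarrow> triangle_form \<phi> a b c d e f = triangle_form \<phi> d e f a b c"
  unfolding triangle_form_def
  using edge_form_sym[of \<phi> a b] edge_form_sym[of \<phi> b c] edge_form_sym[of \<phi> c a] by simp

lemma triangle_form_swap45: "edge_form \<phi> \<Longrightarrow> triangle_form \<phi> a b c e d f = - triangle_form \<phi> a b c d e f"
  by (metis triangle_form_swap12 triangle_form_sym)

lemma triangle_form_swap56: "edge_form \<phi> \<Longrightarrow> triangle_form \<phi> a b c d f e = - triangle_form \<phi> a b c d e f"
  by (metis triangle_form_swap23 triangle_form_sym)

lemma triangle_form_degenerate:
  assumes "edge_form \<phi>"
  shows "triangle_form \<phi> a a c d e f = 0" "triangle_form \<phi> a b b d e f = 0" "triangle_form \<phi> a b a d e f = 0"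
proof -
  show 1: "triangle_form \<phi> a a c d e f = 0" for a c
    using triangle_form_swap12[OF assms, of a a c d e f] by simp
  show "triangle_form \<phi> a b b d e f = 0" "triangle_form \<phi> a b a d e f = 0"
    using 1[of a b] 1[of b a] triangle_form_rotate by metis+
qed

text \<open>Coning from \<open>p\<close>: on the right each edge at \<open>p\<close> occurs once in
  either direction, so these edges cancel and the boundary of the base remains.\<close>

lemma triangle_form_cocycle:
  assumes "edge_form \<phi>"
  shows "triangle_form \<phi> a b c x y z = 
    triangle_form \<phi> p a b x y z + triangle_form \<phi> p b c x y z + triangle_form \<phi> p c a x y z"
  unfolding triangle_form_def
  using edge_form_antisym1[OF assms, of p a] edge_form_antisym1[OF assms, of p b]
    edge_form_antisym1[OF assms, of p c]
  by simp

lemma triangle_form_cocycle2: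
  assumes "edge_form \<phi>"
  shows "triangle_form \<phi> x y z a b c = 
    triangle_form \<phi> x y z p a b + triangle_form \<phi> x y z p b c + triangle_form \<phi> x y z p c a"
  using triangle_form_cocycle[OF assms, of a b c x y z p] triangle_form_sym[OF assms] by metis

lemma edge_form_pull: "edge_form \<phi> \<Longrightarrow> edge_form (pull_form \<sigma> \<phi>)"
  unfolding edge_form_def[of "pull_form \<sigma> \<phi>"] pull_form_def
  using triangle_form_swap23 triangle_form_sym by blast

text \<open>Each edge is pulled back to a triangle with apex \<open>\<sigma> 0\<close>, and the
  three triangles over the edges of a triangle add up to its image by coning from that apex. The
  apex has dropped out, so no vertex is distinguished any more.\<close>

lemma triangle_form_pull:
  assumes "edge_form \<phi>"
  shows "triangle_form (pull_form \<sigma> \<phi>) a b c d e f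
    = triangle_form \<phi> (\<sigma> a) (\<sigma> b) (\<sigma> c) (\<sigma> d) (\<sigma> e) (\<sigma> f)"
proof -
  have "triangle_form (pull_form \<sigma> \<phi>) a b c d e f =
      triangle_form \<phi> (\<sigma> 0) (\<sigma> a) (\<sigma> b) (\<sigma> d) (\<sigma> e) (\<sigma> f)
    + triangle_form \<phi> (\<sigma> 0) (\<sigma> b) (\<sigma> c) (\<sigma> d) (\<sigma> e) (\<sigma> f)
    + triangle_form \<phi> (\<sigma> 0) (\<sigma> c) (\<sigma> a) (\<sigma> d) (\<sigma> e) (\<sigma> f)"
    unfolding triangle_form_cocycle2[OF assms, of _ _ _ "\<sigma> d" "\<sigma> e" "\<sigma> f" "\<sigma> 0"]
    unfolding triangle_form_def[of "pull_form \<sigma> \<phi>"] pull_form_def by simp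
  then show ?thesis
    using triangle_form_cocycle[OF assms, of "\<sigma> a" "\<sigma> b" "\<sigma> c" "\<sigma> d" "\<sigma> e" "\<sigma> f" "\<sigma> 0"] by simp
qed

lemma config_formsD:
  assumes "\<phi> \<in> config_forms"
  shows "edge_form \<phi>" "\<phi> 0 b c d = 0" "triangle_form \<phi> a b c a b c = 0"
  using assms unfolding config_forms_def by auto

lemma config_forms_zero:
  assumes "\<phi> \<in> config_forms"
  shows "\<phi> 0 b c d = 0" "\<phi> a 0 c d = 0" "\<phi> a b 0 d = 0" "\<phi> a b c 0 = 0"
  using config_formsD[OF assms] edge_form_antisym1 edge_form_sym
  by (metis neg_equal_0_iff_equal)+

lemma triangle_form_0: "\<phi> \<in> config_forms \<Longrightarrow> triangle_form \<phi> 0 a b 0 c d = \<phi> a b c d"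
  unfolding triangle_form_def by (simp add: config_forms_zero)

text \<open>The form need not vanish at the base point \<open>0\<close>; pulling back normalises it.\<close>

lemma pull_form_mem:
  assumes "edge_form \<phi>" "\<And>a b c. triangle_form \<phi> a b c a b c = 0"
  shows "pull_form \<sigma> \<phi> \<in> config_forms"
  unfolding config_forms_def
  using edge_form_pull[OF assms(1)] assms
  by (auto simp: triangle_form_pull pull_form_def triangle_form_degenerate)

lemma pull_form_config: "\<phi> \<in> config_forms \<Longrightarrow> pull_form \<sigma> \<phi> \<in> config_forms"
  by (rule pull_form_mem) (auto dest: config_formsD)

lemma pull_form_comp:
  assumes "edge_form \<phi>"
  shows "pull_form \<tau> (pull_form \<sigma> \<phi>) = pull_form (\<sigma> \<circ> \<tau>) \<phi>"
  by (intro ext) (simp add: pull_form_def[of \<tau>] pull_form_def[of "\<sigma> \<circ> \<tau>"] triangle_form_pull[OF assms])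

text \<open>The symmetries proved below are those of an algebraic curvature tensor, in the
  convention that is symmetric in each pair of indices.\<close>

definition pair_form where
  "pair_form \<phi> a b c d = triangle_form \<phi> a b c a b d"

lemma pair_form_pull: "edge_form \<phi> \<Longrightarrow>
  pair_form (pull_form \<sigma> \<phi>) a b c d = pair_form \<phi> (\<sigma> a) (\<sigma> b) (\<sigma> c) (\<sigma> d)"
  unfolding pair_form_def by (rule triangle_form_pull)

lemma pair_form_swap: assumes "edge_form \<phi>"
  shows "pair_form \<phi> b a c d = pair_form \<phi> a b c d" "pair_form \<phi> a b d c = pair_form \<phi> a b c d"
  unfolding pair_form_def 
  using triangle_form_swap12[OF assms, of b a c b a d] triangle_form_swap45[OF assms, of a b c b a d]
    triangle_form_sym[OF assms, of a b c a b d] by auto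

lemma pair_form_eq0: assumes "edge_form \<phi>"
  shows "pair_form \<phi> a a c d = 0" "pair_form \<phi> a b a d = 0" "pair_form \<phi> a b b d = 0"
    "pair_form \<phi> a b c a = 0" "pair_form \<phi> a b c b = 0"
  unfolding pair_form_def 
  using triangle_form_degenerate[OF assms] triangle_form_sym[OF assms] by metis+

lemma pair_form_diag: "\<phi> \<in> config_forms \<Longrightarrow> pair_form \<phi> a b c c = 0"
  unfolding pair_form_def by (rule config_formsD)

text \<open>With \<open>x\<^sub>1, x\<^sub>2, x\<^sub>3, x\<^sub>4\<close> the faces of a tetrahedron,
  \<open>x\<^sub>1 - x\<^sub>2 + x\<^sub>3 - x\<^sub>4 = 0\<close> and \<open>x\<^sub>i\<^sup>2 = 0\<close>; squaring \<open>x\<^sub>1 - x\<^sub>2 = x\<^sub>4 - x\<^sub>3\<close> gives the exchange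
  of the two pairs, multiplying the relation by \<open>x\<^sub>1\<close> gives the cyclic identity.\<close>

lemma pair_form_exchange:
  assumes K: "\<phi> \<in> config_forms"
  shows "pair_form \<phi> a b c d = pair_form \<phi> c d a b"
proof -
  note e = config_formsD(1)[OF K]
  have 1: "triangle_form \<phi> x y z a b d = triangle_form \<phi> x y z c a b 
      + triangle_form \<phi> x y z c b d + triangle_form \<phi> x y z c d a" for x y z
    using triangle_form_cocycle2[OF e, of x y z a b d c] by simp
  have z: "triangle_form \<phi> a b c a b c = 0" "triangle_form \<phi> a b d a b d = 0"
    "triangle_form \<phi> c b d c b d = 0" "triangle_form \<phi> c d a c d a = 0"
    using config_formsD(3)[OF K] by auto
  have s1: "triangle_form \<phi> a b d c b d = triangle_form \<phi> c b d a b d"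
    "triangle_form \<phi> a b d c d a = triangle_form \<phi> c d a a b d"
    "triangle_form \<phi> a b d c a b = triangle_form \<phi> a b c a b d"
    "triangle_form \<phi> c b d c d a = triangle_form \<phi> c d a c b d"
    "triangle_form \<phi> c b d c a b = triangle_form \<phi> a b c c b d"
    "triangle_form \<phi> c d a c a b = triangle_form \<phi> a b c c d a"
    "triangle_form \<phi> a b c c a b = triangle_form \<phi> a b c a b c"
    using triangle_form_sym[OF e] triangle_form_rotate by metis+
  \<comment> \<open>The vanishing square of the face \<open>a b d\<close> contains each mixed
    product of the other three faces twice, so a factor 2 has to be cancelled.\<close>
  have half: "u = v" if "2 * u = 2 * v" for u v :: complex
    using that by simp
  have s2: "triangle_form \<phi> c d a c b d = - triangle_form \<phi> c d a c d b"
    by (rule triangle_form_swap56[OF e])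
  show ?thesis unfolding pair_form_def
    using 1[of a b d] 1[of a b c] 1[of c b d] 1[of c d a] z s1 s2
      half[of "triangle_form \<phi> a b c c b d + triangle_form \<phi> a b c c d a" "triangle_form \<phi> c d a c d b"]
    by (simp add: algebra_simps)
qed

lemma pair_form_cyclic:
  assumes K: "\<phi> \<in> config_forms"
  shows "pair_form \<phi> a b c d + pair_form \<phi> a c b d + pair_form \<phi> a d b c = 0"
proof -
  note e = config_formsD(1)[OF K]
  have 1: "triangle_form \<phi> a b d b c d = triangle_form \<phi> a b d a b c 
      + triangle_form \<phi> a b d a c d + triangle_form \<phi> a b d a d b"
    using triangle_form_cocycle2[OF e, of a b d b c d a] by simp
  have "triangle_form \<phi> a b d a d b = 0"
    using triangle_form_swap56[OF e, of a b d a b d] config_formsD(3)[OF K, of a b d] by simp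
  moreover have "triangle_form \<phi> a b d a c d = pair_form \<phi> a d b c"
    unfolding pair_form_def using triangle_form_swap23[OF e, of a d b] triangle_form_swap56[OF e, of a d b a d c]
    by simp
  moreover have "triangle_form \<phi> a b d a b c = pair_form \<phi> a b c d"
    using pair_form_swap[OF e] unfolding pair_form_def by metis
  moreover have "triangle_form \<phi> a b d b c d = - pair_form \<phi> b d a c"
    using triangle_form_swap56[OF e, of b d a b d c] triangle_form_rotate[of \<phi> b d a]
    unfolding pair_form_def by simp
  moreover have "pair_form \<phi> b d a c = pair_form \<phi> a c b d" by (rule pair_form_exchange[OF K])
  ultimately show ?thesis using 1 by (simp add: eq_neg_iff_add_eq_0 algebra_simps)
qed

section \<open>The alternating part of a form and its coboundary\<close>

definition wedge_form where
  "wedge_form \<phi> a b c d = \<phi> a b c d - \<phi> a c b d + \<phi> a d b c"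

text \<open>\<open>wedge_form\<close> with every edge replaced by its cone from \<open>x\<close>, so
  that \<open>pull_form\<close> permutes the five vertices without reference to
  \<open>0\<close>.\<close>

definition simplex_form where
  "simplex_form \<phi> x a b c d =
    triangle_form \<phi> x a b x c d - triangle_form \<phi> x a c x b d + triangle_form \<phi> x a d x b c"

lemma simplex_form_pull: "edge_form \<phi> \<Longrightarrow>
  simplex_form (pull_form \<sigma> \<phi>) x a b c d = simplex_form \<phi> (\<sigma> x) (\<sigma> a) (\<sigma> b) (\<sigma> c) (\<sigma> d)"
  unfolding simplex_form_def by (simp add: triangle_form_pull)

text \<open>Up to a factor, \<open>wedge_form\<close> is the alternating part of
  \<open>\<phi>\<close>, and the right-hand side is its simplicial coboundary. Products of two edges
  at \<open>x\<close> are symmetric in their far ends and cancel in the alternating sum.\<close>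

lemma simplex_form_boundary:
  assumes e: "edge_form \<phi>"
  shows "simplex_form \<phi> x a b c d = wedge_form \<phi> a b c d - wedge_form \<phi> x b c d
    + wedge_form \<phi> x a c d - wedge_form \<phi> x a b d + wedge_form \<phi> x a b c"
  unfolding simplex_form_def triangle_form_def wedge_form_def
  using edge_form_antisym1[OF e, of b x] edge_form_antisym1[OF e, of c x] edge_form_antisym1[OF e, of d x]
   edge_form_antisym2[OF e, of _ _ b x] edge_form_antisym2[OF e, of _ _ c x] edge_form_antisym2[OF e, of _ _ d x]
   edge_form_sym[OF e, of a b x] edge_form_sym[OF e, of a c x] edge_form_sym[OF e, of a d x]
   edge_form_sym[OF e, of b c x] edge_form_sym[OF e, of b d x] edge_form_sym[OF e, of c d x]
   edge_form_sym[OF e, of x b x a] edge_form_sym[OF e, of x c x a] edge_form_sym[OF e, of x d x a]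
   edge_form_sym[OF e, of x c x b] edge_form_sym[OF e, of x d x b] edge_form_sym[OF e, of x d x c]
  by simp

lemma wedge_form_swap:
  assumes e: "edge_form \<phi>"
  shows "wedge_form \<phi> b a c d = - wedge_form \<phi> a b c d" "wedge_form \<phi> a c b d = - wedge_form \<phi> a b c d"
    "wedge_form \<phi> a b d c = - wedge_form \<phi> a b c d"
  unfolding wedge_form_def
  using edge_form_antisym1[OF e, of b a c d] edge_form_sym[OF e, of a d b c] edge_form_sym[OF e, of a c b d]
    edge_form_antisym2[OF e, of a b d c] edge_form_antisym2[OF e, of a d c b] edge_form_antisym2[OF e, of a c d b]
  by simp_all

lemma wedge_form_rotate:
  assumes e: "edge_form \<phi>"
  shows "wedge_form \<phi> b y c d = - wedge_form \<phi> y b c d" "wedge_form \<phi> b c y d = wedge_form \<phi> y b c d"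
    "wedge_form \<phi> b c d y = - wedge_form \<phi> y b c d"
  by (simp_all add: wedge_form_swap(1)[OF e, of b y] wedge_form_swap(2)[OF e, of b c y]
      wedge_form_swap(3)[OF e, of b c d y])

text \<open>The coboundary of a coboundary vanishes on the six vertices
  \<open>x, y, a, b, c, d\<close>. Arranged in this way it says that a certain combination of values
  at \<open>x\<close> is independent of \<open>x\<close>, which makes a later summation over
  \<open>x\<close> trivial.\<close>

lemma simplex_form_cocycle:
  assumes e: "edge_form \<phi>"
  shows "simplex_form \<phi> x a b c d - simplex_form \<phi> x y b c d - simplex_form \<phi> x a y c d
    - simplex_form \<phi> x a b y d - simplex_form \<phi> x a b c y = simplex_form \<phi> y a b c d"
  unfolding simplex_form_boundary[OF e]
  by (simp add: wedge_form_rotate[OF e, where y = y])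

lemma simplex_form_swap:
  assumes e: "edge_form \<phi>"
  shows "simplex_form \<phi> x b a c d = - simplex_form \<phi> x a b c d"
    "simplex_form \<phi> x a c b d = - simplex_form \<phi> x a b c d"
    "simplex_form \<phi> x a b d c = - simplex_form \<phi> x a b c d"
proof -
  note w = simplex_form_boundary[OF e]
  show "simplex_form \<phi> x b a c d = - simplex_form \<phi> x a b c d"
    unfolding w by (simp add: wedge_form_swap(1)[OF e, where a = a and b = b]
      wedge_form_swap(2)[OF e, where a = x and b = a and c = b])
  show "simplex_form \<phi> x a c b d = - simplex_form \<phi> x a b c d"
    unfolding w by (simp add: wedge_form_swap(2)[OF e, where b = b and c = c]
      wedge_form_swap(3)[OF e, where b = a and c = b and d = c])
  show "simplex_form \<phi> x a b d c = - simplex_form \<phi> x a b c d"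
    unfolding w by (simp add: wedge_form_swap(3)[OF e, where c = c and d = d])
qed

text \<open>The triangles on \<open>0, i, j\<close> and \<open>0, i, k\<close> recover the products
  of two edges that meet. For the three ways to match \<open>a, b, c, d\<close> into two edges, the
  pair relations make the values equal up to sign, and the alternating relation then says that three
  times the value is zero.\<close>

lemma config_form_eq0I:
  assumes K: "\<phi> \<in> config_forms"
   and p: "\<And>a b c d. {a,b,c,d} \<subseteq> S \<Longrightarrow> pair_form \<phi> a b c d = 0"
   and w: "\<And>x a b c d. {x,a,b,c,d} \<subseteq> S \<Longrightarrow> simplex_form \<phi> x a b c d = 0"
   and S: "0 \<in> S" "{a,b,c,d} \<subseteq> S"
  shows "\<phi> a b c d = 0"
proof -
  note e = config_formsD(1)[OF K]
  have 1: "\<phi> i j i k = 0" if "{i,j,k} \<subseteq> S" for i j k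
    using p[of 0 i j k] S that triangle_form_0[OF K] unfolding pair_form_def by simp
  have 2: "\<phi> j i i k = 0" if "{i,j,k} \<subseteq> S" for i j k
    using 1[OF that] edge_form_antisym1[OF e, of j i i k] by simp
  have 3: "\<phi> i j k i = 0" if "{i,j,k} \<subseteq> S" for i j k
    using 1[OF that] edge_form_antisym2[OF e, of i j i k] by simp
  have 4: "\<phi> j i k i = 0" if "{i,j,k} \<subseteq> S" for i j k
    using 2[OF that] edge_form_antisym2[OF e, of j i i k] by simp
  have w0: "\<phi> a b c d - \<phi> a c b d + \<phi> a d b c = 0"
    using w[of 0 a b c d] S unfolding simplex_form_def triangle_form_0[OF K] by simp
  have p2: "\<phi> j k l i + \<phi> k i j l = 0" if "{i,j,k,l} \<subseteq> S" for i j k l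
    using p[of i j k l] that unfolding pair_form_def triangle_form_def
    by (simp add: 1 2 3 4)
  have P: "\<phi> b c d a + \<phi> c a b d = 0" "\<phi> c b d a + \<phi> b a c d = 0"
    using p2[of a b c d] p2[of a c b d] S by auto
  have f1: "\<phi> b c d a = - \<phi> a d b c"
    by (subst edge_form_sym[OF e], rule edge_form_antisym1[OF e])
  have f2: "\<phi> c b d a = - \<phi> b c d a" and f3: "\<phi> c a b d = - \<phi> a c b d" and f4: "\<phi> b a c d = - \<phi> a b c d"
    by (rule edge_form_antisym1[OF e])+
  have g1: "- \<phi> a d b c - \<phi> a c b d = 0" using P(1) unfolding f1 f3 by simp
  have g2: "\<phi> a d b c - \<phi> a b c d = 0" using P(2) unfolding f2 f1 f4 by simp
  have "x = 0" if "- z - y = 0" "z - x = 0" "x - y + z = 0" for x y z :: complex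
  proof -
    have z: "z = x" using that(2) by simp
    have y: "y = - z" using that(1) by (metis eq_iff_diff_eq_0)
    have "3 * x = 0" using that(3) unfolding y z by simp
    then show ?thesis by simp
  qed
  from this[OF g1 g2 w0] show ?thesis .
qed

section \<open>Vanishing of tensors from their contractions\<close>

text \<open>Abstracts the symmetries of \<open>pair_form\<close>, over a finite vertex set so that
  indices can be contracted by summation.\<close>

locale pair_tensor =
  fixes q :: quad_form and S :: "nat set"
  assumes fin: "finite S" and card_S: "card S \<ge> 6"
    and swap1: "\<And>a b c d. q b a c d = q a b c d"
    and swap2: "\<And>a b c d. q a b d c = q a b c d"
    and exchange: "\<And>a b c d. q a b c d = q c d a b"
    and cyclic: "\<And>a b c d. q a b c d + q a c b d + q a d b c = 0"
    and diag: "\<And>a b c. q a b c c = 0"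
    and meet: "\<And>a b d. q a b a d = 0"
begin

text \<open>The tensors \<open>u\<close>, \<open>s\<close>, \<open>r\<close> are detected by the shapes \<open>(n - 1, 2)\<close>, \<open>(n - 2, 2, 1)\<close>, \<open>(n - 3, 2, 2)\<close>.\<close>

definition s where "s a b c = (\<Sum>d\<in>S. q a b c d)"
definition u where "u a b = (\<Sum>c\<in>S. s a b c)"
definition r where "r a c b d = q a b c d - q a d c b"

lemma q_eq0: "q a b c c = 0" "q a a c d = 0" "q a b a d = 0" "q a b b d = 0" "q a b c a = 0" "q a b c b = 0"
  using diag meet swap1 swap2 exchange by metis+

lemma s_swap: "s b a c = s a b c" and s_eq0: "s a a c = 0" "s a b a = 0" "s a b b = 0"
  unfolding s_def by (simp_all add: swap1[of b a] q_eq0)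

lemma u_swap: "u b a = u a b" and u_eq0: "u a a = 0"
  unfolding u_def by (simp_all add: s_swap[of b a] s_eq0)

lemma s_cyclic: "s a b c + s a c b + s b c a = 0"
proof -
  have "s b c a = (\<Sum>d\<in>S. q a d b c)" unfolding s_def by (metis exchange)
  then have "s a b c + s a c b + s b c a = (\<Sum>d\<in>S. q a b c d + q a c b d + q a d b c)"
    unfolding s_def by (simp add: sum.distrib)
  then show ?thesis by (simp add: cyclic)
qed

text \<open>Summing the cyclic identity over \<open>b\<close> gives \<open>u a c\<close> and two
  copies of the sum on the left, which agree because \<open>exchange\<close> makes that sum
  symmetric in \<open>a\<close> and \<open>c\<close>.\<close>

lemma sum_s: "2 * (\<Sum>b\<in>S. s a b c) = - u a c"
proof -
  define P where "P a c = (\<Sum>b\<in>S. s a b c)" for a c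
  have "P a c = P c a"
    unfolding P_def s_def by (subst sum.swap, subst exchange, rule refl)
  have "0 = (\<Sum>b\<in>S. s a b c + s a c b + s b c a)" by (simp add: s_cyclic)
  also have "\<dots> = P a c + u a c + P c a"
    unfolding P_def u_def by (simp add: sum.distrib s_swap[of _ c])
  finally show ?thesis using \<open>P a c = P c a\<close> unfolding P_def[symmetric]
    by (simp add: eq_neg_iff_add_eq_0 algebra_simps)
qed

text \<open>Summing \<open>s a b c\<close> over \<open>b\<close> and \<open>c\<close> in the two
  orders expresses one total both as a row sum of \<open>u\<close> and as minus half of it.\<close>

lemma sum_u: "(\<Sum>b\<in>S. u a b) = 0"
proof -
  have "2 * (\<Sum>b\<in>S. u a b) = (\<Sum>c\<in>S. 2 * (\<Sum>b\<in>S. s a b c))"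
    unfolding u_def by (subst sum.swap) (simp add: sum_distrib_left)
  also have "\<dots> = - (\<Sum>b\<in>S. u a b)" by (simp add: sum_s sum_negf)
  finally have "3 * (\<Sum>b\<in>S. u a b) = 0" by (simp add: eq_neg_iff_add_eq_0)
  then show ?thesis by simp
qed

lemma sum_diff_insert: 
  fixes f :: "nat \<Rightarrow> complex"
  assumes "distinct xs" "set xs \<subseteq> S" 
  shows "(\<Sum>x\<in>S - set xs. f x) = (\<Sum>x\<in>S. f x) - sum_list (map f xs)"
  using assms fin by (simp add: sum_diff sum_list_distinct_conv_sum_set)

lemma card_diff: 
  assumes "distinct xs" "set xs \<subseteq> S" 
  shows "card (S - set xs) = card S - length xs"
  using assms fin by (metis card_Diff_subset distinct_card List.finite_set)

text \<open>Used after summing an identity over all but a few vertices: \<open>k\<close> counts the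
  vertices that are left, and the correction from the excluded ones keeps the total coefficient
  positive even for \<open>k = 0\<close>.\<close>

lemma scale_eq0: 
  fixes x :: complex
  shows "0 = of_nat k * x + x \<Longrightarrow> x = 0" "0 = of_nat k * x + 2 * x \<Longrightarrow> x = 0"
proof -
  have "x = 0" if "0 = of_nat k * x + of_nat (Suc m) * x" for m
  proof -
    have "of_nat (k + Suc m) * x = 0" using that by (simp add: algebra_simps)
    then show "x = 0" by (simp only: mult_eq_0_iff of_nat_eq_0_iff) auto
  qed
  from this[of 0] this[of 1] show "0 = of_nat k * x + x \<Longrightarrow> x = 0" "0 = of_nat k * x + 2 * x \<Longrightarrow> x = 0"
    by simp_all
qed

text \<open>\<open>E\<close> is what polytabloids of shape \<open>(n - 1, 2)\<close> measure. Summed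
  over \<open>x\<close>, it says that \<open>u a b\<close> does not depend on \<open>b\<close>,
  because the row sums of \<open>u\<close> vanish; a row that is constant off the diagonal, zero on
  it and of sum zero is zero.\<close>

lemma u_eq0I:
  assumes E: "\<And>x a y b. distinct [x,a,y,b] \<Longrightarrow> {x,a,y,b} \<subseteq> S \<Longrightarrow> u a b - u x b - u a y + u x y = 0"
  assumes "a \<in> S" "b \<in> S"
  shows "u a b = 0"
proof -
  have step: "u a b = u a y" if "distinct [a,b,y]" "{a,b,y} \<subseteq> S" for a b y
  proof -
    define D where "D = S - set [a,b,y]"
    have D: "(\<Sum>x\<in>D. f x) = (\<Sum>x\<in>S. f x) - (f a + f b + f y)" for f :: "nat \<Rightarrow> complex"
      unfolding D_def using sum_diff_insert[of "[a,b,y]" f] that by (simp add: add.assoc)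
    have "0 = (\<Sum>x\<in>D. u a b - u x b - u a y + u x y)"
      using E[of _ a y b] that unfolding D_def by (intro sum.neutral[symmetric]) auto
    also have "\<dots> = of_nat (card D) * (u a b - u a y) - (\<Sum>x\<in>D. u b x) + (\<Sum>x\<in>D. u y x)"
      by (simp add: sum.distrib sum_subtractf algebra_simps u_swap[of _ b] u_swap[of _ y])
    \<comment> \<open>The full row sums are zero, so only the entries at the three excluded vertices
      are left.\<close>
    also have "\<dots> = of_nat (card D) * (u a b - u a y) + (u a b - u a y)"
      unfolding D by (simp add: sum_u u_eq0 u_swap[of b a] u_swap[of y a] u_swap[of y b])
    finally have "u a b - u a y = 0"
      by (rule scale_eq0(1))
    then show ?thesis by simp
  qed
  show ?thesis
  proof (cases "a = b")
    case False
    have "0 = (\<Sum>y\<in>S - set [a]. u a y)"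
      using sum_diff_insert[of "[a]" "u a"] assms by (simp add: sum_u u_eq0)
    also have "\<dots> = (\<Sum>y\<in>S - set [a]. u a b)"
      using step[of a b] assms False by (intro sum.cong) (auto, metis)
    finally have "of_nat (card (S - set [a])) * u a b = 0" by simp
    then show ?thesis 
      using card_diff[of "[a]"] assms card_S by (auto simp: of_nat_diff)
  qed (simp add: u_eq0)
qed

text \<open>\<open>F\<close> antisymmetrizes \<open>s a b c\<close> over the column
  \<open>x, a, c\<close>, and \<open>E\<close> says that the result does not depend on the remaining
  entry. Its sum over that entry is zero because \<open>u\<close> vanishes, hence \<open>F\<close>
  vanishes on distinct vertices. Summing over \<open>x\<close> then makes \<open>s\<close> symmetric
  in its outer indices; with the symmetry in the first two, all three terms of the cyclic identity
  coincide.\<close>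

lemma s_eq0I:
  assumes u: "\<And>a b. a \<in> S \<Longrightarrow> b \<in> S \<Longrightarrow> u a b = 0"
  assumes F: "\<And>x a c b. F x a c b = s a b c + s c b x + s x b a - s x b c - s c b a - s a b x"
  assumes E: "\<And>x a c y b. distinct [x,a,c,y,b] \<Longrightarrow> {x,a,c,y,b} \<subseteq> S \<Longrightarrow> F x a c b = F x a c y"
  assumes "a \<in> S" "b \<in> S" "c \<in> S"
  shows "s a b c = 0"
proof -
  have u1: "(\<Sum>y\<in>S. s a b y) = 0" if "a \<in> S" "b \<in> S" for a b
    using u[OF that] unfolding u_def by simp
  have u2: "(\<Sum>y\<in>S. s a y b) = 0" if "a \<in> S" "b \<in> S" for a b
    using u[OF that] sum_s[of a b] by simp
  have F0: "F x a c b = 0" if d: "distinct [x,a,c,b]" "{x,a,c,b} \<subseteq> S" for x a c b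
  proof -
    define D where "D = S - set [x,a,c]"
    have D: "(\<Sum>y\<in>D. f y) = (\<Sum>y\<in>S. f y) - (f x + f a + f c)" for f :: "nat \<Rightarrow> complex"
      unfolding D_def using sum_diff_insert[of "[x,a,c]" f] that by (simp add: add.assoc)
    have "(\<Sum>y\<in>D. F x a c b) = (\<Sum>y\<in>D. F x a c y)"
    proof (rule sum.cong[OF refl])
      fix y assume "y \<in> D"
      then show "F x a c b = F x a c y"
        by (cases "y = b") (use that in \<open>auto simp: D_def intro!: E\<close>)
    qed
    also have "\<dots> = 0"
      unfolding F sum.distrib sum_subtractf D using that
      by (simp add: u2 s_eq0 s_swap[of c a] s_swap[of x a] s_swap[of x c])
    finally have "of_nat (card D) * F x a c b = 0" by simp
    moreover have "card D > 0" using card_diff[of "[x,a,c]"] that card_S unfolding D_def by simp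
    ultimately show ?thesis by simp
  qed
  have G0: "s a b c = s c b a" if d: "distinct [a,c,b]" "{a,c,b} \<subseteq> S" for a c b
  proof -
    define D where "D = S - set [a,c,b]"
    have D: "(\<Sum>y\<in>D. f y) = (\<Sum>y\<in>S. f y) - (f a + f c + f b)" for f :: "nat \<Rightarrow> complex"
      unfolding D_def using sum_diff_insert[of "[a,c,b]" f] that by (simp add: add.assoc)
    have "0 = (\<Sum>x\<in>D. F x a c b)"
      using that by (intro sum.neutral[symmetric] ballI F0) (auto simp: D_def)
    also have "\<dots> = of_nat (card D) * (s a b c - s c b a)
        + (\<Sum>x\<in>D. s c b x) + (\<Sum>x\<in>D. s b x a) - (\<Sum>x\<in>D. s b x c) - (\<Sum>x\<in>D. s a b x)"
      unfolding F by (simp add: sum.distrib sum_subtractf algebra_simps s_swap[of _ b])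
    also have "\<dots> = of_nat (card D) * (s a b c - s c b a) + 2 * (s a b c - s c b a)"
      unfolding D using that by (simp add: u1 u2 s_eq0 s_swap[of b c] s_swap[of b a])
    finally have "s a b c - s c b a = 0"
      by (rule scale_eq0(2))
    then show ?thesis by simp
  qed
  show ?thesis
  proof (cases "distinct [a,c,b]")
    case True
    have "s a b c = s c b a" "s a c b = s b c a"
      using G0[of a c b] G0[of a b c] True assms by auto
    moreover have "s c b a = s b c a" by (rule s_swap)
    ultimately have "3 * s a b c = 0" 
      using s_cyclic[of a b c] by simp
    then show ?thesis by simp
  qed (auto simp: s_eq0)
qed

text \<open>\<open>r\<close> is the curvature tensor in the usual convention: antisymmetric in each
  pair and subject to the first Bianchi identity.\<close>

lemma r_swap1: "r c a b d = - r a c b d" and r_swap2: "r a c d b = - r a c b d"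
  and r_bianchi: "r a c b d + r a b d c + r a d c b = 0"
  and r_eq0: "r a c a d = 0" "r a c b a = 0" "r a c c d = 0" "r a c b c = 0" "r a c b b = 0" "r a a b d = 0"
proof -
  show "r c a b d = - r a c b d" "r a c d b = - r a c b d"
    unfolding r_def using exchange[of c b a d] exchange[of c d a b] by simp_all
  show "r a c b d + r a b d c + r a d c b = 0"
    unfolding r_def using swap2[of a d b c] swap2[of a b c d] swap2[of a c b d] by simp
  show "r a c a d = 0" "r a c b a = 0" "r a c c d = 0" "r a c b c = 0" "r a c b b = 0" "r a a b d = 0"
    unfolding r_def by (simp_all add: q_eq0)
qed

text \<open>\<open>E\<close> sums \<open>r a c b d\<close> over the cyclic rotations of
  \<open>x, a, c\<close> and of \<open>y, b, d\<close>. For fixed \<open>y, b, d\<close> it is a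
  cocycle condition on the antisymmetric function \<open>R a c\<close> defined below; summing over
  \<open>x\<close> with vanishing row sums gives \<open>R a c = 0\<close>. The same argument in the
  second pair of indices finishes the proof.\<close>

lemma r_eq0I:
  assumes s: "\<And>a b c. a \<in> S \<Longrightarrow> b \<in> S \<Longrightarrow> c \<in> S \<Longrightarrow> s a b c = 0"
  assumes E: "\<And>x a c y b d. distinct [x,a,c,y,b,d] \<Longrightarrow> {x,a,c,y,b,d} \<subseteq> S \<Longrightarrow> 
     r a c b d + r a c d y + r a c y b + r c x b d + r c x d y + r c x y b + r x a b d + r x a d y + r x a y b = 0"
  assumes mem: "a \<in> S" "b \<in> S" "c \<in> S" "d \<in> S"
  shows "r a c b d = 0"
proof -
  have s2: "(\<Sum>x\<in>S. r a c b x) = 0" if "a \<in> S" "b \<in> S" "c \<in> S" for a b c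
    using s[of a b c] s[of c b a] that unfolding r_def s_def exchange[of a _ c] by (simp add: sum_subtractf)
  have s4: "(\<Sum>x\<in>S. r c x b d) = 0" if "c \<in> S" "b \<in> S" "d \<in> S" for b c d
  proof -
    have "(\<Sum>x\<in>S. r c x b d) = s c b d - s c d b"
      unfolding r_def s_def by (simp add: sum_subtractf swap2[of c b _ d] swap2[of c d _ b])
    then show ?thesis using s that by simp
  qed
  have R0: "r a c b d + r a c d y + r a c y b = 0" if d: "distinct [a,c,y,b,d]" "{a,c,y,b,d} \<subseteq> S" for a c b d y
  proof -
    define R where "R a c = r a c b d + r a c d y + r a c y b" for a c
    define D where "D = S - set [a,c,y,b,d]"
    have D: "(\<Sum>x\<in>D. f x) = (\<Sum>x\<in>S. f x) - (f a + f c + f y + f b + f d)" for f :: "nat \<Rightarrow> complex"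
      unfolding D_def using sum_diff_insert[of "[a,c,y,b,d]" f] that by (simp add: add.assoc)
    have sumR: "(\<Sum>x\<in>S. R c x) = 0" if "c \<in> S" for c
      unfolding R_def sum.distrib using s4 that d by simp
    \<comment> \<open>The entries at the excluded vertices \<open>y, b, d\<close> add up to zero by
      the Bianchi identity.\<close>
    have side: "R c y + R c b + R c d = 0" for c
      unfolding R_def using r_bianchi[of c y b d]
      by (simp add: r_eq0 r_swap2[of c b d y] algebra_simps)
    have RS: "R c a = - R a c" "R c c = 0" for a c
      unfolding R_def by (simp_all add: r_swap1[of c a] r_eq0)
    have "0 = (\<Sum>x\<in>D. R a c + R c x + R x a)"
      using that E unfolding R_def by (intro sum.neutral[symmetric] ballI) (auto simp: D_def algebra_simps)
    also have "\<dots> = of_nat (card D) * R a c + (\<Sum>x\<in>D. R c x) - (\<Sum>x\<in>D. R a x)"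
      by (simp add: sum.distrib sum_subtractf RS(1)[of _ a] sum_negf)
    also have "\<dots> = of_nat (card D) * R a c + 2 * R a c"
      unfolding D using side[of a] side[of c] that by (simp add: sumR RS(2) RS(1)[of c a] algebra_simps)
    finally have "R a c = 0"
      by (rule scale_eq0(2))
    then show ?thesis unfolding R_def .
  qed
  show ?thesis
  proof (cases "distinct [a,c,b,d]")
    case True
    define D where "D = S - set [a,c,b,d]"
    have D: "(\<Sum>y\<in>D. f y) = (\<Sum>y\<in>S. f y) - (f a + f c + f b + f d)" for f :: "nat \<Rightarrow> complex"
      unfolding D_def using sum_diff_insert[of "[a,c,b,d]" f] True mem by (simp add: add.assoc)
    have "0 = (\<Sum>y\<in>D. r a c b d + r a c d y + r a c y b)"
      using True mem R0 by (intro sum.neutral[symmetric] ballI) (auto simp: D_def)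
    also have "\<dots> = of_nat (card D) * r a c b d + (\<Sum>y\<in>D. r a c d y) - (\<Sum>y\<in>D. r a c b y)"
      by (simp add: sum.distrib sum_subtractf r_swap2[of a c _ b] sum_negf)
    also have "\<dots> = of_nat (card D) * r a c b d + 2 * r a c b d"
      unfolding D using mem by (simp add: s2 r_eq0 r_swap2[of a c d b] algebra_simps)
    finally show ?thesis
      by (rule scale_eq0(2))
  qed (auto simp: r_eq0)
qed

text \<open>If \<open>r\<close> vanishes, the second and fourth index of \<open>q\<close> may be
  exchanged, which makes the three terms of the cyclic identity equal.\<close>

lemma q_eq0I:
  assumes "\<And>a b c d. {a,b,c,d} \<subseteq> S \<Longrightarrow> r a c b d = 0" and m: "{a,b,c,d} \<subseteq> S"
  shows "q a b c d = 0"
proof -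
  have "q a b c d = q a d c b" if "{a,b,c,d} \<subseteq> S" for a b c d
    using assms(1)[OF that] unfolding r_def by simp
  from this[of a b c d] this[of a b d c] m have "q a b c d = q a d c b" "q a b d c = q a c d b" by auto
  then have "3 * q a b c d = 0" using cyclic[of a b c d] swap2 by simp
  then show ?thesis by simp
qed

end

section \<open>Column antisymmetrizers on Specht modules\<close>

definition tabloids :: "nat set \<Rightarrow> nat list \<Rightarrow> (nat \<Rightarrow> nat) set"
  where "tabloids S l = tabloid S ` tableaux S l"

lemma finite_young_diagram: "finite (young_diagram l)"
proof -
  have "young_diagram l \<subseteq> {..<length l} \<times> {..<Suc (sum_list l)}"
    unfolding young_diagram_def by (auto simp: less_Suc_eq_le intro: order.trans[OF less_imp_le elem_le_sum_list])
  then show ?thesis by (rule finite_subset) simp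
qed

lemma tableaux_comp: "T \<in> tableaux S l \<Longrightarrow> \<pi> permutes S \<Longrightarrow> T \<circ> \<pi> \<in> tableaux S l"
  unfolding tableaux_def by (auto intro: bij_betw_trans[OF permutes_imp_bij])

lemma tabloid_comp: "\<pi> permutes S \<Longrightarrow> tabloid S (T \<circ> \<pi>) = tabloid S T \<circ> \<pi>"
  unfolding tabloid_def by (auto simp: fun_eq_iff permutes_in_image)

lemma tabloids_comp:
  assumes "t \<in> tabloids S l" "\<pi> permutes S"
  shows "t \<circ> \<pi> \<in> tabloids S l"
proof -
  obtain T where T: "T \<in> tableaux S l" "t = tabloid S T"
    using assms(1) unfolding tabloids_def by blast
  have "t \<circ> \<pi> = tabloid S (T \<circ> \<pi>)" unfolding T(2) by (rule tabloid_comp[OF assms(2), symmetric])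
  then show ?thesis unfolding tabloids_def using tableaux_comp[OF T(1) assms(2)] by blast
qed

lemma tabloid_less:
  assumes "t \<in> tabloids S l" "i \<in> S"
  shows "t i < length l"
proof -
  obtain T where T: "bij_betw T S (young_diagram l)" "t = tabloid S T"
    using assms(1) unfolding tabloids_def tableaux_def by blast
  then have "T i \<in> young_diagram l" using assms(2) unfolding bij_betw_def by blast
  then show ?thesis unfolding T(2) tabloid_def young_diagram_def using assms(2) by auto
qed

lemma finite_tabloids: 
  assumes "finite S"
  shows "finite (tabloids S l)"
proof (rule finite_subset)
  show "tabloids S l \<subseteq> S \<rightarrow>\<^sub>E {..<length l}"
  proof
    fix t assume t: "t \<in> tabloids S l"
    have "t \<in> extensional S" using t unfolding tabloids_def tabloid_def by auto
    then show "t \<in> S \<rightarrow>\<^sub>E {..<length l}" using tabloid_less[OF t] by (auto simp: PiE_def)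
  qed
qed (use assms in \<open>simp add: finite_PiE\<close>)

lemma column_stabilizer_permutes: "\<pi> \<in> column_stabilizer S T \<Longrightarrow> \<pi> permutes S"
  unfolding column_stabilizer_def by simp

lemma column_stabilizer_comp:
  "\<pi> \<in> column_stabilizer S T \<Longrightarrow> \<tau> \<in> column_stabilizer S T \<Longrightarrow> \<pi> \<circ> \<tau> \<in> column_stabilizer S T"
  unfolding column_stabilizer_def by (auto simp: permutes_compose permutes_in_image)

lemma column_stabilizer_inv:
  assumes "\<pi> \<in> column_stabilizer S T"
  shows "inv_into UNIV \<pi> \<in> column_stabilizer S T"
proof -
  have p: "\<pi> permutes S" using assms by (rule column_stabilizer_permutes)
  have "snd (T (inv_into UNIV \<pi> i)) = snd (T i)" if "i \<in> S" for i
  proof -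
    have "inv_into UNIV \<pi> i \<in> S" using permutes_inv[OF p] that by (simp add: permutes_in_image)
    then have "snd (T (\<pi> (inv_into UNIV \<pi> i))) = snd (T (inv_into UNIV \<pi> i))"
      using assms unfolding column_stabilizer_def by blast
    then show ?thesis by (simp add: permutes_inverses[OF p])
  qed
  then show ?thesis using permutes_inv[OF p] unfolding column_stabilizer_def by simp
qed

lemma finite_column_stabilizer: "finite S \<Longrightarrow> finite (column_stabilizer S T)"
  unfolding column_stabilizer_def by (rule finite_subset[OF _ finite_permutations[of S]]) auto

lemma transpose_column_stabilizer:
  "a \<in> S \<Longrightarrow> b \<in> S \<Longrightarrow> snd (T a) = snd (T b) \<Longrightarrow> Transposition.transpose a b \<in> column_stabilizer S T"
  unfolding column_stabilizer_def by (auto simp: permutes_swap_id Transposition.transpose_def)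

lemma sign_column_stabilizer_comp:
  assumes "finite S" "\<pi> \<in> column_stabilizer S T" "\<tau> \<in> column_stabilizer S T"
  shows "sign (\<pi> \<circ> \<tau>) = sign \<pi> * sign \<tau>"
  using assms by (intro sign_compose) (auto simp: permutation_permutes dest: column_stabilizer_permutes)

lemma sum_column_stabilizer_left:
  assumes "\<pi> \<in> column_stabilizer S T"
  shows "(\<Sum>\<tau>\<in>column_stabilizer S T. f (\<pi> \<circ> \<tau>)) = (\<Sum>\<tau>\<in>column_stabilizer S T. f \<tau>)"
proof (rule sum.reindex_bij_witness[of _ "\<lambda>\<tau>. inv_into UNIV \<pi> \<circ> \<tau>" "\<lambda>\<tau>. \<pi> \<circ> \<tau>"])
  have "\<pi> permutes S" using assms by (rule column_stabilizer_permutes)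
  then show "inv_into UNIV \<pi> \<circ> (\<pi> \<circ> a) = a" "\<pi> \<circ> (inv_into UNIV \<pi> \<circ> a) = a" for a
    by (simp_all add: o_assoc permutes_inv_o)
qed (use assms in \<open>auto intro: column_stabilizer_comp column_stabilizer_inv\<close>)

lemma sum_column_stabilizer_inv:
  "(\<Sum>\<tau>\<in>column_stabilizer S T. f (inv_into UNIV \<tau>)) = (\<Sum>\<tau>\<in>column_stabilizer S T. f \<tau>)"
  by (rule sum.reindex_bij_witness[of _ "inv_into UNIV" "inv_into UNIV"])
    (simp_all add: column_stabilizer_inv permutes_inv_inv[OF column_stabilizer_permutes[of _ S T]])

lemma polytabloid_alt:
  "polytabloid S T t = (\<Sum>\<pi>\<in>column_stabilizer S T. of_int (sign \<pi>) *
     (if t = tabloid S T \<circ> inv_into UNIV \<pi> then 1 else 0))"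
  unfolding polytabloid_def
proof (intro sum.cong refl)
  fix \<pi> assume "\<pi> \<in> column_stabilizer S T"
  then have "inv_into UNIV \<pi> permutes S" by (intro permutes_inv column_stabilizer_permutes)
  then show "of_int (sign \<pi>) * (if t = tabloid S (T \<circ> inv_into UNIV \<pi>) then 1 else 0)
      = of_int (sign \<pi>) * (if t = tabloid S T \<circ> inv_into UNIV \<pi> then 1 else 0)"
    by (simp only: tabloid_comp)
qed

lemma polytabloid_outside:
  assumes "T \<in> tableaux S l" "t \<notin> tabloids S l"
  shows "polytabloid S T t = 0"
  unfolding polytabloid_alt
proof (intro sum.neutral ballI)
  fix \<pi> assume "\<pi> \<in> column_stabilizer S T"
  then have "tabloid S T \<circ> inv_into UNIV \<pi> \<in> tabloids S l"
    using assms(1) by (intro tabloids_comp permutes_inv column_stabilizer_permutes) (simp add: tabloids_def)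
  then show "of_int (sign \<pi>) * (if t = tabloid S T \<circ> inv_into UNIV \<pi> then 1 else 0) = 0"
    using assms(2) by auto
qed

section \<open>Specht modules as invariant subspaces\<close>

lemma specht_ops [simp]:
  "\<zero>\<^bsub>specht S l\<^esub> = (\<lambda>t. 0)" "x \<oplus>\<^bsub>specht S l\<^esub> y = (\<lambda>t. x t + y t)"
  "a \<odot>\<^bsub>specht S l\<^esub> x = (\<lambda>t. a * x t)" "act (specht S l) \<sigma> x = (\<lambda>t. x (t \<circ> \<sigma>))"
  unfolding specht_def by simp_all

lemma specht_carrier: "v \<in> carrier (specht S l) \<longleftrightarrow>
    (\<exists>B a. finite B \<and> B \<subseteq> tableaux S l \<and> v = (\<lambda>t. \<Sum>T\<in>B. a T * polytabloid S T t))"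
  by (simp add: specht_def)

lemma spechtI: "finite B \<Longrightarrow> B \<subseteq> tableaux S l \<Longrightarrow> v = (\<lambda>t. \<Sum>T\<in>B. a T * polytabloid S T t) 
    \<Longrightarrow> v \<in> carrier (specht S l)"
  unfolding specht_carrier by blast

lemma spechtE: assumes "v \<in> carrier (specht S l)"
  obtains B a where "finite B" "B \<subseteq> tableaux S l" "v = (\<lambda>t. \<Sum>T\<in>B. a T * polytabloid S T t)"
  using assms unfolding specht_carrier by blast

lemma specht_outside:
  assumes "v \<in> carrier (specht S l)" "t \<notin> tabloids S l"
  shows "v t = 0"
proof -
  obtain B a where v: "finite B" "B \<subseteq> tableaux S l" "v = (\<lambda>t. \<Sum>T\<in>B. a T * polytabloid S T t)"
    using assms(1) by (rule spechtE)
  have "v t = (\<Sum>T\<in>B. 0)"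
    unfolding v(3)
  proof (rule sum.cong[OF refl])
    fix T assume "T \<in> B"
    then have "polytabloid S T t = 0" using polytabloid_outside[OF _ assms(2)] v(2) by blast
    then show "a T * polytabloid S T t = 0" by simp
  qed
  then show ?thesis by simp
qed

lemma polytabloid_specht: "T \<in> tableaux S l \<Longrightarrow> polytabloid S T \<in> carrier (specht S l)"
  by (rule spechtI[of "{T}" _ _ _ "\<lambda>_. 1"]) simp_all

lemma specht_zero: "(\<lambda>t. 0) \<in> carrier (specht S l)"
  by (rule spechtI[of "{}"]) auto

lemma specht_smult: assumes "v \<in> carrier (specht S l)" shows "(\<lambda>t. c * v t) \<in> carrier (specht S l)"
proof -
  obtain B a where v: "finite B" "B \<subseteq> tableaux S l" "v = (\<lambda>t. \<Sum>T\<in>B. a T * polytabloid S T t)"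
    using assms by (rule spechtE)
  show ?thesis
    by (rule spechtI[OF v(1,2), of _ "\<lambda>T. c * a T"]) (simp add: v(3) sum_distrib_left mult.assoc)
qed

lemma specht_add:
  assumes "v \<in> carrier (specht S l)" "w \<in> carrier (specht S l)"
  shows "(\<lambda>t. v t + w t) \<in> carrier (specht S l)"
proof -
  obtain B a where v: "finite B" "B \<subseteq> tableaux S l" "v = (\<lambda>t. \<Sum>T\<in>B. a T * polytabloid S T t)"
    using assms(1) by (rule spechtE)
  obtain C b where w: "finite C" "C \<subseteq> tableaux S l" "w = (\<lambda>t. \<Sum>T\<in>C. b T * polytabloid S T t)"
    using assms(2) by (rule spechtE)
  define a' b' where "a' T = (if T \<in> B then a T else 0)" and "b' T = (if T \<in> C then b T else 0)" for T
  have "v t = (\<Sum>T\<in>B\<union>C. a' T * polytabloid S T t)" for t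
    unfolding v(3) a'_def using v w by (intro sum.mono_neutral_cong_left) auto
  moreover have "w t = (\<Sum>T\<in>B\<union>C. b' T * polytabloid S T t)" for t
    unfolding w(3) b'_def using v w by (intro sum.mono_neutral_cong_left) auto
  ultimately show ?thesis
    by (intro spechtI[of "B \<union> C" S l _ "\<lambda>T. a' T + b' T"])
      (use v w in \<open>auto simp: sum.distrib distrib_right\<close>)
qed

lemma column_stabilizer_conj:
  assumes \<sigma>: "\<sigma> permutes S" and \<pi>: "\<pi> \<in> column_stabilizer S T"
  shows "\<sigma> \<circ> \<pi> \<circ> inv_into UNIV \<sigma> \<in> column_stabilizer S (T \<circ> inv_into UNIV \<sigma>)"
proof -
  have i: "inv_into UNIV \<sigma> permutes S" using \<sigma> by (rule permutes_inv)
  have "snd (T (\<pi> (inv_into UNIV \<sigma> i))) = snd (T (inv_into UNIV \<sigma> i))" if "i \<in> S" for i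
    using \<pi> that permutes_in_image[OF i] unfolding column_stabilizer_def by auto
  then show ?thesis
    using permutes_compose[OF permutes_compose[OF i column_stabilizer_permutes[OF \<pi>]] \<sigma>]
    unfolding column_stabilizer_def by (simp add: permutes_inverses[OF \<sigma>] o_assoc)
qed

text \<open>Conjugation by \<open>\<sigma>\<close> carries the column stabilizer of a tableau to
  that of its translate and preserves signs. The inverse appears because the action composes the
  argument of a vector with \<open>\<sigma>\<close>.\<close>

lemma polytabloid_act:
  assumes S: "finite S" and \<sigma>: "\<sigma> permutes S"
  shows "polytabloid S T (t \<circ> \<sigma>) = polytabloid S (T \<circ> inv_into UNIV \<sigma>) t"
proof -
  let ?i = "inv_into UNIV \<sigma>"
  have i: "?i permutes S" and ii: "inv_into UNIV ?i = \<sigma>"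
    using \<sigma> by (simp_all add: permutes_inv permutes_inv_inv)
  have Ti: "T \<circ> ?i \<circ> \<sigma> = T" using \<sigma> by (simp add: o_assoc[symmetric] permutes_inv_o)
  show ?thesis unfolding polytabloid_alt
  proof (rule sum.reindex_bij_witness[of _ "\<lambda>\<pi>. ?i \<circ> \<pi> \<circ> \<sigma>" "\<lambda>\<pi>. \<sigma> \<circ> \<pi> \<circ> ?i"])
    fix \<pi> assume \<pi>: "\<pi> \<in> column_stabilizer S T"
    note p = column_stabilizer_permutes[OF \<pi>]
    show "?i \<circ> (\<sigma> \<circ> \<pi> \<circ> ?i) \<circ> \<sigma> = \<pi>"
      by (simp add: fun_eq_iff permutes_inverses[OF \<sigma>])
    show "\<sigma> \<circ> \<pi> \<circ> ?i \<in> column_stabilizer S (T \<circ> ?i)" by (rule column_stabilizer_conj[OF \<sigma> \<pi>])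
    have pp: "permutation \<sigma>" "permutation \<pi>" "permutation ?i"
      using S \<sigma> p i permutation_permutes by blast+
    have s: "sign (\<sigma> \<circ> \<pi> \<circ> ?i) = sign \<pi>"
      using pp by (simp add: sign_compose permutation_compose sign_inverse) 
    have v: "inv_into UNIV (\<sigma> \<circ> \<pi> \<circ> ?i) = \<sigma> \<circ> inv_into UNIV \<pi> \<circ> ?i"
      using permutes_bij[OF \<sigma>] permutes_bij[OF p] permutes_bij[OF i] ii
      by (simp add: o_inv_distrib bij_comp o_assoc)
    have "(t = tabloid S (T \<circ> ?i) \<circ> inv_into UNIV (\<sigma> \<circ> \<pi> \<circ> ?i)) = (t \<circ> \<sigma> = tabloid S T \<circ> inv_into UNIV \<pi>)"
      unfolding v tabloid_comp[OF i] fun_eq_iff o_apply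
      using permutes_inverses[OF \<sigma>] by metis
    then show "of_int (sign (\<sigma> \<circ> \<pi> \<circ> ?i)) * (if t = tabloid S (T \<circ> ?i) \<circ> inv_into UNIV (\<sigma> \<circ> \<pi> \<circ> ?i) then 1 else 0)
       = of_int (sign \<pi>) * (if t \<circ> \<sigma> = tabloid S T \<circ> inv_into UNIV \<pi> then 1 else 0)"
      unfolding s by presburger
  next
    fix \<pi> assume \<pi>: "\<pi> \<in> column_stabilizer S (T \<circ> ?i)"
    show "\<sigma> \<circ> (?i \<circ> \<pi> \<circ> \<sigma>) \<circ> ?i = \<pi>"
      by (simp add: fun_eq_iff permutes_inverses[OF \<sigma>])
    show "?i \<circ> \<pi> \<circ> \<sigma> \<in> column_stabilizer S T"
      using column_stabilizer_conj[OF i \<pi>] by (simp add: ii Ti)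
  qed
qed

lemma specht_act:
  assumes S: "finite S" and v: "v \<in> carrier (specht S l)" and \<sigma>: "\<sigma> permutes S"
  shows "(\<lambda>t. v (t \<circ> \<sigma>)) \<in> carrier (specht S l)"
proof -
  let ?i = "inv_into UNIV \<sigma>"
  obtain B a where v: "finite B" "B \<subseteq> tableaux S l" "v = (\<lambda>t. \<Sum>T\<in>B. a T * polytabloid S T t)"
    using v by (rule spechtE)
  have Ti: "T \<circ> ?i \<circ> \<sigma> = T" for T using \<sigma> by (simp add: o_assoc[symmetric] permutes_inv_o)
  have inj: "inj_on (\<lambda>T. T \<circ> ?i) B" by (rule inj_on_inverseI[of _ "\<lambda>T. T \<circ> \<sigma>"]) (rule Ti)
  show ?thesis
    by (rule spechtI[of "(\<lambda>T. T \<circ> ?i) ` B" _ _ _ "\<lambda>T. a (T \<circ> \<sigma>)"])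
      (use v \<sigma> in \<open>auto simp: sum.reindex[OF inj] Ti polytabloid_act[OF S \<sigma>] intro!: tableaux_comp permutes_inv\<close>)
qed

section \<open>Signed column sums acting on functions of tabloids\<close>

definition column_antisym where
  "column_antisym S T v t = (\<Sum>\<pi>\<in>column_stabilizer S T. of_int (sign \<pi>) * v (t \<circ> \<pi>))" for v :: "(nat \<Rightarrow> nat) \<Rightarrow> complex"

text \<open>The scalar \<open>c\<close> for which the signed column sum of \<open>T\<close> maps
  \<open>v\<close> to \<open>c\<close> times the polytabloid of \<open>T\<close>. It is at the same
  time the standard scalar product of \<open>v\<close> with that polytabloid.\<close>

definition polytabloid_coeff where
  "polytabloid_coeff S T v = (\<Sum>\<pi>\<in>column_stabilizer S T. of_int (sign \<pi>) * v (tabloid S T \<circ> inv_into UNIV \<pi>))"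
    for v :: "(nat \<Rightarrow> nat) \<Rightarrow> complex"

text \<open>The transposition of \<open>a\<close> and \<open>b\<close> lies in the column stabilizer
  and fixes \<open>t\<close>, so composing with it changes the sign of the whole sum.\<close>

lemma column_antisym_eq0:
  assumes S: "finite S" and ab: "a \<in> S" "b \<in> S" "a \<noteq> b" "snd (T a) = snd (T b)" "t a = t b"
  shows "column_antisym S T v t = 0"
proof -
  let ?\<tau> = "Transposition.transpose a b"
  have \<tau>: "?\<tau> \<in> column_stabilizer S T" using ab transpose_column_stabilizer by blast
  have t: "t \<circ> ?\<tau> = t" using ab by (auto simp: fun_eq_iff Transposition.transpose_def)
  have "column_antisym S T v t = (\<Sum>\<pi>\<in>column_stabilizer S T. of_int (sign (?\<tau> \<circ> \<pi>)) * v (t \<circ> (?\<tau> \<circ> \<pi>)))"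
    unfolding column_antisym_def by (rule sum_column_stabilizer_left[OF \<tau>, symmetric])
  also have "\<dots> = (\<Sum>\<pi>\<in>column_stabilizer S T. - (of_int (sign \<pi>) * v (t \<circ> \<pi>)))"
    using sign_column_stabilizer_comp[OF S \<tau>] ab(3)
    by (intro sum.cong refl) (simp add: o_assoc t sign_swap_id)
  also have "\<dots> = - column_antisym S T v t" unfolding column_antisym_def by (rule sum_negf)
  finally show ?thesis by simp
qed

text \<open>Meant for the row numbers that a tabloid assigns to the entries of one column.\<close>

lemma sum_card_le:
  fixes A :: "nat set"
  assumes "finite A"
  shows "\<Sum>{..<card A} \<le> \<Sum>A \<and> (\<Sum>A = \<Sum>{..<card A} \<longrightarrow> A = {..<card A})"
  using assms
proof (induction A rule: finite_linorder_max_induct)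
  case (insert b A)
  have "A \<subseteq> {..<b}" "b \<notin> A" using insert.hyps by auto
  then have "card A \<le> b" using card_mono[of "{..<b}" A] by simp
  then show ?case using insert.IH \<open>b \<notin> A\<close> insert.hyps by (auto simp: lessThan_Suc)
qed simp

text \<open>The entries of a column of \<open>T\<close> have distinct row numbers in
  \<open>t\<close>, so these sum to at least \<open>0 + 1 + 2 + ...\<close>, with equality only for
  an initial segment. Over all columns the totals for \<open>t\<close> and \<open>T\<close> agree,
  because both have shape \<open>l\<close>; hence equality holds in every column. Taking the row
  from \<open>t\<close> and the column from \<open>T\<close> is therefore again a tableau, and the
  permutation sought matches it with \<open>T\<close>.\<close>

lemma column_stabilizer_exists:
  assumes S: "finite S" and T: "T \<in> tableaux S l" and t: "t \<in> tabloids S l" and l: "sorted_wrt (\<ge>) l"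
    and nobad: "\<And>a b. a \<in> S \<Longrightarrow> b \<in> S \<Longrightarrow> snd (T a) = snd (T b) \<Longrightarrow> t a = t b \<Longrightarrow> a = b"
  obtains \<pi> where "\<pi> \<in> column_stabilizer S T" "t = tabloid S T \<circ> inv_into UNIV \<pi>"
proof -
  have bT: "bij_betw T S (young_diagram l)" using T unfolding tableaux_def by simp
  define col where "col c = {i\<in>S. snd (T i) = c}" for c
  have fcol: "finite (col c)" for c using S unfolding col_def by auto
  have injF: "inj_on (\<lambda>i. fst (T i)) (col c)" for c
    using bT unfolding col_def bij_betw_def inj_on_def by (simp add: prod_eq_iff)
  have injt: "inj_on t (col c)" for c
    using nobad unfolding col_def inj_on_def by simp
  have imF: "(\<lambda>i. fst (T i)) ` col c = {..<card (col c)}" for c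
  proof -
    have im: "(\<lambda>i. fst (T i)) ` col c = {r. (r, c) \<in> young_diagram l}" (is "_ = ?R")
      using bT unfolding col_def bij_betw_def image_iff by (force simp: prod_eq_iff)
    \<comment> \<open>Row lengths do not increase, so a column of the diagram is closed under moving
      up.\<close>
    have down: "r' \<in> ?R" if "r \<in> ?R" "r' < r" for r r'
      using that l sorted_wrt_nth_less[OF l, of r' r] unfolding young_diagram_def by auto
    have "finite ?R" unfolding im[symmetric] using fcol by simp
    have "?R = {..<card ?R}"
    proof -
      have "\<exists>k. ?R = {..<k}"
      proof (cases "?R = {}")
        case False
        have "?R = {..<Suc (Max ?R)}"
        proof (intro Set.set_eqI iffI)
          fix x assume "x \<in> {..<Suc (Max ?R)}"
          then have "x = Max ?R \<or> x < Max ?R" by auto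
          then show "x \<in> ?R" using Max_in[OF \<open>finite ?R\<close> False] down[of "Max ?R" x] by metis
        qed (use Max_ge[OF \<open>finite ?R\<close>] in \<open>simp add: less_Suc_eq_le\<close>)
        then show ?thesis by blast
      qed auto
      then show ?thesis by (metis card_lessThan)
    qed
    moreover have "card ?R = card (col c)" unfolding im[symmetric] by (rule card_image[OF injF])
    ultimately show ?thesis using im by simp
  qed
  obtain T' where T': "bij_betw T' S (young_diagram l)" "t = tabloid S T'"
    using t unfolding tabloids_def tableaux_def by auto
  have tout: "t x = undefined" if "x \<notin> S" for x using T'(2) that unfolding tabloid_def by simp
  have "(\<Sum>i\<in>S. t i) = (\<Sum>i\<in>S. fst (T' i))" unfolding T'(2) tabloid_def by simp
  also have "\<dots> = (\<Sum>i\<in>S. fst (T i))"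
    using sum.reindex_bij_betw[OF T'(1), of fst] sum.reindex_bij_betw[OF bT, of fst] by simp
  finally have tot: "(\<Sum>i\<in>S. fst (T i)) = (\<Sum>i\<in>S. t i)" by simp
  let ?C = "(\<lambda>i. snd (T i)) ` S"
  have gen: "(\<Sum>i\<in>S. f i) = (\<Sum>c\<in>?C. \<Sum>i\<in>col c. f i)" for f :: "nat \<Rightarrow> nat"
    unfolding col_def by (rule sum.image_gen[OF S])
  have F: "(\<Sum>i\<in>col c. fst (T i)) = \<Sum>{..<card (col c)}" for c
    using sum.reindex[OF injF, of "\<lambda>x. x" c] unfolding imF by simp
  have tt: "(\<Sum>i\<in>col c. t i) = \<Sum>(t ` col c)" "card (t ` col c) = card (col c)" for c
    using sum.reindex[OF injt, of "\<lambda>x. x" c] card_image[OF injt] by simp_all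
  have im: "t ` col c = (\<lambda>i. fst (T i)) ` col c" if "c \<in> ?C" for c
  proof -
    \<comment> \<open>Columnwise inequalities with equal totals are equalities.\<close>
    have "(\<Sum>i\<in>col c. fst (T i)) = (\<Sum>i\<in>col c. t i)"
    proof (rule sum_mono_inv[OF _ _ that])
      show "(\<Sum>c\<in>?C. \<Sum>i\<in>col c. fst (T i)) = (\<Sum>c\<in>?C. \<Sum>i\<in>col c. t i)"
        using tot unfolding gen .
      show "(\<Sum>i\<in>col c. fst (T i)) \<le> (\<Sum>i\<in>col c. t i)" for c
        using sum_card_le[of "t ` col c"] fcol unfolding F tt by simp
    qed (use S in simp)
    then show ?thesis
      using sum_card_le[of "t ` col c"] fcol unfolding F tt imF by simp
  qed
  define T2 where "T2 j = (t j, snd (T j))" for j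
  have inj2: "inj_on T2 S" unfolding T2_def inj_on_def using nobad by simp
  have sub2: "T2 ` S \<subseteq> young_diagram l"
  proof
    fix x assume "x \<in> T2 ` S"
    then obtain j where j: "j \<in> S" "x = (t j, snd (T j))" unfolding T2_def by auto
    then have "t j \<in> t ` col (snd (T j))" unfolding col_def by simp
    then obtain i where "i \<in> col (snd (T j))" "fst (T i) = t j" using im[of "snd (T j)"] j(1) by auto
    then have "T i = x" "i \<in> S" using j(2) unfolding col_def by (auto simp: prod_eq_iff)
    then show "x \<in> young_diagram l" using bT unfolding bij_betw_def by auto
  qed
  have "card (T2 ` S) = card (young_diagram l)"
    using card_image[OF inj2] bij_betw_same_card[OF bT] by simp
  then have im2: "T2 ` S = young_diagram l"
    using card_subset_eq[OF finite_young_diagram sub2] by simp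
  have b2: "bij_betw T2 S (young_diagram l)" using inj2 im2 unfolding bij_betw_def by simp
  define \<pi> where "\<pi> x = (if x \<in> S then inv_into S T2 (T x) else x)" for x
  have b\<pi>: "bij_betw \<pi> S S"
  proof -
    have "bij_betw (inv_into S T2 \<circ> T) S S"
      using bij_betw_trans[OF bT bij_betw_inv_into[OF b2]] .
    then show ?thesis by (rule bij_betw_cong[THEN iffD1, rotated]) (simp add: \<pi>_def)
  qed
  have p: "\<pi> permutes S" by (rule bij_imp_permutes[OF b\<pi>]) (simp add: \<pi>_def)
  have T2\<pi>: "T2 (\<pi> x) = T x" if "x \<in> S" for x
    unfolding \<pi>_def using that f_inv_into_f[of "T x" T2 S] bT im2 unfolding bij_betw_def by auto
  have c: "\<pi> \<in> column_stabilizer S T"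
    unfolding column_stabilizer_def using p T2\<pi> unfolding T2_def by (auto simp: prod_eq_iff)
  have "t \<circ> \<pi> = tabloid S T"
  proof
    fix x show "(t \<circ> \<pi>) x = tabloid S T x"
      using T2\<pi>[of x] tout[of x] unfolding T2_def tabloid_def by (cases "x \<in> S") (auto simp: prod_eq_iff \<pi>_def)
  qed
  then have "t = tabloid S T \<circ> inv_into UNIV \<pi>"
    using permutes_inv_o(1)[OF p] by (metis comp_assoc comp_id)
  with c show ?thesis by (rule that)
qed

text \<open>Row and column determine an entry, and both permutations leave the column
  unchanged.\<close>

lemma tabloid_column_inj:
  assumes T: "T \<in> tableaux S l" and \<pi>: "\<pi> \<in> column_stabilizer S T" and \<tau>: "\<tau> \<in> column_stabilizer S T"
    and ab: "a \<in> S" "b \<in> S" "tabloid S T (\<pi> a) = tabloid S T (\<tau> b)" "snd (T a) = snd (T b)"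
  shows "\<pi> a = \<tau> b"
proof -
  have "\<pi> a \<in> S" "\<tau> b \<in> S"
    using ab permutes_in_image[OF column_stabilizer_permutes[OF \<pi>]]
      permutes_in_image[OF column_stabilizer_permutes[OF \<tau>]] by auto
  moreover have "snd (T (\<pi> a)) = snd (T (\<tau> b))"
    using \<pi> \<tau> ab unfolding column_stabilizer_def by simp
  ultimately have "T (\<pi> a) = T (\<tau> b)" using ab(3) unfolding tabloid_def by (simp add: prod_eq_iff)
  moreover have "inj_on T S" using T unfolding tableaux_def by (simp add: bij_betw_imp_inj_on)
  ultimately show ?thesis using \<open>\<pi> a \<in> S\<close> \<open>\<tau> b \<in> S\<close> by (simp add: inj_on_eq_iff)
qed

lemma tabloid_stabilizer_inj:
  assumes T: "T \<in> tableaux S l" and \<pi>: "\<pi> \<in> column_stabilizer S T" and \<tau>: "\<tau> \<in> column_stabilizer S T"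
    and eq: "tabloid S T \<circ> inv_into UNIV \<pi> = tabloid S T \<circ> inv_into UNIV \<tau>"
  shows "\<pi> = \<tau>"
proof -
  note p = column_stabilizer_permutes[OF \<pi>] and q = column_stabilizer_permutes[OF \<tau>]
  have "inv_into UNIV \<pi> x = inv_into UNIV \<tau> x" for x
  proof (cases "x \<in> S")
    case True
    moreover have "tabloid S T (inv_into UNIV \<pi> x) = tabloid S T (inv_into UNIV \<tau> x)"
      using fun_cong[OF eq, of x] by simp
    ultimately show ?thesis
      using tabloid_column_inj[OF T column_stabilizer_inv[OF \<pi>] column_stabilizer_inv[OF \<tau>], of x x] by blast
  qed (use permutes_not_in[OF permutes_inv[OF p]] permutes_not_in[OF permutes_inv[OF q]] in simp)
  then have "inv_into UNIV \<pi> = inv_into UNIV \<tau>" by (rule ext)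
  then have "inv_into UNIV (inv_into UNIV \<pi>) = inv_into UNIV (inv_into UNIV \<tau>)" by (rule arg_cong)
  then show ?thesis unfolding permutes_inv_inv[OF p] permutes_inv_inv[OF q] .
qed

text \<open>Either \<open>t\<close> has two entries of one column of \<open>T\<close> in the same
  row, and both sides vanish, or \<open>t\<close> is a column permutation of the tabloid of
  \<open>T\<close>. In the second case reindexing the signed sum by that permutation extracts its
  sign, which is the value of the polytabloid at \<open>t\<close>.\<close>

lemma column_antisym_same_shape:
  assumes S: "finite S" and T: "T \<in> tableaux S l" and t: "t \<in> tabloids S l" and l: "sorted_wrt (\<ge>) l"
  shows "column_antisym S T v t = polytabloid_coeff S T v * polytabloid S T t"
proof (cases "\<exists>a b. a \<in> S \<and> b \<in> S \<and> a \<noteq> b \<and> snd (T a) = snd (T b) \<and> t a = t b")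
  case True
  then obtain a b where ab: "a \<in> S" "b \<in> S" "a \<noteq> b" "snd (T a) = snd (T b)" "t a = t b" by blast
  have "polytabloid S T t = 0"
    unfolding polytabloid_alt
  proof (intro sum.neutral ballI)
    fix \<pi> assume \<pi>: "\<pi> \<in> column_stabilizer S T"
    note i = column_stabilizer_inv[OF \<pi>]
    have "t \<noteq> tabloid S T \<circ> inv_into UNIV \<pi>"
    proof
      assume "t = tabloid S T \<circ> inv_into UNIV \<pi>"
      then have "inv_into UNIV \<pi> a = inv_into UNIV \<pi> b"
        using tabloid_column_inj[OF T i i] ab by simp
      then show False using ab(3) permutes_inj[OF column_stabilizer_permutes[OF i]] by (simp add: inj_eq)
    qed
    then show "of_int (sign \<pi>) * (if t = tabloid S T \<circ> inv_into UNIV \<pi> then 1 else 0) = 0" by simp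
  qed
  then show ?thesis using column_antisym_eq0[OF S ab] by simp
next
  case False
  then obtain p where p: "p \<in> column_stabilizer S T" "t = tabloid S T \<circ> inv_into UNIV p"
    using column_stabilizer_exists[OF S T t l] by (metis (no_types, lifting))
  note pp = column_stabilizer_permutes[OF p(1)]
  have "polytabloid S T t = (\<Sum>\<pi>\<in>column_stabilizer S T. if \<pi> = p then of_int (sign \<pi>) else 0)"
    unfolding polytabloid_alt p(2) using tabloid_stabilizer_inj[OF T p(1)]
    by (intro sum.cong refl) auto
  then have e: "polytabloid S T t = of_int (sign p)"
    using p(1) finite_column_stabilizer[OF S, of T] by simp
  have "column_antisym S T v t = (\<Sum>\<pi>\<in>column_stabilizer S T. of_int (sign (p \<circ> \<pi>)) * v (t \<circ> (p \<circ> \<pi>)))"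
    unfolding column_antisym_def by (rule sum_column_stabilizer_left[OF p(1), symmetric])
  also have "\<dots> = (\<Sum>\<pi>\<in>column_stabilizer S T. of_int (sign p) * (of_int (sign \<pi>) * v (tabloid S T \<circ> \<pi>)))"
    using sign_column_stabilizer_comp[OF S p(1)] permutes_inv_o(2)[OF pp]
    by (intro sum.cong refl) (simp add: p(2) o_assoc, simp add: o_assoc[symmetric])
  also have "\<dots> = of_int (sign p) * (\<Sum>\<pi>\<in>column_stabilizer S T. 
      of_int (sign (inv_into UNIV \<pi>)) * v (tabloid S T \<circ> inv_into UNIV \<pi>))"
    unfolding sum_distrib_left by (rule sum_column_stabilizer_inv[symmetric])
  also have "\<dots> = of_int (sign p) * polytabloid_coeff S T v"
  proof -
    have "sign (inv_into UNIV \<pi>) = sign \<pi>" if "\<pi> \<in> column_stabilizer S T" for \<pi>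
      by (rule sign_inverse) (use that S in \<open>auto simp: permutation_permutes dest: column_stabilizer_permutes\<close>)
    then show ?thesis unfolding polytabloid_coeff_def by simp
  qed
  finally show ?thesis using e by simp
qed

text \<open>The hypothesis says that \<open>v\<close> is orthogonal to all polytabloids. These are
  real-valued and span the module, so \<open>v\<close> is orthogonal to itself for the hermitian
  product.\<close>

lemma specht_eq0I:
  assumes S: "finite S" and v: "v \<in> carrier (specht S l)"
    and c: "\<And>T. T \<in> tableaux S l \<Longrightarrow> polytabloid_coeff S T v = 0"
  shows "v = (\<lambda>t. 0)"
proof -
  obtain B a where B: "finite B" "B \<subseteq> tableaux S l" "v = (\<lambda>t. \<Sum>T\<in>B. a T * polytabloid S T t)"
    using v by (rule spechtE)
  have fin: "finite (tabloids S l)" by (rule finite_tabloids[OF S])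
  have co: "(\<Sum>t\<in>tabloids S l. v t * polytabloid S T t) = 0" if T: "T \<in> tableaux S l" for T
  proof -
    have "(\<Sum>t\<in>tabloids S l. v t * polytabloid S T t) = 
       (\<Sum>\<pi>\<in>column_stabilizer S T. \<Sum>t\<in>tabloids S l. 
        if t = tabloid S T \<circ> inv_into UNIV \<pi> then of_int (sign \<pi>) * v t else 0)"
      unfolding polytabloid_alt sum_distrib_left by (subst sum.swap) (intro sum.cong refl, simp)
    also have "\<dots> = polytabloid_coeff S T v"
      unfolding polytabloid_coeff_def
    proof (intro sum.cong refl)
      fix \<pi> assume "\<pi> \<in> column_stabilizer S T"
      then have "tabloid S T \<circ> inv_into UNIV \<pi> \<in> tabloids S l"
        using T by (intro tabloids_comp permutes_inv column_stabilizer_permutes) (simp add: tabloids_def)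
      then show "(\<Sum>t\<in>tabloids S l. if t = tabloid S T \<circ> inv_into UNIV \<pi> then of_int (sign \<pi>) * v t else 0)
        = of_int (sign \<pi>) * v (tabloid S T \<circ> inv_into UNIV \<pi>)"
        using fin by simp
    qed
    finally show ?thesis using c[OF T] by simp
  qed
  have real: "cnj (polytabloid S T t) = polytabloid S T t" for T t
    unfolding polytabloid_def by (auto intro!: sum.cong)
  have "(\<Sum>t\<in>tabloids S l. v t * cnj (v t)) = (\<Sum>t\<in>tabloids S l. \<Sum>T\<in>B. cnj (a T) * (v t * polytabloid S T t))"
    by (intro sum.cong refl) (subst (2) B(3), simp add: real sum_distrib_left algebra_simps)
  also have "\<dots> = (\<Sum>T\<in>B. cnj (a T) * (\<Sum>t\<in>tabloids S l. v t * polytabloid S T t))"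
    by (subst sum.swap) (simp add: sum_distrib_left)
  also have "\<dots> = 0" using co B(2) by (intro sum.neutral) auto
  finally have "complex_of_real (\<Sum>t\<in>tabloids S l. (cmod (v t))\<^sup>2) = 0"
    by (simp add: complex_mult_cnj cmod_power2 cmod_def)
  then have "(\<Sum>t\<in>tabloids S l. (cmod (v t))\<^sup>2) = 0" by (simp only: of_real_eq_0_iff)
  then have "v t = 0" if "t \<in> tabloids S l" for t
    using that fin by (simp add: sum_nonneg_eq_0_iff)
  then show ?thesis using specht_outside[OF v] by (intro ext) blast
qed

lemma card_bij_betw_Collect:
  assumes "bij_betw f A B"
  shows "card {x\<in>A. P (f x)} = card {y\<in>B. P y}"
proof (rule bij_betw_same_card)
  show "bij_betw f {x\<in>A. P (f x)} {y\<in>B. P y}"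
    using assms by (auto simp: bij_betw_def inj_on_def)
qed

text \<open>The first row of \<open>t\<close> has more entries than \<open>T\<close> has columns, so
  two of them lie in one column of \<open>T\<close>.\<close>

lemma column_antisym_larger_row:
  assumes S: "finite S" and T: "T \<in> tableaux S l" and l: "sorted_wrt (\<ge>) l"
    and t: "t \<in> tabloids S m" and m: "0 < length m" "l ! 0 < m ! 0"
  shows "column_antisym S T v t = 0"
proof -
  obtain T' where T': "bij_betw T' S (young_diagram m)" "t = tabloid S T'"
    using t unfolding tabloids_def tableaux_def by auto
  have "{i\<in>S. t i = 0} = {i\<in>S. fst (T' i) = 0}" unfolding T'(2) tabloid_def by auto
  moreover have "{x\<in>young_diagram m. fst x = 0} = {0} \<times> {..<m ! 0}"
    using m unfolding young_diagram_def by auto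
  ultimately have c: "card {i\<in>S. t i = 0} = m ! 0"
    using card_bij_betw_Collect[OF T'(1), of "\<lambda>x. fst x = 0"] by simp
  have "snd (T i) < l ! 0" if "i \<in> S" for i
  proof -
    have "T i \<in> young_diagram l" using T that unfolding tableaux_def bij_betw_def by auto
    then show ?thesis using sorted_wrt_nth_less[OF l, of 0 "fst (T i)"] unfolding young_diagram_def
      by (cases "fst (T i) = 0") (auto simp: split_beta)
  qed
  then have "(\<lambda>i. snd (T i)) ` {i\<in>S. t i = 0} \<subseteq> {..<l ! 0}" by auto
  then have "\<not> inj_on (\<lambda>i. snd (T i)) {i\<in>S. t i = 0}"
    using c m(2) card_inj_on_le[of "\<lambda>i. snd (T i)" "{i\<in>S. t i = 0}" "{..<l ! 0}"] by auto
  then show ?thesis unfolding inj_on_def using column_antisym_eq0[OF S] by (metis (mono_tags, lifting) mem_Collect_eq)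
qed

text \<open>The first column of \<open>T\<close> has more entries than \<open>t\<close> has rows, so
  two of them lie in one row of \<open>t\<close>.\<close>

lemma column_antisym_shorter:
  assumes S: "finite S" and T: "T \<in> tableaux S l" and l: "\<And>r. r < length l \<Longrightarrow> 0 < l ! r"
    and t: "t \<in> tabloids S m" and m: "length m < length l"
  shows "column_antisym S T v t = 0"
proof -
  let ?C = "{i\<in>S. snd (T i) = 0}"
  have "{x\<in>young_diagram l. snd x = 0} = {..<length l} \<times> {0}"
    using l unfolding young_diagram_def by auto
  then have c: "card ?C = length l"
    using T card_bij_betw_Collect[of T S "young_diagram l" "\<lambda>x. snd x = 0"] unfolding tableaux_def
    by (simp add: card_cartesian_product)
  have "t ` ?C \<subseteq> {..<length m}" using tabloid_less[OF t] by auto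
  then have "\<not> inj_on t ?C"
    using c m card_inj_on_le[of t ?C "{..<length m}"] by auto
  then show ?thesis unfolding inj_on_def using column_antisym_eq0[OF S] by (metis (mono_tags, lifting) mem_Collect_eq)
qed

text \<open>As many entries as cells are left over, and any bijection between them completes the
  placement.\<close>

lemma tableau_extend:
  assumes S: "finite S" "card S = card (young_diagram l)"
    and f: "inj_on f A" "A \<subseteq> S" "f ` A \<subseteq> young_diagram l"
  obtains T where "T \<in> tableaux S l" "\<And>a. a \<in> A \<Longrightarrow> T a = f a"
proof -
  let ?D = "young_diagram l"
  have "card (S - A) = card (?D - f ` A)"
    using S f by (simp add: card_Diff_subset finite_subset card_image finite_young_diagram)
  then obtain g where g: "bij_betw g (S - A) (?D - f ` A)"
    using S finite_young_diagram finite_same_card_bij by (metis finite_Diff)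
  define T where "T x = (if x \<in> A then f x else g x)" for x
  have "bij_betw T A (f ` A)" using f(1) by (auto simp: bij_betw_def T_def inj_on_def)
  moreover have "bij_betw T (S - A) (?D - f ` A)"
    using g by (rule bij_betw_cong[THEN iffD1, rotated]) (simp add: T_def)
  ultimately have "bij_betw T (A \<union> (S - A)) (f ` A \<union> (?D - f ` A))"
    by (rule bij_betw_combine) auto
  then have "T \<in> tableaux S l" using f unfolding tableaux_def by (simp add: Un_absorb1)
  then show ?thesis by (rule that) (simp add: T_def)
qed

text \<open>From column 2 on every column is a single cell, so the column stabilizer is the product
  of the symmetric groups of the first two columns.\<close>

lemma sum_column_stabilizer_two_columns:
  assumes S: "finite S" and T: "T \<in> tableaux S l"
    and C: "C = {i\<in>S. snd (T i) = 0}" and C': "C' = {i\<in>S. snd (T i) = 1}"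
    and single: "\<And>a b. a \<in> S \<Longrightarrow> b \<in> S \<Longrightarrow> snd (T a) = snd (T b) \<Longrightarrow> 2 \<le> snd (T a) \<Longrightarrow> a = b"
  shows "(\<Sum>\<pi>\<in>column_stabilizer S T. f \<pi>) = 
    (\<Sum>p\<in>{p. p permutes C}. \<Sum>q\<in>{q. q permutes C'}. f (p \<circ> q))" 
proof -
  define res where "res D \<pi> x = (if x \<in> D then \<pi> x else x)" for D and \<pi> :: "nat \<Rightarrow> nat" and x
  have CC: "C \<subseteq> S" "C' \<subseteq> S" "C \<inter> C' = {}" using C C' by auto
  have comp: "(p \<circ> q) x = (if x \<in> C then p x else if x \<in> C' then q x else x)" 
    if "p permutes C" "q permutes C'" for p q x
    using CC permutes_in_image[OF that(2), of x] permutes_not_in[OF that(1), of x]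
      permutes_not_in[OF that(1), of "q x"] permutes_not_in[OF that(2), of x]
    by auto
  have "(\<Sum>\<pi>\<in>column_stabilizer S T. f \<pi>) = (\<Sum>(p,q)\<in>{p. p permutes C} \<times> {q. q permutes C'}. f (p \<circ> q))"
  proof (rule sum.reindex_bij_witness[of _ "\<lambda>(p,q). p \<circ> q" "\<lambda>\<pi>. (res C \<pi>, res C' \<pi>)"])
    fix \<pi> assume \<pi>: "\<pi> \<in> column_stabilizer S T"
    note p = column_stabilizer_permutes[OF \<pi>]
    have snd: "snd (T (\<pi> i)) = snd (T i)" if "i \<in> S" for i using \<pi> that unfolding column_stabilizer_def by simp
    have r: "res D \<pi> permutes D" if D: "D = {i\<in>S. snd (T i) = c}" for D c
    proof (rule bij_imp_permutes)
      have "\<pi> ` D \<subseteq> D" using D snd permutes_in_image[OF p] by auto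
      moreover have "finite D" "inj_on \<pi> D" using S D permutes_inj[OF p] by (auto intro: inj_on_subset)
      ultimately have "bij_betw \<pi> D D" by (simp add: bij_betw_def endo_inj_surj)
      then show "bij_betw (res D \<pi>) D D" by (rule bij_betw_cong[THEN iffD1, rotated]) (simp add: res_def)
    qed (simp add: res_def)
    show "(res C \<pi>, res C' \<pi>) \<in> {p. p permutes C} \<times> {q. q permutes C'}" using r C C' by simp
    show "(case (res C \<pi>, res C' \<pi>) of (p, q) \<Rightarrow> p \<circ> q) = \<pi>"
    proof (unfold prod.case, rule ext)
      fix x
      have "\<pi> x = x" if "x \<notin> C" "x \<notin> C'"
      proof (cases "x \<in> S")
        case True
        then have "snd (T x) \<noteq> 0" "snd (T x) \<noteq> 1" using that C C' by auto
        then have "snd (T x) \<ge> 2" by simp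
        then show ?thesis using single[of "\<pi> x" x] snd True permutes_in_image[OF p] by simp
      qed (use p in \<open>simp add: permutes_not_in\<close>)
      then show "(res C \<pi> \<circ> res C' \<pi>) x = \<pi> x"
        unfolding comp[OF r[OF C] r[OF C']] by (auto simp: res_def)
    qed
    then show "(case (res C \<pi>, res C' \<pi>) of (p, q) \<Rightarrow> f (p \<circ> q)) = f \<pi>" by simp
  next
    fix pq assume "pq \<in> {p. p permutes C} \<times> {q. q permutes C'}"
    then obtain p q where pq: "pq = (p, q)" and p: "p permutes C" and q: "q permutes C'" by auto
    have "p \<circ> q permutes S" using permutes_compose permutes_subset p q CC by metis
    moreover have "snd (T ((p \<circ> q) i)) = snd (T i)" if "i \<in> S" for i
      unfolding comp[OF p q] using C C' permutes_in_image[OF p, of i] permutes_in_image[OF q, of i] by auto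
    ultimately show "(case pq of (p, q) \<Rightarrow> p \<circ> q) \<in> column_stabilizer S T"
      unfolding pq column_stabilizer_def by simp
    show "(res C (case pq of (p, q) \<Rightarrow> p \<circ> q), res C' (case pq of (p, q) \<Rightarrow> p \<circ> q)) = pq"
      unfolding pq prod.case prod.inject fun_eq_iff res_def comp[OF p q]
      using CC p q by (auto simp: permutes_not_in)
  qed
  then show ?thesis by (simp add: sum.cartesian_product)
qed

section \<open>Forms evaluated on polytabloids\<close>

text \<open>Rows are selected by predicates so that an index with the predicate that is always true
  is contracted over all of \<open>S\<close>.\<close>

definition tabloid_form ::
    "nat set \<Rightarrow> (nat \<Rightarrow> bool) \<Rightarrow> (nat \<Rightarrow> bool) \<Rightarrow> (nat \<Rightarrow> bool) \<Rightarrow> (nat \<Rightarrow> bool) \<Rightarrow>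
     quad_form \<Rightarrow> (nat \<Rightarrow> nat) \<Rightarrow> complex"
  where "tabloid_form S P Q R U h t =
    (\<Sum>a\<in>{a\<in>S. P (t a)}. \<Sum>b\<in>{b\<in>S. Q (t b)}. \<Sum>c\<in>{c\<in>S. R (t c)}. \<Sum>d\<in>{d\<in>S. U (t d)}. h a b c d)"

definition specht_form ::
    "nat set \<Rightarrow> nat list \<Rightarrow> (nat \<Rightarrow> bool) \<Rightarrow> (nat \<Rightarrow> bool) \<Rightarrow> (nat \<Rightarrow> bool) \<Rightarrow> (nat \<Rightarrow> bool) \<Rightarrow>
     quad_form \<Rightarrow> ((nat \<Rightarrow> nat) \<Rightarrow> complex) \<Rightarrow> complex"
  where "specht_form S l P Q R U h v = (\<Sum>t\<in>tabloids S l. v t * tabloid_form S P Q R U h t)"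

lemma sum_filter_permute:
  assumes "\<sigma> permutes S"
  shows "(\<Sum>a\<in>{a\<in>S. P (\<sigma> a)}. f (\<sigma> a)) = (\<Sum>a\<in>{a\<in>S. P a}. f a)"
  by (rule sum.reindex_bij_witness[of _ "inv_into UNIV \<sigma>" \<sigma>])
    (use permutes_in_image[OF assms] permutes_in_image[OF permutes_inv[OF assms]] in
      \<open>auto simp: permutes_inverses[OF assms]\<close>)

lemma tabloid_form_permute:
  assumes "\<sigma> permutes S"
  shows "tabloid_form S P Q R U (\<lambda>a b c d. h (\<sigma> a) (\<sigma> b) (\<sigma> c) (\<sigma> d)) (t \<circ> \<sigma>) = tabloid_form S P Q R U h t"
proof -
  note p = sum_filter_permute[OF assms]
  have "(\<Sum>d\<in>{d\<in>S. U (t (\<sigma> d))}. h x y z (\<sigma> d)) = (\<Sum>d\<in>{d\<in>S. U (t d)}. h x y z d)" for x y z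
    by (rule p[where f = "\<lambda>d. h x y z d" and P = "\<lambda>a. U (t a)"])
  moreover have "(\<Sum>c\<in>{c\<in>S. R (t (\<sigma> c))}. \<Sum>d\<in>{d\<in>S. U (t d)}. h x y (\<sigma> c) d)
    = (\<Sum>c\<in>{c\<in>S. R (t c)}. \<Sum>d\<in>{d\<in>S. U (t d)}. h x y c d)" for x y
    by (rule p[where f = "\<lambda>c. \<Sum>d\<in>{d\<in>S. U (t d)}. h x y c d" and P = "\<lambda>a. R (t a)"])
  moreover have "(\<Sum>b\<in>{b\<in>S. Q (t (\<sigma> b))}. \<Sum>c\<in>{c\<in>S. R (t c)}. \<Sum>d\<in>{d\<in>S. U (t d)}. h x (\<sigma> b) c d)
    = (\<Sum>b\<in>{b\<in>S. Q (t b)}. \<Sum>c\<in>{c\<in>S. R (t c)}. \<Sum>d\<in>{d\<in>S. U (t d)}. h x b c d)" for x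
    by (rule p[where f = "\<lambda>b. \<Sum>c\<in>{c\<in>S. R (t c)}. \<Sum>d\<in>{d\<in>S. U (t d)}. h x b c d" and P = "\<lambda>a. Q (t a)"])
  ultimately show ?thesis
    unfolding tabloid_form_def o_apply
    using p[where f = "\<lambda>a. \<Sum>b\<in>{b\<in>S. Q (t b)}. \<Sum>c\<in>{c\<in>S. R (t c)}. \<Sum>d\<in>{d\<in>S. U (t d)}. h a b c d" 
        and P = "\<lambda>a. P (t a)"] by simp
qed

text \<open>Relabelling tabloids and vertices simultaneously changes nothing, so the permutation can
  be moved from the vector to the arguments of \<open>h\<close>.\<close>

lemma specht_form_act:
  assumes \<sigma>: "\<sigma> permutes S"
  shows "specht_form S l P Q R U h (\<lambda>t. v (t \<circ> \<sigma>))
    = specht_form S l P Q R U (\<lambda>a b c d. h (\<sigma> a) (\<sigma> b) (\<sigma> c) (\<sigma> d)) v"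
  unfolding specht_form_def
proof (rule sum.reindex_bij_witness[of _ "\<lambda>t. t \<circ> inv_into UNIV \<sigma>" "\<lambda>t. t \<circ> \<sigma>"])
  fix t assume t: "t \<in> tabloids S l"
  show "t \<circ> \<sigma> \<circ> inv_into UNIV \<sigma> = t" "t \<circ> inv_into UNIV \<sigma> \<circ> \<sigma> = t"
    by (simp_all add: fun_eq_iff permutes_inverses[OF \<sigma>])
  show "t \<circ> \<sigma> \<in> tabloids S l" by (rule tabloids_comp[OF t \<sigma>])
  show "t \<circ> inv_into UNIV \<sigma> \<in> tabloids S l" by (rule tabloids_comp[OF t permutes_inv[OF \<sigma>]])
  show "v (t \<circ> \<sigma>) * tabloid_form S P Q R U (\<lambda>a b c d. h (\<sigma> a) (\<sigma> b) (\<sigma> c) (\<sigma> d)) (t \<circ> \<sigma>)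
    = v (t \<circ> \<sigma>) * tabloid_form S P Q R U h t"
    by (simp add: tabloid_form_permute[OF \<sigma>])
qed

lemma specht_form_add: "specht_form S l P Q R U h (\<lambda>t. v t + w t) = specht_form S l P Q R U h v + specht_form S l P Q R U h w"
  unfolding specht_form_def by (simp add: distrib_right sum.distrib)

lemma specht_form_smult: "specht_form S l P Q R U h (\<lambda>t. c * v t) = c * specht_form S l P Q R U h v"
  unfolding specht_form_def by (simp add: sum_distrib_left mult.assoc)

lemma specht_form_sum: "specht_form S l P Q R U h (\<lambda>t. \<Sum>i\<in>I. v i t) = (\<Sum>i\<in>I. specht_form S l P Q R U h (v i))"
  unfolding specht_form_def by (subst sum.swap) (simp add: sum_distrib_right)

lemma specht_form_zero: "specht_form S l P Q R U h (\<lambda>t. 0) = 0"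
  unfolding specht_form_def by simp

text \<open>Each column permutation is moved from the tabloid to the arguments of \<open>h\<close>,
  so that all summands refer to the rows of \<open>T\<close> itself.\<close>

lemma specht_form_polytabloid:
  assumes S: "finite S" and T: "T \<in> tableaux S l"
  shows "specht_form S l P Q R U h (polytabloid S T) = (\<Sum>\<pi>\<in>column_stabilizer S T. of_int (sign \<pi>) *
     tabloid_form S P Q R U (\<lambda>a b c d. h (\<pi> a) (\<pi> b) (\<pi> c) (\<pi> d)) (tabloid S T))"
proof -
  have "specht_form S l P Q R U h (polytabloid S T) = (\<Sum>\<pi>\<in>column_stabilizer S T.
     \<Sum>t\<in>tabloids S l. if t = tabloid S T \<circ> inv_into UNIV \<pi> then of_int (sign \<pi>) * tabloid_form S P Q R U h t else 0)"
    unfolding specht_form_def polytabloid_alt sum_distrib_right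
    by (subst sum.swap) (intro sum.cong refl, simp)
  also have "\<dots> = (\<Sum>\<pi>\<in>column_stabilizer S T. of_int (sign \<pi>) *
     tabloid_form S P Q R U (\<lambda>a b c d. h (\<pi> a) (\<pi> b) (\<pi> c) (\<pi> d)) (tabloid S T))"
  proof (intro sum.cong refl)
    fix \<pi> assume \<pi>: "\<pi> \<in> column_stabilizer S T"
    note p = column_stabilizer_permutes[OF \<pi>]
    have "tabloid S T \<circ> inv_into UNIV \<pi> \<in> tabloids S l"
      using T by (intro tabloids_comp permutes_inv p) (simp add: tabloids_def)
    moreover have "tabloid_form S P Q R U (\<lambda>a b c d. h (\<pi> a) (\<pi> b) (\<pi> c) (\<pi> d)) (tabloid S T) =
      tabloid_form S P Q R U h (tabloid S T \<circ> inv_into UNIV \<pi>)"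
      using tabloid_form_permute[OF p, of P Q R U h "tabloid S T \<circ> inv_into UNIV \<pi>"]
      by (simp add: o_assoc[symmetric] permutes_inv_o[OF p])
    ultimately show "(\<Sum>t\<in>tabloids S l. if t = tabloid S T \<circ> inv_into UNIV \<pi> 
        then of_int (sign \<pi>) * tabloid_form S P Q R U h t else 0)
      = of_int (sign \<pi>) * tabloid_form S P Q R U (\<lambda>a b c d. h (\<pi> a) (\<pi> b) (\<pi> c) (\<pi> d)) (tabloid S T)"
      using finite_tabloids[OF S] by simp
  qed
  finally show ?thesis .
qed

lemma card_young_diagram: "card (young_diagram l) = sum_list l"
proof -
  have "young_diagram l = (SIGMA r:{..<length l}. {..<l ! r})" unfolding young_diagram_def by auto
  then show ?thesis by (simp add: sum_list_sum_nth atLeast0LessThan)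
qed

lemma tableau_Collect:
  assumes "T \<in> tableaux S l" "X \<subseteq> S" "{y\<in>young_diagram l. P y} = T ` X"
  shows "{i\<in>S. P (T i)} = X"
proof -
  have T: "inj_on T S" "T ` S = young_diagram l"
    using assms(1) unfolding tableaux_def bij_betw_def by auto
  have "T ` {i\<in>S. P (T i)} = {y\<in>T ` S. P y}" by auto
  then have "T ` {i\<in>S. P (T i)} = T ` X" unfolding T(2) assms(3) .
  then show ?thesis using inj_on_image_eq_iff[OF T(1), of "{i\<in>S. P (T i)}" X] assms(2) by simp
qed

lemma tableau_entry:
  assumes "T \<in> tableaux S l" "y \<in> young_diagram l"
  obtains x where "x \<in> S" "T x = y"
  using assms unfolding tableaux_def bij_betw_def mem_Collect_eq by (metis imageE)

lemma tableau_eq: "T \<in> tableaux S l \<Longrightarrow> x \<in> S \<Longrightarrow> y \<in> S \<Longrightarrow> T x = T y \<longleftrightarrow> x = y"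
  unfolding tableaux_def bij_betw_def by (auto simp: inj_on_eq_iff)

lemma sum_sign_permutes_2:
  assumes "x \<noteq> a"
  shows "(\<Sum>p\<in>{p. p permutes {x, a}}. of_int (sign p) * g (p x) (p a)) = g x a - (g a x :: complex)"
proof -
  have f: "finite {a}" "x \<notin> {a}" using assms by auto
  show ?thesis
    unfolding sum_over_permutations_insert[OF f] permutes_sing using assms
    by (simp add: sign_swap_id sign_id)
qed

lemma sum_sign_permutes_3:
  assumes "x \<noteq> a" "x \<noteq> c" "a \<noteq> c"
  shows "(\<Sum>p\<in>{p. p permutes {x, a, c}}. of_int (sign p) * g (p x) (p a) (p c)) =
    g x a c + g a c x + g c x a - g a x c - g x c a - (g c a x :: complex)"
proof -
  have f: "finite {a, c}" "x \<notin> {a, c}" "finite {c}" "a \<notin> {c}" using assms by auto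
  show ?thesis
    unfolding sum_over_permutations_insert[OF f(1,2)] sum_over_permutations_insert[OF f(3,4)] permutes_sing 
    using assms
    by (simp add: sign_swap_id sign_id sign_compose permutation_swap_id Transposition.transpose_def)
qed

text \<open>Induction over transpositions; the six transpositions of positions are reduced to the
  three adjacent ones.\<close>

lemma alternating_permutes:
  fixes G :: "'a \<Rightarrow> 'a \<Rightarrow> 'a \<Rightarrow> 'a \<Rightarrow> complex"
  assumes alt: "\<And>a b c d. G b a c d = - G a b c d" "\<And>a b c d. G a c b d = - G a b c d"
     "\<And>a b c d. G a b d c = - G a b c d"
    and d: "distinct [a, b, c, d]" and q: "q permutes {a, b, c, d}"
  shows "G (q a) (q b) (q c) (q d) = of_int (sign q) * G a b c d"
proof -
  have "finite {a, b, c, d}" by simp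
  then show ?thesis using q
  proof (induction rule: permutes_rev_induct)
    case id
    then show ?case by simp
  next
    case (swap i j p)
    have "permutation p" using swap.hyps(4) unfolding permutation_permutes by (intro exI[of _ "{a, b, c, d}"]) simp
    then have s: "sign (p \<circ> Transposition.transpose i j) = - sign p"
      using swap.hyps by (simp add: sign_compose permutation_swap_id sign_swap_id)
    have "G ((p \<circ> Transposition.transpose i j) a) ((p \<circ> Transposition.transpose i j) b)
         ((p \<circ> Transposition.transpose i j) c) ((p \<circ> Transposition.transpose i j) d)
       = - G (p a) (p b) (p c) (p d)"
    proof -
      have "G y x w z = - G x y w z" "G w y x z = - G x y w z" "G z y w x = - G x y w z"
        "G x w y z = - G x y w z" "G x z w y = - G x y w z" "G x y z w = - G x y w z" for x y w z
        using alt by (metis minus_minus)+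
      note e = this[of "p a" "p b" "p c" "p d"] 
      show ?thesis
        using swap.hyps(1-3) d e by (auto simp: Transposition.transpose_def)
    qed
    then show ?case using swap.IH unfolding s by simp
  qed
qed


text \<open>Splits the signed column sum into two nested antisymmetrizations, one for each of the
  first two columns. The premises on \<open>p \<circ> q\<close> allow \<open>F\<close> to be
  evaluated separately on the entries of each column.\<close>

lemma sum_column_stabilizer_sign:
  assumes S: "finite S" and T: "T \<in> tableaux S l"
    and C: "{i\<in>S. snd (T i) = 0} = C" and C': "{i\<in>S. snd (T i) = 1} = C'"
    and single: "\<And>a b. a \<in> S \<Longrightarrow> b \<in> S \<Longrightarrow> snd (T a) = snd (T b) \<Longrightarrow> 2 \<le> snd (T a) \<Longrightarrow> a = b"
    and F: "\<And>p q. p permutes C \<Longrightarrow> q permutes C' \<Longrightarrow> p \<circ> q permutes S \<Longrightarrow>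
       (\<And>i. i \<in> C \<Longrightarrow> (p \<circ> q) i = p i) \<Longrightarrow> (\<And>i. i \<in> C' \<Longrightarrow> (p \<circ> q) i = q i) \<Longrightarrow> F (p \<circ> q) = G p q"
  shows "(\<Sum>\<pi>\<in>column_stabilizer S T. of_int (sign \<pi>) * F \<pi>) = 
    (\<Sum>p\<in>{p. p permutes C}. of_int (sign p) * (\<Sum>q\<in>{q. q permutes C'}. of_int (sign q) * (G p q :: complex)))"
proof -
  have CC: "C \<subseteq> S" "C' \<subseteq> S" "C \<inter> C' = {}" using C C' by auto
  have fin: "finite C" "finite C'" using CC S finite_subset by blast+
  have two: "(\<Sum>\<pi>\<in>column_stabilizer S T. f \<pi>) = 
    (\<Sum>p\<in>{p. p permutes C}. \<Sum>q\<in>{q. q permutes C'}. f (p \<circ> q))" for f :: "(nat \<Rightarrow> nat) \<Rightarrow> complex"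
    by (rule sum_column_stabilizer_two_columns[OF S T C[symmetric] C'[symmetric]]) (rule single)
  show ?thesis
    unfolding two sum_distrib_left
  proof (intro sum.cong refl)
    fix p q assume p: "p \<in> {p. p permutes C}" and q: "q \<in> {q. q permutes C'}"
    have "permutation p" "permutation q" using p q fin by (auto simp: permutation_permutes)
    then have s: "sign (p \<circ> q) = sign p * sign q" by (rule sign_compose)
    have "p \<circ> q permutes S"
      using permutes_compose[OF permutes_subset[OF _ CC(2)] permutes_subset[OF _ CC(1)]] p q by simp
    moreover have "(p \<circ> q) i = p i" if "i \<in> C" for i
    proof -
      have "i \<notin> C'" using that CC by blast
      then show ?thesis using permutes_not_in[of q C' i] q by simp
    qed
    moreover have "(p \<circ> q) i = q i" if "i \<in> C'" for i
    proof -
      have "q i \<notin> C" using that CC q permutes_in_image[of q C' i] by auto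
      then show ?thesis using permutes_not_in[of p C "q i"] p by simp
    qed
    ultimately have "F (p \<circ> q) = G p q" using p q by (intro F) auto
    then show "of_int (sign (p \<circ> q)) * F (p \<circ> q) = of_int (sign p) * (of_int (sign q) * G p q)"
      unfolding s by simp
  qed
qed

section \<open>Values on polytabloids of the four shapes\<close>

locale young_symmetrizer =
  fixes n :: nat and S :: "nat set"
  assumes n: "n \<ge> 5" and S: "S = {0..n}"
begin

lemma fin_S: "finite S" and card_S: "card S = Suc n"
  unfolding S by simp_all

lemma tabloid_row: "{i\<in>S. P (tabloid S T i)} = {i\<in>S. P (fst (T i))}"
  unfolding tabloid_def by auto

lemma sum_permute_S: "\<pi> permutes S \<Longrightarrow> (\<Sum>c\<in>S. f (\<pi> c)) = (\<Sum>c\<in>S. f c)" for f :: "nat \<Rightarrow> complex"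
  using sum.permute[of \<pi> S f] by (simp add: o_def)

text \<open>Rows below the first have at most two cells, so from index 2 on a column consists of its
  cell in the first row.\<close>

lemma tableau_single:
  assumes T: "T \<in> tableaux S l" and l: "\<And>r. 0 < r \<Longrightarrow> r < length l \<Longrightarrow> l ! r \<le> 2"
    and ij: "i \<in> S" "j \<in> S" "snd (T i) = snd (T j)" "2 \<le> snd (T i)"
  shows "i = j"
proof -
  have "fst (T i) = 0" if "i \<in> S" "2 \<le> snd (T i)" for i
  proof (rule ccontr)
    assume "fst (T i) \<noteq> 0"
    moreover have "T i \<in> young_diagram l" using T that unfolding tableaux_def bij_betw_def by auto
    ultimately show False using l[of "fst (T i)"] that unfolding young_diagram_def by (auto simp: split_beta)
  qed
  from this[of i] this[of j] have "T i = T j" using ij by (simp add: prod_eq_iff)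
  then show ?thesis using tableau_eq[OF T] ij by simp
qed

text \<open>The second row of \<open>T\<close> is \<open>a, b\<close> and the other two indices run
  over \<open>S\<close>, so the tabloid of \<open>T\<close> contributes \<open>2 * u a b\<close>:
  the two orders agree and diagonal terms vanish. Antisymmetrizing over the columns
  \<open>x, a\<close> and \<open>y, b\<close> gives a mixed second difference.\<close>

lemma specht_form_2:
  assumes T: "T \<in> tableaux S [n - 1, 2]" 
    and m: "{x,a,y,b} \<subseteq> S" "T x = (0,0)" "T a = (1,0)" "T y = (0,1)" "T b = (1,1)"
    and h: "\<And>a b c d. h b a c d = h a b c d" "\<And>a c d. h a a c d = 0"
    and u: "\<And>a b. u a b = (\<Sum>c\<in>S. \<Sum>d\<in>S. h a b c d)"
  shows "specht_form S [n - 1, 2] (\<lambda>r. r = 1) (\<lambda>r. r = 1) (\<lambda>_. True) (\<lambda>_. True) h (polytabloid S T)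
    = 2 * (u a b - u x b - u a y + u x y)"
proof -
  have d: "distinct [x,a,y,b]" using m by auto
  have C: "{i\<in>S. snd (T i) = 0} = {x,a}"
    using n m by (intro tableau_Collect[OF T]) (auto simp: young_diagram_def less_Suc_eq)
  have C': "{i\<in>S. snd (T i) = 1} = {y,b}"
    using n m by (intro tableau_Collect[OF T]) (auto simp: young_diagram_def less_Suc_eq)
  have R: "{i\<in>S. fst (T i) = 1} = {a,b}"
    using n m by (intro tableau_Collect[OF T]) (auto simp: young_diagram_def less_Suc_eq numeral_2_eq_2)
  have single: "i = j" if "i \<in> S" "j \<in> S" "snd (T i) = snd (T j)" "2 \<le> snd (T i)" for i j
    by (rule tableau_single[OF T _ that]) (simp add: less_Suc_eq)
  have "specht_form S [n - 1, 2] (\<lambda>r. r = 1) (\<lambda>r. r = 1) (\<lambda>_. True) (\<lambda>_. True) h (polytabloid S T)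
    = (\<Sum>p\<in>{p. p permutes {x,a}}. of_int (sign p) * 
        (\<Sum>q\<in>{q. q permutes {y,b}}. of_int (sign q) * (2 * u (p a) (q b))))"
    unfolding specht_form_polytabloid[OF fin_S T]
  proof (rule sum_column_stabilizer_sign[OF fin_S T C C' single])
    fix p q assume \<pi>: "p \<circ> q permutes S" and pq: "\<And>i. i \<in> {x,a} \<Longrightarrow> (p \<circ> q) i = p i" 
      "\<And>i. i \<in> {y,b} \<Longrightarrow> (p \<circ> q) i = q i"
    have "(p \<circ> q) a = p a" "(p \<circ> q) b = q b" using pq by blast+
    moreover have "(\<Sum>c\<in>S. \<Sum>d\<in>S. h i j ((p \<circ> q) c) ((p \<circ> q) d)) = u i j" for i j
      unfolding u using sum_permute_S[OF \<pi>, of "\<lambda>c. \<Sum>d\<in>S. h i j c d"] 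
       sum_permute_S[OF \<pi>, of "\<lambda>d. h i j _ d"] by simp
    ultimately show "tabloid_form S (\<lambda>r. r = 1) (\<lambda>r. r = 1) (\<lambda>_. True) (\<lambda>_. True)
      (\<lambda>a b c d. h ((p \<circ> q) a) ((p \<circ> q) b) ((p \<circ> q) c) ((p \<circ> q) d)) (tabloid S T) = 2 * u (p a) (q b)"
      unfolding tabloid_form_def tabloid_row[of "\<lambda>r. r = 1"] R using d
      by (simp add: u h)
  qed
  also have "\<dots> = (\<Sum>p\<in>{p. p permutes {x,a}}. of_int (sign p) * (2 * u (p a) b - 2 * u (p a) y))"
    using d sum_sign_permutes_2[of y b "\<lambda>y b. 2 * u _ b"] by simp
  also have "\<dots> = 2 * (u a b - u x b - u a y + u x y)"
    using d sum_sign_permutes_2[of x a "\<lambda>x a. 2 * u a b - 2 * u a y"] by (simp add: algebra_simps)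
  finally show ?thesis .
qed


text \<open>\<open>F\<close> is the antisymmetrization of \<open>s a b c\<close> over the column
  \<open>x, a, c\<close>, and the column \<open>y, b\<close> gives the difference. The factor 2
  counts the orders of the two entries in the second row.\<close>

lemma specht_form_21:
  assumes T: "T \<in> tableaux S [n - 2, 2, 1]" 
    and m: "{x,a,c,y,b} \<subseteq> S" "T x = (0,0)" "T a = (1,0)" "T c = (2,0)" "T y = (0,1)" "T b = (1,1)"
    and h: "\<And>a b c d. h b a c d = h a b c d" "\<And>a c d. h a a c d = 0"
    and s: "\<And>a b c. s a b c = (\<Sum>d\<in>S. h a b c d)"
    and F: "\<And>b. F b = s a b c + s c b x + s x b a - s x b c - s c b a - s a b x"
  shows "specht_form S [n - 2, 2, 1] (\<lambda>r. r = 1) (\<lambda>r. r = 1) (\<lambda>r. r = 2) (\<lambda>_. True) h (polytabloid S T)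
    = 2 * (F b - F y)"
proof -
  have d: "distinct [x,a,c,y,b]" using m by auto
  have C: "{i\<in>S. snd (T i) = 0} = {x,a,c}"
    using n m by (intro tableau_Collect[OF T]) (auto simp: young_diagram_def less_Suc_eq)
  have C': "{i\<in>S. snd (T i) = 1} = {y,b}"
    using n m by (intro tableau_Collect[OF T]) (auto simp: young_diagram_def less_Suc_eq)
  have R: "{i\<in>S. fst (T i) = 1} = {a,b}"
    using n m by (intro tableau_Collect[OF T]) (auto simp: young_diagram_def less_Suc_eq numeral_2_eq_2)
  have R': "{i\<in>S. fst (T i) = 2} = {c}"
    using n m by (intro tableau_Collect[OF T]) (auto simp: young_diagram_def less_Suc_eq numeral_2_eq_2)
  have single: "i = j" if "i \<in> S" "j \<in> S" "snd (T i) = snd (T j)" "2 \<le> snd (T i)" for i j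
    by (rule tableau_single[OF T _ that]) (auto simp: less_Suc_eq)
  have "specht_form S [n - 2, 2, 1] (\<lambda>r. r = 1) (\<lambda>r. r = 1) (\<lambda>r. r = 2) (\<lambda>_. True) h (polytabloid S T)
    = (\<Sum>p\<in>{p. p permutes {x,a,c}}. of_int (sign p) * 
        (\<Sum>q\<in>{q. q permutes {y,b}}. of_int (sign q) * (2 * s (p a) (q b) (p c))))"
    unfolding specht_form_polytabloid[OF fin_S T]
  proof (rule sum_column_stabilizer_sign[OF fin_S T C C' single])
    fix p q assume \<pi>: "p \<circ> q permutes S" and pq: "\<And>i. i \<in> {x,a,c} \<Longrightarrow> (p \<circ> q) i = p i" 
      "\<And>i. i \<in> {y,b} \<Longrightarrow> (p \<circ> q) i = q i"
    have "(p \<circ> q) a = p a" "(p \<circ> q) b = q b" "(p \<circ> q) c = p c" using pq by blast+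
    moreover have "(\<Sum>d\<in>S. h i j k ((p \<circ> q) d)) = s i j k" for i j k
      unfolding s using sum_permute_S[OF \<pi>, of "\<lambda>d. h i j k d"] by simp
    ultimately show "tabloid_form S (\<lambda>r. r = 1) (\<lambda>r. r = 1) (\<lambda>r. r = 2) (\<lambda>_. True)
      (\<lambda>a b c d. h ((p \<circ> q) a) ((p \<circ> q) b) ((p \<circ> q) c) ((p \<circ> q) d)) (tabloid S T) = 2 * s (p a) (q b) (p c)"
      unfolding tabloid_form_def tabloid_row[of "\<lambda>r. r = 1"] tabloid_row[of "\<lambda>r. r = 2"] R R' using d
      by (simp add: s h)
  qed
  also have "\<dots> = (\<Sum>p\<in>{p. p permutes {x,a,c}}. of_int (sign p) * (2 * s (p a) b (p c) - 2 * s (p a) y (p c)))"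
    using d sum_sign_permutes_2[of y b "\<lambda>y b. 2 * s _ b _"] by simp
  also have "\<dots> = 2 * (F b - F y)"
    unfolding F
    using d sum_sign_permutes_3[of x a c "\<lambda>x a c. 2 * s a b c - 2 * s a y c"] by (simp add: algebra_simps)
  finally show ?thesis .
qed

text \<open>\<open>K\<close> is the antisymmetrization over the column \<open>x, a, c\<close>, and
  the six terms of the result antisymmetrize it over \<open>y, b, d\<close>. The factor 4 counts the
  orders within each of the two lower rows.\<close>

lemma specht_form_22:
  assumes T: "T \<in> tableaux S [n - 3, 2, 2]" 
    and m: "{x,a,c,y,b,d} \<subseteq> S" "T x = (0,0)" "T a = (1,0)" "T c = (2,0)" 
      "T y = (0,1)" "T b = (1,1)" "T d = (2,1)"
    and h: "\<And>a b c d. h b a c d = h a b c d" "\<And>a c d. h a a c d = 0"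
      "\<And>a b c d. h a b d c = h a b c d" "\<And>a b c. h a b c c = 0"
    and K: "\<And>b d. K b d = h a b c d + h c b x d + h x b a d - h x b c d - h c b a d - h a b x d"
  shows "specht_form S [n - 3, 2, 2] (\<lambda>r. r = 1) (\<lambda>r. r = 1) (\<lambda>r. r = 2) (\<lambda>r. r = 2) h (polytabloid S T)
    = 4 * (K b d + K d y + K y b - K y d - K d b - K b y)"
proof -
  have d: "distinct [x,a,c,y,b,d]" using m by auto
  have C: "{i\<in>S. snd (T i) = 0} = {x,a,c}"
    using n m by (intro tableau_Collect[OF T]) (auto simp: young_diagram_def less_Suc_eq)
  have C': "{i\<in>S. snd (T i) = 1} = {y,b,d}"
    using n m by (intro tableau_Collect[OF T]) (auto simp: young_diagram_def less_Suc_eq)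
  have R: "{i\<in>S. fst (T i) = 1} = {a,b}"
    using n m by (intro tableau_Collect[OF T]) (auto simp: young_diagram_def less_Suc_eq numeral_2_eq_2)
  have R': "{i\<in>S. fst (T i) = 2} = {c,d}"
    using n m by (intro tableau_Collect[OF T]) (auto simp: young_diagram_def less_Suc_eq numeral_2_eq_2)
  have single: "i = j" if "i \<in> S" "j \<in> S" "snd (T i) = snd (T j)" "2 \<le> snd (T i)" for i j
    by (rule tableau_single[OF T _ that]) (auto simp: less_Suc_eq)
  have "specht_form S [n - 3, 2, 2] (\<lambda>r. r = 1) (\<lambda>r. r = 1) (\<lambda>r. r = 2) (\<lambda>r. r = 2) h (polytabloid S T)
    = (\<Sum>p\<in>{p. p permutes {x,a,c}}. of_int (sign p) * 
        (\<Sum>q\<in>{q. q permutes {y,b,d}}. of_int (sign q) * (4 * h (p a) (q b) (p c) (q d))))"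
    unfolding specht_form_polytabloid[OF fin_S T]
  proof (rule sum_column_stabilizer_sign[OF fin_S T C C' single])
    fix p q assume \<pi>: "p \<circ> q permutes S" and pq: "\<And>i. i \<in> {x,a,c} \<Longrightarrow> (p \<circ> q) i = p i" 
      "\<And>i. i \<in> {y,b,d} \<Longrightarrow> (p \<circ> q) i = q i"
    have "(p \<circ> q) a = p a" "(p \<circ> q) b = q b" "(p \<circ> q) c = p c" "(p \<circ> q) d = q d" using pq by blast+
    then show "tabloid_form S (\<lambda>r. r = 1) (\<lambda>r. r = 1) (\<lambda>r. r = 2) (\<lambda>r. r = 2)
      (\<lambda>a b c d. h ((p \<circ> q) a) ((p \<circ> q) b) ((p \<circ> q) c) ((p \<circ> q) d)) (tabloid S T) = 4 * h (p a) (q b) (p c) (q d)"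
      unfolding tabloid_form_def tabloid_row[of "\<lambda>r. r = 1"] tabloid_row[of "\<lambda>r. r = 2"] R R' using d
      by (simp add: h(2,4) h(1)[of "p a" "q b"] h(3)[of _ _ "p c" "q d"])
  qed
  also have "\<dots> = (\<Sum>p\<in>{p. p permutes {x,a,c}}. of_int (sign p) * 
     (4 * h (p a) b (p c) d + 4 * h (p a) d (p c) y + 4 * h (p a) y (p c) b
       - 4 * h (p a) y (p c) d - 4 * h (p a) d (p c) b - 4 * h (p a) b (p c) y))"
    using d sum_sign_permutes_3[of y b d "\<lambda>y b d. 4 * h _ b _ d"] by simp
  also have "\<dots> = 4 * (K b d + K d y + K y b - K y d - K d b - K b y)"
    unfolding K
    using d sum_sign_permutes_3[of x a c "\<lambda>x a c. 4 * h a b c d + 4 * h a d c y + 4 * h a y c b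
       - 4 * h a y c d - 4 * h a d c b - 4 * h a b c y"] by (simp add: algebra_simps)
  finally show ?thesis .
qed

text \<open>\<open>h\<close> already alternates under permutations of \<open>a, b, c, d\<close>. The
  cosets of this subgroup in the symmetric group of the column are represented by the exchanges of
  \<open>e\<close> with an entry of the column, the identity included, and each coset contributes
  \<open>4! = 24\<close> equal terms.\<close>

lemma specht_form_1:
  assumes T: "T \<in> tableaux S [n - 3, 1, 1, 1, 1]" 
    and m: "{e,a,b,c,d} \<subseteq> S" "T e = (0,0)" "T a = (1,0)" "T b = (2,0)" "T c = (3,0)" "T d = (4,0)"
    and alt: "\<And>a b c d. h b a c d = - h a b c d" "\<And>a b c d. h a c b d = - h a b c d"
     "\<And>a b c d. h a b d c = - h a b c d"
  shows "specht_form S [n - 3, 1, 1, 1, 1] (\<lambda>r. r = 1) (\<lambda>r. r = 2) (\<lambda>r. r = 3) (\<lambda>r. r = 4) h (polytabloid S T)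
    = 24 * (h a b c d - h e b c d - h a e c d - h a b e d - h a b c e)"
proof -
  have dist: "distinct [e,a,b,c,d]" using m by auto
  then have ne: "e \<noteq> a" "e \<noteq> b" "e \<noteq> c" "e \<noteq> d" "a \<noteq> e" "a \<noteq> b" "a \<noteq> c" "a \<noteq> d"
    "b \<noteq> e" "b \<noteq> a" "b \<noteq> c" "b \<noteq> d" "c \<noteq> e" "c \<noteq> a" "c \<noteq> b" "c \<noteq> d"
    "d \<noteq> e" "d \<noteq> a" "d \<noteq> b" "d \<noteq> c"
    by auto
  \<comment> \<open>The second column is the single cell \<open>(0, 1)\<close>, present because
    \<open>n - 3\<close> is at least 2.\<close>
  obtain z where z: "z \<in> S" "T z = (0,1)"
    using n by (auto intro: tableau_entry[OF T, of "(0,1)"] simp: young_diagram_def)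
  have C: "{i\<in>S. snd (T i) = 0} = {e,a,b,c,d}"
    using n m by (intro tableau_Collect[OF T]) (auto simp: young_diagram_def less_Suc_eq numeral_eq_Suc)
  have C': "{i\<in>S. snd (T i) = 1} = {z}"
    using n z by (intro tableau_Collect[OF T]) (auto simp: young_diagram_def less_Suc_eq numeral_eq_Suc)
  have R: "{i\<in>S. fst (T i) = 1} = {a}" "{i\<in>S. fst (T i) = 2} = {b}" 
     "{i\<in>S. fst (T i) = 3} = {c}" "{i\<in>S. fst (T i) = 4} = {d}"
    using n m by (intro tableau_Collect[OF T]; auto simp: young_diagram_def less_Suc_eq numeral_eq_Suc)+
  have single: "i = j" if "i \<in> S" "j \<in> S" "snd (T i) = snd (T j)" "2 \<le> snd (T i)" for i j
    by (rule tableau_single[OF T _ that]) (auto simp: less_Suc_eq)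
  have "specht_form S [n - 3, 1, 1, 1, 1] (\<lambda>r. r = 1) (\<lambda>r. r = 2) (\<lambda>r. r = 3) (\<lambda>r. r = 4) h (polytabloid S T)
    = (\<Sum>p\<in>{p. p permutes {e,a,b,c,d}}. of_int (sign p) * 
        (\<Sum>q\<in>{q. q permutes {z}}. of_int (sign q) * h (p a) (p b) (p c) (p d)))"
    unfolding specht_form_polytabloid[OF fin_S T]
  proof (rule sum_column_stabilizer_sign[OF fin_S T C C' single])
    fix p q :: "nat \<Rightarrow> nat" assume pq: "\<And>i. i \<in> {e,a,b,c,d} \<Longrightarrow> (p \<circ> q) i = p i" 
    have "(p \<circ> q) a = p a" "(p \<circ> q) b = p b" "(p \<circ> q) c = p c" "(p \<circ> q) d = p d" using pq by blast+
    then show "tabloid_form S (\<lambda>r. r = 1) (\<lambda>r. r = 2) (\<lambda>r. r = 3) (\<lambda>r. r = 4)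
      (\<lambda>a b c d. h ((p \<circ> q) a) ((p \<circ> q) b) ((p \<circ> q) c) ((p \<circ> q) d)) (tabloid S T) = h (p a) (p b) (p c) (p d)"
      unfolding tabloid_form_def tabloid_row[of "\<lambda>r. r = 1"] tabloid_row[of "\<lambda>r. r = 2"] 
        tabloid_row[of "\<lambda>r. r = 3"] tabloid_row[of "\<lambda>r. r = 4"] R by simp
  qed
  also have "\<dots> = (\<Sum>p\<in>{p. p permutes {e,a,b,c,d}}. of_int (sign p) * h (p a) (p b) (p c) (p d))"
    by (simp add: permutes_sing)
  also have "\<dots> = (\<Sum>i\<in>{e,a,b,c,d}. \<Sum>q\<in>{q. q permutes {a,b,c,d}}.
      of_int (sign (Transposition.transpose e i)) * h (Transposition.transpose e i a) 
      (Transposition.transpose e i b) (Transposition.transpose e i c) (Transposition.transpose e i d))"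
  proof -
    have f: "finite {a,b,c,d}" "e \<notin> {a,b,c,d}" using dist by auto
    show ?thesis unfolding sum_over_permutations_insert[OF f]
    proof (intro sum.cong refl)
      fix i q assume i: "i \<in> {e,a,b,c,d}" and q: "q \<in> {q. q permutes {a,b,c,d}}"
      let ?\<tau> = "Transposition.transpose e i"
      have p: "permutation q" using q f(1) unfolding permutation_permutes by blast
      then have s: "sign (?\<tau> \<circ> q) = sign ?\<tau> * sign q" 
        by (simp add: sign_compose permutation_swap_id)
      have "h (?\<tau> (q a)) (?\<tau> (q b)) (?\<tau> (q c)) (?\<tau> (q d)) = of_int (sign q) * h (?\<tau> a) (?\<tau> b) (?\<tau> c) (?\<tau> d)"
        by (rule alternating_permutes[where G = "\<lambda>a b c d. h (?\<tau> a) (?\<tau> b) (?\<tau> c) (?\<tau> d)"])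
          (rule alt, rule alt, rule alt, use dist q in auto)
      moreover have "of_int (sign q) * of_int (sign q) = (1 :: complex)"
        by (metis of_int_1 of_int_mult sign_idempotent)
      ultimately show "of_int (sign (?\<tau> \<circ> q)) * h ((?\<tau> \<circ> q) a) ((?\<tau> \<circ> q) b) ((?\<tau> \<circ> q) c) ((?\<tau> \<circ> q) d)
        = of_int (sign ?\<tau>) * h (?\<tau> a) (?\<tau> b) (?\<tau> c) (?\<tau> d)"
        unfolding s by (simp add: algebra_simps)
    qed
  qed
  also have "\<dots> = (\<Sum>i\<in>{e,a,b,c,d}. 24 * (of_int (sign (Transposition.transpose e i)) * h (Transposition.transpose e i a) 
      (Transposition.transpose e i b) (Transposition.transpose e i c) (Transposition.transpose e i d)))"
    using card_permutations[of "{a,b,c,d}" 4] dist by (simp add: fact_numeral)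
  also have "\<dots> = 24 * (h a b c d - h e b c d - h a e c d - h a b e d - h a b c e)"
    by (simp add: ne sign_swap_id Transposition.transpose_def algebra_simps)
  finally show ?thesis .
qed

end

section \<open>Test forms supported on two disjoint edges\<close>

definition edge_indicator :: quad_form
  where "edge_indicator p q a b = (if a = p \<and> b = q then 1 else 0) - (if a = q \<and> b = p then 1 else 0)"

text \<open>Detects the product of the edges \<open>p q\<close> and \<open>s t\<close>. It need not
  vanish when a label is \<open>0\<close>, hence the later use of
  \<open>pull_form id\<close>.\<close>

definition edge_pair_form :: "nat \<Rightarrow> nat \<Rightarrow> nat \<Rightarrow> nat \<Rightarrow> quad_form"
  where "edge_pair_form p q s t a b c d =
    edge_indicator p q a b * edge_indicator s t c d + edge_indicator s t a b * edge_indicator p q c d"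

lemma edge_indicator_swap: "edge_indicator p q a b = - edge_indicator p q b a"
  unfolding edge_indicator_def by (simp add: conj_commute)

lemma edge_form_edge_pair: "edge_form (edge_pair_form p q s t)"
  unfolding edge_form_def edge_pair_form_def
proof (intro conjI allI)
  fix a b c d
  show "edge_indicator p q a b * edge_indicator s t c d + edge_indicator s t a b * edge_indicator p q c d =
    - (edge_indicator p q b a * edge_indicator s t c d + edge_indicator s t b a * edge_indicator p q c d)"
    by (simp add: edge_indicator_swap[of p q a b] edge_indicator_swap[of s t a b])
qed (simp add: algebra_simps)

lemma edge_indicator_nonzero: "edge_indicator p q a b \<noteq> 0 \<Longrightarrow> a = p \<and> b = q \<or> a = q \<and> b = p"
  unfolding edge_indicator_def by (rule ccontr) auto

lemma edge_indicator_meet: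
  assumes "{p, q} \<inter> {s, t} = {}" "{a, b} \<inter> {c, d} \<noteq> {}"
  shows "edge_indicator p q a b * edge_indicator s t c d = 0"
proof (rule ccontr)
  assume "\<not> ?thesis"
  then have "edge_indicator p q a b \<noteq> 0" "edge_indicator s t c d \<noteq> 0" by auto
  then have "{a, b} \<subseteq> {p, q}" "{c, d} \<subseteq> {s, t}" using edge_indicator_nonzero by blast+
  then show False using assms by blast
qed

lemma edge_pair_form_meet:
  assumes "distinct [p, q, s, t]"
  shows "edge_pair_form p q s t a b a d = 0" "edge_pair_form p q s t a b b d = 0"
    "edge_pair_form p q s t a b c a = 0" "edge_pair_form p q s t a b c b = 0"
proof -
  have "{p, q} \<inter> {s, t} = {}" "{s, t} \<inter> {p, q} = {}" using assms by auto
  then show "edge_pair_form p q s t a b a d = 0" "edge_pair_form p q s t a b b d = 0"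
    "edge_pair_form p q s t a b c a = 0" "edge_pair_form p q s t a b c b = 0"
    unfolding edge_pair_form_def by (simp_all add: edge_indicator_meet)
qed

text \<open>Disjointness of the two edges makes the square of every triangle vanish.\<close>

lemma pull_edge_pair_form:
  assumes "distinct [p, q, s, t]"
  shows "pull_form id (edge_pair_form p q s t) \<in> config_forms"
  by (rule pull_form_mem[OF edge_form_edge_pair])
    (simp add: triangle_form_def edge_pair_form_meet[OF assms])

text \<open>Of the nine products of edges of the two triangles, all but \<open>b c\<close> with
  \<open>d a\<close> and \<open>c a\<close> with \<open>b d\<close> have a common vertex.\<close>

lemma pair_form_edge_pair:
  assumes "distinct [p, q, s, t]"
  shows "pair_form (pull_form id (edge_pair_form p q s t)) a b c d
    = edge_pair_form p q s t b c d a + edge_pair_form p q s t c a b d"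
  unfolding pair_form_pull[OF edge_form_edge_pair] 
  by (simp add: pair_form_def triangle_form_def edge_pair_form_meet[OF assms])

lemma simplex_form_edge_pair:
  "simplex_form (pull_form id (edge_pair_form p q s t)) x a b c d
    = simplex_form (edge_pair_form p q s t) x a b c d"
  unfolding simplex_form_pull[OF edge_form_edge_pair] by simp

section \<open>The four functionals and forms on which they do not vanish\<close>

context young_symmetrizer begin

text \<open>The hook has only four entries below its first row; the fifth vertex of the alternating
  product is therefore summed over all of \<open>S\<close>.\<close>

definition form1 where
  "form1 \<phi> = specht_form S [n - 3, 1, 1, 1, 1] (\<lambda>r. r = 1) (\<lambda>r. r = 2) (\<lambda>r. r = 3) (\<lambda>r. r = 4)
     (\<lambda>a b c d. \<Sum>x\<in>S. simplex_form \<phi> x a b c d)"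
definition form21 where
  "form21 \<phi> = specht_form S [n - 2, 2, 1] (\<lambda>r. r = 1) (\<lambda>r. r = 1) (\<lambda>r. r = 2) (\<lambda>_. True) (pair_form \<phi>)"
definition form22 where
  "form22 \<phi> = specht_form S [n - 3, 2, 2] (\<lambda>r. r = 1) (\<lambda>r. r = 1) (\<lambda>r. r = 2) (\<lambda>r. r = 2) (pair_form \<phi>)"
definition form2 where
  "form2 \<phi> = specht_form S [n - 1, 2] (\<lambda>r. r = 1) (\<lambda>r. r = 1) (\<lambda>_. True) (\<lambda>_. True) (pair_form \<phi>)"

lemma pair_tensor:
  assumes K: "\<phi> \<in> config_forms"
  shows "pair_tensor (pair_form \<phi>) S"
proof
  note e = config_formsD(1)[OF K]
  show "finite S" "card S \<ge> 6" using fin_S card_S n by auto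
  show "pair_form \<phi> b a c d = pair_form \<phi> a b c d" "pair_form \<phi> a b d c = pair_form \<phi> a b c d"
    "pair_form \<phi> a b a d = 0" for a b c d
    by (rule pair_form_swap[OF e] pair_form_eq0[OF e])+
  show "pair_form \<phi> a b c d = pair_form \<phi> c d a b" for a b c d by (rule pair_form_exchange[OF K])
  show "pair_form \<phi> a b c d + pair_form \<phi> a c b d + pair_form \<phi> a d b c = 0" for a b c d
    by (rule pair_form_cyclic[OF K])
  show "pair_form \<phi> a b c c = 0" for a b c by (rule pair_form_diag[OF K])
qed

text \<open>By the cocycle identity every vertex \<open>x\<close> contributes the same value, so
  summing over \<open>x\<close> multiplies by the number \<open>n + 1\<close> of vertices.\<close>

lemma form1_polytabloid:
  assumes K: "\<phi> \<in> config_forms" and T: "T \<in> tableaux S [n - 3, 1, 1, 1, 1]" 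
    and m: "{e,a,b,c,d} \<subseteq> S" "T e = (0,0)" "T a = (1,0)" "T b = (2,0)" "T c = (3,0)" "T d = (4,0)"
  shows "form1 \<phi> (polytabloid S T) = 24 * of_nat (n + 1) * simplex_form \<phi> e a b c d"
proof -
  note ef = config_formsD(1)[OF K]
  have "form1 \<phi> (polytabloid S T) = 24 * ((\<Sum>x\<in>S. simplex_form \<phi> x a b c d) - (\<Sum>x\<in>S. simplex_form \<phi> x e b c d)
     - (\<Sum>x\<in>S. simplex_form \<phi> x a e c d) - (\<Sum>x\<in>S. simplex_form \<phi> x a b e d) - (\<Sum>x\<in>S. simplex_form \<phi> x a b c e))"
    unfolding form1_def
  proof (rule specht_form_1[OF T m])
    show "(\<Sum>x\<in>S. simplex_form \<phi> x b a c d) = - (\<Sum>x\<in>S. simplex_form \<phi> x a b c d)"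
       "(\<Sum>x\<in>S. simplex_form \<phi> x a c b d) = - (\<Sum>x\<in>S. simplex_form \<phi> x a b c d)"
       "(\<Sum>x\<in>S. simplex_form \<phi> x a b d c) = - (\<Sum>x\<in>S. simplex_form \<phi> x a b c d)" for a b c d
      unfolding sum_negf[symmetric] by (intro sum.cong refl simplex_form_swap[OF ef])+
  qed
  also have "\<dots> = 24 * (\<Sum>x\<in>S. simplex_form \<phi> x a b c d - simplex_form \<phi> x e b c d
     - simplex_form \<phi> x a e c d - simplex_form \<phi> x a b e d - simplex_form \<phi> x a b c e)"
    by (simp add: sum_subtractf)
  also have "\<dots> = 24 * of_nat (n + 1) * simplex_form \<phi> e a b c d"
    unfolding simplex_form_cocycle[OF ef] by (simp add: card_S)
  finally show ?thesis .
qed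

lemma form1_nonzero:
  assumes T: "T \<in> tableaux S [n - 3, 1, 1, 1, 1]"
  obtains \<phi> where "\<phi> \<in> config_forms" "form1 \<phi> (polytabloid S T) \<noteq> 0"
proof -
  have D: "(0,0) \<in> young_diagram [n - 3, 1, 1, 1, 1]" "(1,0) \<in> young_diagram [n - 3, 1, 1, 1, 1]"
    "(2,0) \<in> young_diagram [n - 3, 1, 1, 1, 1]" "(3,0) \<in> young_diagram [n - 3, 1, 1, 1, 1]"
    "(4,0) \<in> young_diagram [n - 3, 1, 1, 1, 1]"
    using n by (auto simp: young_diagram_def numeral_eq_Suc)
  obtain e where e: "e \<in> S" "T e = (0,0)" by (rule tableau_entry[OF T D(1)])
  obtain a where a: "a \<in> S" "T a = (1,0)" by (rule tableau_entry[OF T D(2)])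
  obtain b where b: "b \<in> S" "T b = (2,0)" by (rule tableau_entry[OF T D(3)])
  obtain c where c: "c \<in> S" "T c = (3,0)" by (rule tableau_entry[OF T D(4)])
  obtain d where d: "d \<in> S" "T d = (4,0)" by (rule tableau_entry[OF T D(5)])
  have ne: "a \<noteq> b" "a \<noteq> c" "a \<noteq> d" "b \<noteq> c" "b \<noteq> d" "c \<noteq> d" "e \<noteq> a" "e \<noteq> b" "e \<noteq> c" "e \<noteq> d"
    using a b c d e by auto
  note ne' = ne ne[symmetric]
  \<comment> \<open>Of the five faces only \<open>a b c d\<close> avoids \<open>e\<close>, and the
    edges \<open>a b\<close> and \<open>c d\<close> match its vertices.\<close>
  let ?\<phi> = "pull_form id (edge_pair_form a b c d)"
  have K: "?\<phi> \<in> config_forms" using ne by (intro pull_edge_pair_form) auto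
  have "simplex_form ?\<phi> e a b c d = 1"
    unfolding simplex_form_edge_pair simplex_form_boundary[OF edge_form_edge_pair] wedge_form_def
      edge_pair_form_def edge_indicator_def by (simp add: ne')
  then have "form1 ?\<phi> (polytabloid S T) = 24 * of_nat (n + 1)"
    using form1_polytabloid[OF K T _ e(2) a(2) b(2) c(2) d(2)] e a b c d by simp
  then have "form1 ?\<phi> (polytabloid S T) \<noteq> 0" by (simp only: mult_eq_0_iff of_nat_eq_0_iff) auto
  with K show ?thesis by (rule that)
qed

lemma form21_polytabloid:
  assumes K: "\<phi> \<in> config_forms" and T: "T \<in> tableaux S [n - 2, 2, 1]" 
    and m: "{x,a,c,y,b} \<subseteq> S" "T x = (0,0)" "T a = (1,0)" "T c = (2,0)" "T y = (0,1)" "T b = (1,1)"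
    and s: "\<And>a b c. s a b c = (\<Sum>d\<in>S. pair_form \<phi> a b c d)"
    and F: "\<And>b. F b = s a b c + s c b x + s x b a - s x b c - s c b a - s a b x"
  shows "form21 \<phi> (polytabloid S T) = 2 * (F b - F y)"
  unfolding form21_def
  by (rule specht_form_21[OF T m _ _ s F])
    (simp_all add: pair_form_swap[OF config_formsD(1)[OF K]] pair_form_eq0[OF config_formsD(1)[OF K]])

lemma form22_polytabloid:
  assumes K: "\<phi> \<in> config_forms" and T: "T \<in> tableaux S [n - 3, 2, 2]" 
    and m: "{x,a,c,y,b,d} \<subseteq> S" "T x = (0,0)" "T a = (1,0)" "T c = (2,0)" 
      "T y = (0,1)" "T b = (1,1)" "T d = (2,1)"
    and L: "\<And>b d. L b d = pair_form \<phi> a b c d + pair_form \<phi> c b x d + pair_form \<phi> x b a d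
        - pair_form \<phi> x b c d - pair_form \<phi> c b a d - pair_form \<phi> a b x d"
  shows "form22 \<phi> (polytabloid S T) = 4 * (L b d + L d y + L y b - L y d - L d b - L b y)"
  unfolding form22_def
  using config_formsD(1)[OF K] pair_form_diag[OF K]
  by (intro specht_form_22[OF T m _ _ _ _ L])
    (simp_all add: pair_form_swap[OF config_formsD(1)[OF K]] pair_form_eq0[OF config_formsD(1)[OF K]])

lemma form2_polytabloid:
  assumes K: "\<phi> \<in> config_forms" and T: "T \<in> tableaux S [n - 1, 2]" 
    and m: "{x,a,y,b} \<subseteq> S" "T x = (0,0)" "T a = (1,0)" "T y = (0,1)" "T b = (1,1)"
    and u: "\<And>a b. u a b = (\<Sum>c\<in>S. \<Sum>d\<in>S. pair_form \<phi> a b c d)"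
  shows "form2 \<phi> (polytabloid S T) = 2 * (u a b - u x b - u a y + u x y)"
  unfolding form2_def
  by (rule specht_form_2[OF T m _ _ u])
    (simp_all add: pair_form_swap[OF config_formsD(1)[OF K]] pair_form_eq0[OF config_formsD(1)[OF K]])

lemma obtain_fresh:
  assumes "length xs \<le> 5"
  obtains z where "z \<in> S" "z \<notin> set xs"
proof -
  have "card (set xs) < card S" using assms n card_length[of xs] unfolding card_S by linarith
  then have "\<not> S \<subseteq> set xs" using card_mono[of "set xs" S] by auto
  then show ?thesis using that by blast
qed

lemma form22_nonzero:
  assumes T: "T \<in> tableaux S [n - 3, 2, 2]"
  obtains \<phi> where "\<phi> \<in> config_forms" "form22 \<phi> (polytabloid S T) \<noteq> 0"
proof -
  have D: "(0,0) \<in> young_diagram [n - 3, 2, 2]" "(1,0) \<in> young_diagram [n - 3, 2, 2]"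
    "(2,0) \<in> young_diagram [n - 3, 2, 2]" "(0,1) \<in> young_diagram [n - 3, 2, 2]"
    "(1,1) \<in> young_diagram [n - 3, 2, 2]" "(2,1) \<in> young_diagram [n - 3, 2, 2]"
    using n by (auto simp: young_diagram_def numeral_eq_Suc)
  obtain x where x: "x \<in> S" "T x = (0,0)" by (rule tableau_entry[OF T D(1)])
  obtain a where a: "a \<in> S" "T a = (1,0)" by (rule tableau_entry[OF T D(2)])
  obtain c where c: "c \<in> S" "T c = (2,0)" by (rule tableau_entry[OF T D(3)])
  obtain y where y: "y \<in> S" "T y = (0,1)" by (rule tableau_entry[OF T D(4)])
  obtain b where b: "b \<in> S" "T b = (1,1)" by (rule tableau_entry[OF T D(5)])
  obtain d where d: "d \<in> S" "T d = (2,1)" by (rule tableau_entry[OF T D(6)])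
  have ne: "x \<noteq> a" "x \<noteq> b" "x \<noteq> c" "x \<noteq> d" "x \<noteq> y" "y \<noteq> a" "y \<noteq> b" "y \<noteq> c" "y \<noteq> d" 
    "a \<noteq> b" "a \<noteq> c" "a \<noteq> d" "b \<noteq> c" "b \<noteq> d" "c \<noteq> d"
    using a b c d x y by auto
  note ne' = ne ne[symmetric]
  \<comment> \<open>Chosen so that \<open>pair_form\<close> is 1 at \<open>a, b, c, d\<close> and at
    the exchanged \<open>c, d, a, b\<close>. Both enter with coefficient 1 after the two
    antisymmetrizations, whence the value \<open>4 * 2 = 8\<close>.\<close>
  let ?\<phi> = "pull_form id (edge_pair_form b c d a)"
  have dist: "distinct [b,c,d,a]" using ne' by simp
  have K: "?\<phi> \<in> config_forms" by (rule pull_edge_pair_form[OF dist])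
  have "form22 ?\<phi> (polytabloid S T) = 8"
    using form22_polytabloid[OF K T _ x(2) a(2) c(2) y(2) b(2) d(2) refl] x a b c d y
    unfolding pair_form_edge_pair[OF dist] edge_pair_form_def edge_indicator_def by (simp add: ne')
  with K show ?thesis using that[of ?\<phi>] by simp
qed

lemma form21_nonzero:
  assumes T: "T \<in> tableaux S [n - 2, 2, 1]"
  obtains \<phi> where "\<phi> \<in> config_forms" "form21 \<phi> (polytabloid S T) \<noteq> 0"
proof -
  have D: "(0,0) \<in> young_diagram [n - 2, 2, 1]" "(1,0) \<in> young_diagram [n - 2, 2, 1]"
    "(2,0) \<in> young_diagram [n - 2, 2, 1]" "(0,1) \<in> young_diagram [n - 2, 2, 1]"
    "(1,1) \<in> young_diagram [n - 2, 2, 1]"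
    using n by (auto simp: young_diagram_def numeral_eq_Suc)
  obtain x where x: "x \<in> S" "T x = (0,0)" by (rule tableau_entry[OF T D(1)])
  obtain a where a: "a \<in> S" "T a = (1,0)" by (rule tableau_entry[OF T D(2)])
  obtain c where c: "c \<in> S" "T c = (2,0)" by (rule tableau_entry[OF T D(3)])
  obtain y where y: "y \<in> S" "T y = (0,1)" by (rule tableau_entry[OF T D(4)])
  obtain b where b: "b \<in> S" "T b = (1,1)" by (rule tableau_entry[OF T D(5)])
  obtain z where z: "z \<in> S" "z \<notin> set [x,a,c,y,b]" by (rule obtain_fresh[of "[x,a,c,y,b]"]) auto
  have ne: "x \<noteq> a" "x \<noteq> b" "x \<noteq> c" "x \<noteq> y" "y \<noteq> a" "y \<noteq> b" "y \<noteq> c" 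
    "a \<noteq> b" "a \<noteq> c" "b \<noteq> c" "z \<noteq> x" "z \<noteq> a" "z \<noteq> c" "z \<noteq> y" "z \<noteq> b"
    using a b c x y z by auto
  note ne' = ne ne[symmetric]
  let ?\<phi> = "pull_form id (edge_pair_form b c z a)"
  have dist: "distinct [b,c,z,a]" using ne' by simp
  have K: "?\<phi> \<in> config_forms" by (rule pull_edge_pair_form[OF dist])
  have q: "pair_form ?\<phi> a b c d = (if d = z then 1 else 0)" "pair_form ?\<phi> c b x d = 0"
    "pair_form ?\<phi> x b a d = 0" "pair_form ?\<phi> x b c d = 0" "pair_form ?\<phi> c b a d = 0" "pair_form ?\<phi> a b x d = 0"
    "pair_form ?\<phi> a y c d = 0" "pair_form ?\<phi> c y x d = 0"
    "pair_form ?\<phi> x y a d = 0" "pair_form ?\<phi> x y c d = 0" "pair_form ?\<phi> c y a d = 0" "pair_form ?\<phi> a y x d = 0"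
    for d
    unfolding pair_form_edge_pair[OF dist] edge_pair_form_def edge_indicator_def by (simp_all add: ne')
  have "form21 ?\<phi> (polytabloid S T) = 2"
    using form21_polytabloid[OF K T _ x(2) a(2) c(2) y(2) b(2) refl refl] x a b c y z(1) fin_S
    unfolding q by simp
  with K show ?thesis using that[of ?\<phi>] by simp
qed

lemma form2_nonzero:
  assumes T: "T \<in> tableaux S [n - 1, 2]"
  obtains \<phi> where "\<phi> \<in> config_forms" "form2 \<phi> (polytabloid S T) \<noteq> 0"
proof -
  have D: "(0,0) \<in> young_diagram [n - 1, 2]" "(1,0) \<in> young_diagram [n - 1, 2]"
    "(0,1) \<in> young_diagram [n - 1, 2]" "(1,1) \<in> young_diagram [n - 1, 2]"
    using n by (auto simp: young_diagram_def numeral_eq_Suc)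
  obtain x where x: "x \<in> S" "T x = (0,0)" by (rule tableau_entry[OF T D(1)])
  obtain a where a: "a \<in> S" "T a = (1,0)" by (rule tableau_entry[OF T D(2)])
  obtain y where y: "y \<in> S" "T y = (0,1)" by (rule tableau_entry[OF T D(3)])
  obtain b where b: "b \<in> S" "T b = (1,1)" by (rule tableau_entry[OF T D(4)])
  obtain w where w: "w \<in> S" "w \<notin> set [x,a,y,b]" by (rule obtain_fresh[of "[x,a,y,b]"]) auto
  obtain z where z: "z \<in> S" "z \<notin> set [x,a,w,y,b]" by (rule obtain_fresh[of "[x,a,w,y,b]"]) auto
  have ne: "x \<noteq> a" "x \<noteq> b" "x \<noteq> w" "x \<noteq> y" "y \<noteq> a" "y \<noteq> b" "y \<noteq> w" 
    "a \<noteq> b" "a \<noteq> w" "b \<noteq> w" "z \<noteq> x" "z \<noteq> a" "z \<noteq> w" "z \<noteq> y" "z \<noteq> b"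
    using a b w x y z by auto
  note ne' = ne ne[symmetric]
  let ?\<phi> = "pull_form id (edge_pair_form b w z a)"
  have dist: "distinct [b,w,z,a]" using ne' by simp
  have K: "?\<phi> \<in> config_forms" by (rule pull_edge_pair_form[OF dist])
  have q: "pair_form ?\<phi> a b c d = (if c = w then (if d = z then 1 else 0) else 0)
       + (if c = z then (if d = w then 1 else 0) else 0)" 
    "pair_form ?\<phi> x b c d = 0" "pair_form ?\<phi> a y c d = 0" "pair_form ?\<phi> x y c d = 0" for c d
    unfolding pair_form_edge_pair[OF dist] edge_pair_form_def edge_indicator_def using ne' by auto
  have inner: "(\<Sum>j\<in>S. if i = p then (if j = q then 1 else 0) else 0) = (if i = p then 1 else (0::complex))"
    if "q \<in> S" for i p q :: nat
    using that fin_S by simp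
  have one: "(\<Sum>i\<in>S. \<Sum>j\<in>S. if i = p then (if j = q then 1 else 0) else 0) = (1::complex)"
    if "p \<in> S" "q \<in> S" for p q
    unfolding inner[OF that(2)] using that(1) fin_S by simp
  have "form2 ?\<phi> (polytabloid S T) = 4"
    using form2_polytabloid[OF K T _ x(2) a(2) y(2) b(2) refl] x a b y z(1) w(1) fin_S
    unfolding q sum.distrib by (simp add: one[OF w(1) z(1)] one[OF z(1) w(1)])
  with K show ?thesis using that[of ?\<phi>] by simp
qed


lemma tableau_of_list:
  assumes l: "sum_list l = n + 1" and xs: "distinct xs" "set xs \<subseteq> S"
    and ys: "distinct ys" "set ys \<subseteq> young_diagram l" and len: "length xs = length ys"
  obtains T where "T \<in> tableaux S l" "map T xs = ys"
proof -
  define f where "f = (\<lambda>i. the (map_of (zip xs ys) i))"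
  have nth: "f (xs ! i) = ys ! i" if "i < length xs" for i
    unfolding f_def using map_of_zip_nth[OF len xs(1)] that len by simp
  have map: "map f xs = ys" using nth len by (intro nth_equalityI) auto
  have "inj_on f (set xs)" using map xs(1) ys(1) by (metis distinct_map)
  moreover have "f ` set xs \<subseteq> young_diagram l" using map ys(2) by (metis list.set_map)
  ultimately obtain T where T: "T \<in> tableaux S l" "\<And>a. a \<in> set xs \<Longrightarrow> T a = f a"
    using tableau_extend[OF fin_S, of l f "set xs"] card_S l xs(2) unfolding card_young_diagram by auto
  have "map T xs = ys" unfolding map[symmetric] using T(2) by simp
  with T(1) show ?thesis by (rule that)
qed

text \<open>Adjacent exchanges move equal vertices next to each other, and a second vertex equal to
  \<open>x\<close> makes a factor of each product degenerate.\<close>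

lemma simplex_form_not_distinct:
  assumes e: "edge_form \<phi>" and "\<not> distinct [x,a,b,c,d]"
  shows "simplex_form \<phi> x a b c d = 0"
proof -
  note sw = simplex_form_swap[OF e]
  have x: "simplex_form \<phi> x x b c d = 0" for b c d
    unfolding simplex_form_def by (simp add: triangle_form_degenerate[OF e])
  have s1: "simplex_form \<phi> x a a c d = 0" for a c d using sw(1)[of x a a c d] by simp
  have s2: "simplex_form \<phi> x a b b d = 0" for a b d using sw(2)[of x a b b d] by simp
  have s3: "simplex_form \<phi> x a b c c = 0" for a b c using sw(3)[of x a b c c] by simp
  have "simplex_form \<phi> x a b a d = 0" "simplex_form \<phi> x a x b c = 0" for a b c d
    using sw(2)[of x a a b d] s1[of a b d] sw(1)[of x a x b c] x[of a b c] by simp_all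
  moreover have "simplex_form \<phi> x a b c b = 0" for a b c
    using sw(2)[of x a b c b] sw(3)[of x a c b b] s3[of a c b] sw(3)[of x a b b c] s2[of a b c] by simp
  moreover from calculation have "simplex_form \<phi> x a b c a = 0" "simplex_form \<phi> x a b x c = 0" for a b c
    using sw(3)[of x a b a c] sw(2)[of x a x b c] by simp_all
  moreover from calculation have "simplex_form \<phi> x a b c x = 0" for a b c
    using sw(3)[of x a b x c] by simp
  ultimately show ?thesis using assms(2) x s1 s2 s3 by auto
qed

text \<open>The hook settles the alternating products. For the pair products, the values on
  polytabloids are the hypotheses of the contraction lemmas, which dictate the order of the other
  shapes: \<open>s\<close> is controlled once \<open>u\<close> vanishes, and \<open>r\<close> once
  \<open>s\<close> does.\<close>

lemma forms_separate:
  assumes K: "\<phi> \<in> config_forms"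
    and f1: "\<And>T. T \<in> tableaux S [n - 3, 1, 1, 1, 1] \<Longrightarrow> form1 \<phi> (polytabloid S T) = 0"
    and f21: "\<And>T. T \<in> tableaux S [n - 2, 2, 1] \<Longrightarrow> form21 \<phi> (polytabloid S T) = 0"
    and f22: "\<And>T. T \<in> tableaux S [n - 3, 2, 2] \<Longrightarrow> form22 \<phi> (polytabloid S T) = 0"
    and f2: "\<And>T. T \<in> tableaux S [n - 1, 2] \<Longrightarrow> form2 \<phi> (polytabloid S T) = 0"
    and "{a,b,c,d} \<subseteq> S"
  shows "\<phi> a b c d = 0"
proof -
  interpret P: pair_tensor "pair_form \<phi>" S by (rule pair_tensor[OF K])
  have two: "x = 0" if "2 * x = 0" for x :: complex using that by simp
  have w: "simplex_form \<phi> e a b c d = 0" if m: "{e,a,b,c,d} \<subseteq> S" for e a b c d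
  proof (cases "distinct [e,a,b,c,d]")
    case True
    obtain T where T: "T \<in> tableaux S [n - 3, 1, 1, 1, 1]" "map T [e,a,b,c,d] = [(0,0),(1,0),(2,0),(3,0),(4,0)]"
      by (rule tableau_of_list[of "[n - 3, 1, 1, 1, 1]" "[e,a,b,c,d]" "[(0,0),(1,0),(2,0),(3,0),(4,0)]"])
        (use True m n in \<open>auto simp: young_diagram_def numeral_eq_Suc\<close>)
    then have "24 * of_nat (n + 1) * simplex_form \<phi> e a b c d = 0"
      using form1_polytabloid[OF K T(1) m] f1[OF T(1)] by simp
    then show ?thesis by (simp only: mult_eq_0_iff of_nat_eq_0_iff) auto
  qed (rule simplex_form_not_distinct[OF config_formsD(1)[OF K]])
  have u: "P.u a b = 0" if "a \<in> S" "b \<in> S" for a b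
  proof (rule P.u_eq0I[OF _ that])
    fix x a y b assume d: "distinct [x,a,y,b]" "{x,a,y,b} \<subseteq> S"
    obtain T where T: "T \<in> tableaux S [n - 1, 2]" "map T [x,a,y,b] = [(0,0),(1,0),(0,1),(1,1)]"
      by (rule tableau_of_list[of "[n - 1, 2]" "[x,a,y,b]" "[(0,0),(1,0),(0,1),(1,1)]"])
        (use d n in \<open>auto simp: young_diagram_def\<close>)
    then have "2 * (P.u a b - P.u x b - P.u a y + P.u x y) = 0"
      using form2_polytabloid[OF K T(1) d(2), of P.u] f2[OF T(1)] by (simp add: P.u_def P.s_def)
    then show "P.u a b - P.u x b - P.u a y + P.u x y = 0" by (rule two)
  qed
  define F where "F x a c b = P.s a b c + P.s c b x + P.s x b a - P.s x b c - P.s c b a - P.s a b x" for x a c b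
  have s: "P.s a b c = 0" if "a \<in> S" "b \<in> S" "c \<in> S" for a b c
  proof (rule P.s_eq0I[OF u F_def _ that])
    fix x a c y b assume d: "distinct [x,a,c,y,b]" "{x,a,c,y,b} \<subseteq> S"
    obtain T where T: "T \<in> tableaux S [n - 2, 2, 1]" "map T [x,a,c,y,b] = [(0,0),(1,0),(2,0),(0,1),(1,1)]"
      by (rule tableau_of_list[of "[n - 2, 2, 1]" "[x,a,c,y,b]" "[(0,0),(1,0),(2,0),(0,1),(1,1)]"])
        (use d n in \<open>auto simp: young_diagram_def numeral_eq_Suc\<close>)
    then have "2 * (F x a c b - F x a c y) = 0"
      using form21_polytabloid[OF K T(1) d(2) _ _ _ _ _ P.s_def F_def] f21[OF T(1)] by simp
    then show "F x a c b = F x a c y" by simp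
  qed
  have r: "P.r a c b d = 0" if "{a,b,c,d} \<subseteq> S" for a b c d
  proof (rule P.r_eq0I[OF s])
    show "a \<in> S" "b \<in> S" "c \<in> S" "d \<in> S" using that by auto
    fix x a c y b d assume d: "distinct [x,a,c,y,b,d]" "{x,a,c,y,b,d} \<subseteq> S"
    obtain T where T: "T \<in> tableaux S [n - 3, 2, 2]" 
      "map T [x,a,c,y,b,d] = [(0,0),(1,0),(2,0),(0,1),(1,1),(2,1)]"
      by (rule tableau_of_list[of "[n - 3, 2, 2]" "[x,a,c,y,b,d]" "[(0,0),(1,0),(2,0),(0,1),(1,1),(2,1)]"])
        (use d n in \<open>auto simp: young_diagram_def numeral_eq_Suc\<close>)
    define L where "L b d = pair_form \<phi> a b c d + pair_form \<phi> c b x d + pair_form \<phi> x b a d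
        - pair_form \<phi> x b c d - pair_form \<phi> c b a d - pair_form \<phi> a b x d" for b d
    \<comment> \<open>After antisymmetrization in \<open>b\<close> and \<open>d\<close>, the terms
      of \<open>L\<close> combine in pairs to values of \<open>r\<close>.\<close>
    have L: "L b d - L d b = 2 * (P.r a c b d + P.r c x b d + P.r x a b d)" for b d
    proof -
      have "L b d - L d b = P.r a c b d - P.r c a b d + P.r c x b d - P.r x c b d + P.r x a b d - P.r a x b d"
        unfolding L_def P.r_def by (simp add: algebra_simps)
      then show ?thesis 
        unfolding P.r_swap1[of a c] P.r_swap1[of c x] P.r_swap1[of x a] by simp
    qed
    have "4 * (L b d + L d y + L y b - L y d - L d b - L b y) = 0"
      using form22_polytabloid[OF K T(1) d(2) _ _ _ _ _ _ L_def] f22[OF T(1)] T(2) by simp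
    then have "4 * ((L b d - L d b) + (L d y - L y d) + (L y b - L b y)) = 0"
      by (simp add: algebra_simps)
    then have "(L b d - L d b) + (L d y - L y d) + (L y b - L b y) = 0"
      by (simp only: mult_eq_0_iff) simp
    then have "2 * (P.r a c b d + P.r a c d y + P.r a c y b + P.r c x b d + P.r c x d y + P.r c x y b
      + P.r x a b d + P.r x a d y + P.r x a y b) = 0"
      unfolding L by (simp add: algebra_simps)
    then show "P.r a c b d + P.r a c d y + P.r a c y b + P.r c x b d + P.r c x d y + P.r c x y b
      + P.r x a b d + P.r x a d y + P.r x a y b = 0" by (rule two)
  qed
  show ?thesis
  proof (rule config_form_eq0I[OF K])
    show "pair_form \<phi> a b c d = 0" if "{a,b,c,d} \<subseteq> S" for a b c d
      by (rule P.q_eq0I[OF _ that]) (rule r)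
    show "simplex_form \<phi> e a b c d = 0" if "{e,a,b,c,d} \<subseteq> S" for e a b c d
      using that by (rule w)
  qed (use assms(6) S in auto)
qed

end

section \<open>Realising the sum of the Specht modules\<close>

lemma specht_form_cong:
  "(\<And>t. t \<in> tabloids S l \<Longrightarrow> v t = w t) \<Longrightarrow> specht_form S l P Q R U h v = specht_form S l P Q R U h w"
  unfolding specht_form_def by (intro sum.cong) auto

context young_symmetrizer begin

text \<open>The permutation passes from the vector to the form, where \<open>pair_form\<close> and
  \<open>simplex_form\<close> absorb it; the summation over \<open>x\<close> in \<open>form1\<close>
  is only reindexed.\<close>

lemma form_pull:
  assumes K: "\<phi> \<in> config_forms" and \<sigma>: "\<sigma> permutes S"
  shows "form1 \<phi> (\<lambda>t. v (t \<circ> \<sigma>)) = form1 (pull_form \<sigma> \<phi>) v"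
    "form21 \<phi> (\<lambda>t. v (t \<circ> \<sigma>)) = form21 (pull_form \<sigma> \<phi>) v"
    "form22 \<phi> (\<lambda>t. v (t \<circ> \<sigma>)) = form22 (pull_form \<sigma> \<phi>) v"
    "form2 \<phi> (\<lambda>t. v (t \<circ> \<sigma>)) = form2 (pull_form \<sigma> \<phi>) v"
proof -
  note e = config_formsD(1)[OF K]
  have p: "pair_form (pull_form \<sigma> \<phi>) = (\<lambda>a b c d. pair_form \<phi> (\<sigma> a) (\<sigma> b) (\<sigma> c) (\<sigma> d))"
    by (intro ext pair_form_pull[OF e])
  have s: "(\<Sum>x\<in>S. simplex_form \<phi> x (\<sigma> a) (\<sigma> b) (\<sigma> c) (\<sigma> d)) = 
      (\<Sum>x\<in>S. simplex_form (pull_form \<sigma> \<phi>) x a b c d)" for a b c d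
    unfolding simplex_form_pull[OF e] 
    by (rule sum_permute_S[OF \<sigma>, of "\<lambda>x. simplex_form \<phi> x (\<sigma> a) (\<sigma> b) (\<sigma> c) (\<sigma> d)", symmetric])
  show "form1 \<phi> (\<lambda>t. v (t \<circ> \<sigma>)) = form1 (pull_form \<sigma> \<phi>) v"
    unfolding form1_def specht_form_act[OF \<sigma>] s ..
  show "form21 \<phi> (\<lambda>t. v (t \<circ> \<sigma>)) = form21 (pull_form \<sigma> \<phi>) v"
    "form22 \<phi> (\<lambda>t. v (t \<circ> \<sigma>)) = form22 (pull_form \<sigma> \<phi>) v"
    "form2 \<phi> (\<lambda>t. v (t \<circ> \<sigma>)) = form2 (pull_form \<sigma> \<phi>) v"
    unfolding form21_def form22_def form2_def specht_form_act[OF \<sigma>] p by (rule refl)+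
qed

lemma form_antisym:
  assumes K: "\<phi> \<in> config_forms"
  shows "form1 \<phi> (column_antisym S T v) = (\<Sum>\<pi>\<in>column_stabilizer S T. of_int (sign \<pi>) * form1 (pull_form \<pi> \<phi>) v)"
    "form21 \<phi> (column_antisym S T v) = (\<Sum>\<pi>\<in>column_stabilizer S T. of_int (sign \<pi>) * form21 (pull_form \<pi> \<phi>) v)"
    "form22 \<phi> (column_antisym S T v) = (\<Sum>\<pi>\<in>column_stabilizer S T. of_int (sign \<pi>) * form22 (pull_form \<pi> \<phi>) v)"
    "form2 \<phi> (column_antisym S T v) = (\<Sum>\<pi>\<in>column_stabilizer S T. of_int (sign \<pi>) * form2 (pull_form \<pi> \<phi>) v)"
proof -
  have c: "column_antisym S T v = (\<lambda>t. \<Sum>\<pi>\<in>column_stabilizer S T. of_int (sign \<pi>) * v (t \<circ> \<pi>))"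
    by (rule ext) (simp add: column_antisym_def)
  note f = form_pull[OF K column_stabilizer_permutes, unfolded form1_def form21_def form22_def form2_def]
  show "form1 \<phi> (column_antisym S T v) = (\<Sum>\<pi>\<in>column_stabilizer S T. of_int (sign \<pi>) * form1 (pull_form \<pi> \<phi>) v)"
    "form21 \<phi> (column_antisym S T v) = (\<Sum>\<pi>\<in>column_stabilizer S T. of_int (sign \<pi>) * form21 (pull_form \<pi> \<phi>) v)"
    "form22 \<phi> (column_antisym S T v) = (\<Sum>\<pi>\<in>column_stabilizer S T. of_int (sign \<pi>) * form22 (pull_form \<pi> \<phi>) v)"
    "form2 \<phi> (column_antisym S T v) = (\<Sum>\<pi>\<in>column_stabilizer S T. of_int (sign \<pi>) * form2 (pull_form \<pi> \<phi>) v)"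
    unfolding c form1_def form21_def form22_def form2_def specht_form_sum specht_form_smult
    by (intro sum.cong refl arg_cong2[of _ _ _ _ "(*)"] f; assumption)+
qed

section \<open>The joint functional and its kernel\<close>

definition total_form where
  "total_form \<phi> v = (case v of (v1, v21, v22, v2) \<Rightarrow> form1 \<phi> v1 + form21 \<phi> v21 + form22 \<phi> v22 + form2 \<phi> v2)"

text \<open>Column permutations become \<open>pull_form\<close> on the forms, and this preserves
  \<open>config_forms\<close>. So a quadruple that all forms annihilate stays so when one signed
  column sum is applied to all its components.\<close>

lemma total_form_antisym:
  assumes "\<And>\<phi>. \<phi> \<in> config_forms \<Longrightarrow> total_form \<phi> (v1, v21, v22, v2) = 0" and K: "\<phi> \<in> config_forms"
  shows "form1 \<phi> (column_antisym S T v1) + form21 \<phi> (column_antisym S T v21)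
    + form22 \<phi> (column_antisym S T v22) + form2 \<phi> (column_antisym S T v2) = 0"
  unfolding form_antisym[OF K] sum.distrib[symmetric] distrib_left[symmetric]
  using assms(1)[OF pull_form_config[OF K]] unfolding total_form_def by (simp add: prod.case)

lemma form_eq0:
  "(\<And>t. t \<in> tabloids S [n - 3, 1, 1, 1, 1] \<Longrightarrow> v t = 0) \<Longrightarrow> form1 \<phi> v = 0"
  "(\<And>t. t \<in> tabloids S [n - 2, 2, 1] \<Longrightarrow> v t = 0) \<Longrightarrow> form21 \<phi> v = 0"
  "(\<And>t. t \<in> tabloids S [n - 3, 2, 2] \<Longrightarrow> v t = 0) \<Longrightarrow> form22 \<phi> v = 0"
  "(\<And>t. t \<in> tabloids S [n - 1, 2] \<Longrightarrow> v t = 0) \<Longrightarrow> form2 \<phi> v = 0"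
  unfolding form1_def form21_def form22_def form2_def specht_form_def by (simp_all add: sum.neutral)

lemma form_coeff:
  "(\<And>t. t \<in> tabloids S [n - 3, 1, 1, 1, 1] \<Longrightarrow> v t = c * w t) \<Longrightarrow> form1 \<phi> v = c * form1 \<phi> w"
  "(\<And>t. t \<in> tabloids S [n - 2, 2, 1] \<Longrightarrow> v t = c * w t) \<Longrightarrow> form21 \<phi> v = c * form21 \<phi> w"
  "(\<And>t. t \<in> tabloids S [n - 3, 2, 2] \<Longrightarrow> v t = c * w t) \<Longrightarrow> form22 \<phi> v = c * form22 \<phi> w"
  "(\<And>t. t \<in> tabloids S [n - 1, 2] \<Longrightarrow> v t = c * w t) \<Longrightarrow> form2 \<phi> v = c * form2 \<phi> w"
  unfolding form1_def form21_def form22_def form2_def specht_form_smult[symmetric] by (rule specht_form_cong; simp)+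

text \<open>The bound on \<open>n\<close> makes \<open>n - 3\<close> at least 2, so that the list
  \<open>[n - 3, 2, 2]\<close> is a partition.\<close>

lemma sorted_shapes:
  "sorted_wrt (\<ge>) [n - 3, 1, 1, 1, 1]" "sorted_wrt (\<ge>) [n - 2, 2, 1]"
  "sorted_wrt (\<ge>) [n - 3, 2, 2]" "sorted_wrt (\<ge>) [n - 1, 2]"
  using n by auto

text \<open>For a tableau of one shape, its signed column sum leaves a multiple of a single
  polytabloid in the component of that shape. The other components contribute nothing, either by a
  pigeonhole argument or because they are known to be zero; this dictates the order, the hook first
  and then by increasing first row. A form that does not vanish on the polytabloid forces the
  multiple to be zero.\<close>

lemma total_form_kernel:
  assumes v: "v1 \<in> carrier (specht S [n - 3, 1, 1, 1, 1])" "v21 \<in> carrier (specht S [n - 2, 2, 1])"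
    "v22 \<in> carrier (specht S [n - 3, 2, 2])" "v2 \<in> carrier (specht S [n - 1, 2])"
    and z: "\<And>\<phi>. \<phi> \<in> config_forms \<Longrightarrow> total_form \<phi> (v1, v21, v22, v2) = 0"
  shows "v1 = (\<lambda>t. 0) \<and> v21 = (\<lambda>t. 0) \<and> v22 = (\<lambda>t. 0) \<and> v2 = (\<lambda>t. 0)"
proof -
  note same = column_antisym_same_shape[OF fin_S _ _ sorted_shapes(1)] column_antisym_same_shape[OF fin_S _ _ sorted_shapes(2)]
    column_antisym_same_shape[OF fin_S _ _ sorted_shapes(3)] column_antisym_same_shape[OF fin_S _ _ sorted_shapes(4)]
  have anti0: "column_antisym S T (\<lambda>t. 0) t = 0" for T t unfolding column_antisym_def by simp
  \<comment> \<open>The hook has five rows and the other shapes at most three.\<close>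
  have 1: "v1 = (\<lambda>t. 0)"
  proof (rule specht_eq0I[OF fin_S v(1)])
    fix T assume T: "T \<in> tableaux S [n - 3, 1, 1, 1, 1]"
    obtain \<phi> where K: "\<phi> \<in> config_forms" and nz: "form1 \<phi> (polytabloid S T) \<noteq> 0" by (rule form1_nonzero[OF T])
    have pos: "0 < [n - 3, 1, 1, 1, 1] ! r" if "r < length [n - 3, 1, 1, 1, 1]" for r
      using that n by (auto simp: less_Suc_eq)
    have sh: "column_antisym S T v t = 0" if "t \<in> tabloids S m" "length m < 5" for v t m
      by (rule column_antisym_shorter[OF fin_S T _ that(1)]) (use pos that(2) in auto)
    have "form21 \<phi> (column_antisym S T v21) = 0" "form22 \<phi> (column_antisym S T v22) = 0" 
      "form2 \<phi> (column_antisym S T v2) = 0"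
      by (rule form_eq0, erule sh, simp)+
    moreover have "form1 \<phi> (column_antisym S T v1) = polytabloid_coeff S T v1 * form1 \<phi> (polytabloid S T)"
      by (rule form_coeff) (rule same(1)[OF T])
    ultimately have "polytabloid_coeff S T v1 * form1 \<phi> (polytabloid S T) = 0"
      using total_form_antisym[OF z K, of T] by simp
    then show "polytabloid_coeff S T v1 = 0" using nz by simp
  qed
  \<comment> \<open>The first row has the same length as that of the hook, whose component has just
    been shown to be zero; the two remaining shapes have a longer first row.\<close>
  have 2: "v22 = (\<lambda>t. 0)"
  proof (rule specht_eq0I[OF fin_S v(3)])
    fix T assume T: "T \<in> tableaux S [n - 3, 2, 2]"
    obtain \<phi> where K: "\<phi> \<in> config_forms" and nz: "form22 \<phi> (polytabloid S T) \<noteq> 0" by (rule form22_nonzero[OF T])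
    have sh: "column_antisym S T v t = 0" if "t \<in> tabloids S m" "0 < length m" "[n - 3, 2, 2] ! 0 < m ! 0" for v t m
      by (rule column_antisym_larger_row[OF fin_S T sorted_shapes(3) that])
    have "form21 \<phi> (column_antisym S T v21) = 0" 
      "form2 \<phi> (column_antisym S T v2) = 0"
      by (rule form_eq0, erule sh; use n in simp)+
    moreover have "form1 \<phi> (column_antisym S T v1) = 0"
      unfolding 1 by (rule form_eq0) (rule anti0)
    moreover have "form22 \<phi> (column_antisym S T v22) = polytabloid_coeff S T v22 * form22 \<phi> (polytabloid S T)"
      by (rule form_coeff) (rule same(3)[OF T])
    ultimately have "polytabloid_coeff S T v22 * form22 \<phi> (polytabloid S T) = 0"
      using total_form_antisym[OF z K, of T] by simp
    then show "polytabloid_coeff S T v22 = 0" using nz by simp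
  qed
  have 3: "v21 = (\<lambda>t. 0)"
  proof (rule specht_eq0I[OF fin_S v(2)])
    fix T assume T: "T \<in> tableaux S [n - 2, 2, 1]"
    obtain \<phi> where K: "\<phi> \<in> config_forms" and nz: "form21 \<phi> (polytabloid S T) \<noteq> 0" by (rule form21_nonzero[OF T])
    have sh: "column_antisym S T v t = 0" if "t \<in> tabloids S m" "0 < length m" "[n - 2, 2, 1] ! 0 < m ! 0" for v t m
      by (rule column_antisym_larger_row[OF fin_S T sorted_shapes(2) that])
    have "form2 \<phi> (column_antisym S T v2) = 0"
      by (rule form_eq0, erule sh; use n in simp)
    moreover have "form1 \<phi> (column_antisym S T v1) = 0" "form22 \<phi> (column_antisym S T v22) = 0"
      unfolding 1 2 by (rule form_eq0, rule anti0)+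
    moreover have "form21 \<phi> (column_antisym S T v21) = polytabloid_coeff S T v21 * form21 \<phi> (polytabloid S T)"
      by (rule form_coeff) (rule same(2)[OF T])
    ultimately have "polytabloid_coeff S T v21 * form21 \<phi> (polytabloid S T) = 0"
      using total_form_antisym[OF z K, of T] by simp
    then show "polytabloid_coeff S T v21 = 0" using nz by simp
  qed
  have 4: "v2 = (\<lambda>t. 0)"
  proof (rule specht_eq0I[OF fin_S v(4)])
    fix T assume T: "T \<in> tableaux S [n - 1, 2]"
    obtain \<phi> where K: "\<phi> \<in> config_forms" and nz: "form2 \<phi> (polytabloid S T) \<noteq> 0" by (rule form2_nonzero[OF T])
    have "form1 \<phi> (column_antisym S T v1) = 0" "form22 \<phi> (column_antisym S T v22) = 0"
      "form21 \<phi> (column_antisym S T v21) = 0"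
      unfolding 1 2 3 by (rule form_eq0, rule anti0)+
    moreover have "form2 \<phi> (column_antisym S T v2) = polytabloid_coeff S T v2 * form2 \<phi> (polytabloid S T)"
      by (rule form_coeff) (rule same(4)[OF T])
    ultimately have "polytabloid_coeff S T v2 * form2 \<phi> (polytabloid S T) = 0"
      using total_form_antisym[OF z K, of T] by simp
    then show "polytabloid_coeff S T v2 = 0" using nz by simp
  qed
  show ?thesis using 1 2 3 4 by blast
qed

definition specht_sum where
  "specht_sum = specht S [n - 3, 1, 1, 1, 1] \<oplus>\<^sub>R specht S [n - 2, 2, 1] \<oplus>\<^sub>R specht S [n - 3, 2, 2] \<oplus>\<^sub>R specht S [n - 1, 2]"

lemma specht_sum_carrier: "(v1, v21, v22, v2) \<in> carrier specht_sum \<longleftrightarrow>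
    v1 \<in> carrier (specht S [n - 3, 1, 1, 1, 1]) \<and> v21 \<in> carrier (specht S [n - 2, 2, 1]) \<and>
    v22 \<in> carrier (specht S [n - 3, 2, 2]) \<and> v2 \<in> carrier (specht S [n - 1, 2])"
  unfolding specht_sum_def rep_sum_def by simp

lemma specht_sum_ops:
  "(v1, v21, v22, v2) \<oplus>\<^bsub>specht_sum\<^esub> (w1, w21, w22, w2)
    = ((\<lambda>t. v1 t + w1 t), (\<lambda>t. v21 t + w21 t), (\<lambda>t. v22 t + w22 t), (\<lambda>t. v2 t + w2 t))"
  "c \<odot>\<^bsub>specht_sum\<^esub> (v1, v21, v22, v2) = ((\<lambda>t. c * v1 t), (\<lambda>t. c * v21 t), (\<lambda>t. c * v22 t), (\<lambda>t. c * v2 t))"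
  "act specht_sum \<sigma> (v1, v21, v22, v2)
    = ((\<lambda>t. v1 (t \<circ> \<sigma>)), (\<lambda>t. v21 (t \<circ> \<sigma>)), (\<lambda>t. v22 (t \<circ> \<sigma>)), (\<lambda>t. v2 (t \<circ> \<sigma>)))"
  unfolding specht_sum_def rep_sum_def by simp_all

lemma specht_sum_closed:
  assumes "v \<in> carrier specht_sum"
  shows "w \<in> carrier specht_sum \<Longrightarrow> v \<oplus>\<^bsub>specht_sum\<^esub> w \<in> carrier specht_sum"
    "c \<odot>\<^bsub>specht_sum\<^esub> v \<in> carrier specht_sum"
    "\<sigma> permutes S \<Longrightarrow> act specht_sum \<sigma> v \<in> carrier specht_sum"
proof -
  show "v \<oplus>\<^bsub>specht_sum\<^esub> w \<in> carrier specht_sum" if "w \<in> carrier specht_sum"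
    using assms that by (cases v; cases w) (simp add: specht_sum_carrier specht_sum_ops specht_add)
  show "c \<odot>\<^bsub>specht_sum\<^esub> v \<in> carrier specht_sum"
    using assms by (cases v) (simp add: specht_sum_carrier specht_sum_ops specht_smult)
  show "act specht_sum \<sigma> v \<in> carrier specht_sum" if "\<sigma> permutes S"
    using assms that by (cases v) (simp add: specht_sum_carrier specht_sum_ops specht_act[OF fin_S])
qed

lemma total_form_ops:
  "total_form \<phi> (v \<oplus>\<^bsub>specht_sum\<^esub> w) = total_form \<phi> v + total_form \<phi> w"
  "total_form \<phi> (c \<odot>\<^bsub>specht_sum\<^esub> v) = c * total_form \<phi> v"
  by (cases v; cases w; simp add: specht_sum_ops total_form_def form1_def form21_def form22_def form2_def
      specht_form_add)
    (cases v; simp add: specht_sum_ops total_form_def form1_def form21_def form22_def form2_def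
      specht_form_smult distrib_left)

lemma total_form_act: "\<phi> \<in> config_forms \<Longrightarrow> \<sigma> permutes S \<Longrightarrow>
    total_form \<phi> (act specht_sum \<sigma> v) = total_form (pull_form \<sigma> \<phi>) v"
  by (cases v) (simp add: specht_sum_ops total_form_def form_pull)

lemma total_form_inj:
  assumes v: "v \<in> carrier specht_sum" and w: "w \<in> carrier specht_sum"
    and eq: "\<And>\<phi>. \<phi> \<in> config_forms \<Longrightarrow> total_form \<phi> v = total_form \<phi> w"
  shows "v = w"
proof -
  obtain v1 v21 v22 v2 w1 w21 w22 w2 where vw: "v = (v1, v21, v22, v2)" "w = (w1, w21, w22, w2)"
    by (metis prod_cases4)
  have d: "v \<oplus>\<^bsub>specht_sum\<^esub> ((-1) \<odot>\<^bsub>specht_sum\<^esub> w) = ((\<lambda>t. v1 t + (-1) * w1 t), (\<lambda>t. v21 t + (-1) * w21 t),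
      (\<lambda>t. v22 t + (-1) * w22 t), (\<lambda>t. v2 t + (-1) * w2 t))"
    unfolding vw specht_sum_ops ..
  have "v \<oplus>\<^bsub>specht_sum\<^esub> ((-1) \<odot>\<^bsub>specht_sum\<^esub> w) \<in> carrier specht_sum"
    by (intro specht_sum_closed v w)
  moreover have "total_form \<phi> (v \<oplus>\<^bsub>specht_sum\<^esub> ((-1) \<odot>\<^bsub>specht_sum\<^esub> w)) = 0" if "\<phi> \<in> config_forms" for \<phi>
    unfolding total_form_ops eq[OF that] by simp
  ultimately have "(\<lambda>t. v1 t + (-1) * w1 t) = (\<lambda>t. 0) \<and> (\<lambda>t. v21 t + (-1) * w21 t) = (\<lambda>t. 0) \<and>
      (\<lambda>t. v22 t + (-1) * w22 t) = (\<lambda>t. 0) \<and> (\<lambda>t. v2 t + (-1) * w2 t) = (\<lambda>t. 0)"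
    unfolding d specht_sum_carrier by (intro total_form_kernel) auto
  then show ?thesis unfolding vw by (simp add: fun_eq_iff)
qed

end

text \<open>What is required of the degree \<open>2 * (d - 1)\<close> part: a pairing with
  \<open>config_forms\<close> for which the action is adjoint to \<open>pull_form\<close>, every
  evaluation at labels is represented by a vector, and forms separate subspaces. The last condition
  expresses finite-dimensional duality.\<close>

locale form_pairing = young_symmetrizer +
  fixes V :: "'a perm_rep" and pr :: "'a \<Rightarrow> quad_form \<Rightarrow> complex"
  assumes add_closed: "x \<in> carrier V \<Longrightarrow> y \<in> carrier V \<Longrightarrow> x \<oplus>\<^bsub>V\<^esub> y \<in> carrier V"
    and smult_closed: "x \<in> carrier V \<Longrightarrow> k \<odot>\<^bsub>V\<^esub> x \<in> carrier V"
    and act_closed: "x \<in> carrier V \<Longrightarrow> \<sigma> permutes S \<Longrightarrow> act V \<sigma> x \<in> carrier V"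
    and pr_add: "x \<in> carrier V \<Longrightarrow> y \<in> carrier V \<Longrightarrow> \<phi> \<in> config_forms \<Longrightarrow> pr (x \<oplus>\<^bsub>V\<^esub> y) \<phi> = pr x \<phi> + pr y \<phi>"
    and pr_smult: "x \<in> carrier V \<Longrightarrow> \<phi> \<in> config_forms \<Longrightarrow> pr (k \<odot>\<^bsub>V\<^esub> x) \<phi> = k * pr x \<phi>"
    and pr_act: "x \<in> carrier V \<Longrightarrow> \<sigma> permutes S \<Longrightarrow> \<phi> \<in> config_forms \<Longrightarrow> pr (act V \<sigma> x) \<phi> = pr x (pull_form \<sigma> \<phi>)"
    and pr_eval: "{a, b, c, d} \<subseteq> S \<Longrightarrow> \<exists>x\<in>carrier V. \<forall>\<phi>\<in>config_forms. pr x \<phi> = \<phi> a b c d"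
    and pr_local: "x \<in> carrier V \<Longrightarrow> \<phi> \<in> config_forms \<Longrightarrow> (\<And>a b c d. {a, b, c, d} \<subseteq> S \<Longrightarrow> \<phi> a b c d = 0) \<Longrightarrow> pr x \<phi> = 0"
    and pr_inj: "x \<in> carrier V \<Longrightarrow> y \<in> carrier V \<Longrightarrow> (\<And>\<phi>. \<phi> \<in> config_forms \<Longrightarrow> pr x \<phi> = pr y \<phi>) \<Longrightarrow> x = y"
    and separation: "M \<subseteq> carrier V \<Longrightarrow> M \<noteq> {} \<Longrightarrow> (\<And>x y. x \<in> M \<Longrightarrow> y \<in> M \<Longrightarrow> x \<oplus>\<^bsub>V\<^esub> y \<in> M) \<Longrightarrow>
      (\<And>k x. x \<in> M \<Longrightarrow> k \<odot>\<^bsub>V\<^esub> x \<in> M) \<Longrightarrow> x \<in> carrier V \<Longrightarrow> x \<notin> M \<Longrightarrow>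
      \<exists>\<phi>\<in>config_forms. (\<forall>y\<in>M. pr y \<phi> = 0) \<and> pr x \<phi> \<noteq> 0"
begin

definition representable where
  "representable F \<longleftrightarrow> (\<exists>x\<in>carrier V. \<forall>\<phi>\<in>config_forms. pr x \<phi> = F \<phi>)"

lemma representable_add: "representable F \<Longrightarrow> representable G \<Longrightarrow> representable (\<lambda>\<phi>. F \<phi> + G \<phi>)"
proof -
  assume "representable F" "representable G"
  then obtain x y where "x \<in> carrier V" "\<forall>\<phi>\<in>config_forms. pr x \<phi> = F \<phi>" 
    "y \<in> carrier V" "\<forall>\<phi>\<in>config_forms. pr y \<phi> = G \<phi>"
    unfolding representable_def by blast
  then show ?thesis
    unfolding representable_def by (intro bexI[of _ "x \<oplus>\<^bsub>V\<^esub> y"]) (simp_all add: pr_add add_closed)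
qed

lemma representable_smult: "representable F \<Longrightarrow> representable (\<lambda>\<phi>. c * F \<phi>)"
proof -
  assume "representable F"
  then obtain x where "x \<in> carrier V" "\<forall>\<phi>\<in>config_forms. pr x \<phi> = F \<phi>" 
    unfolding representable_def by blast
  then show ?thesis
    unfolding representable_def by (intro bexI[of _ "c \<odot>\<^bsub>V\<^esub> x"]) (simp_all add: pr_smult smult_closed)
qed

lemma representable_diff:
  assumes "representable F" "representable G"
  shows "representable (\<lambda>\<phi>. F \<phi> - G \<phi>)"
  using representable_add[OF assms(1) representable_smult[OF assms(2), of "-1"]] by simp

lemma representable_eval: "{a, b, c, d} \<subseteq> S \<Longrightarrow> representable (\<lambda>\<phi>. \<phi> a b c d)"
  unfolding representable_def by (rule pr_eval)

lemma representable_0: "representable (\<lambda>\<phi>. 0)"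
  using representable_smult[OF representable_eval[of 0 0 0 0], of 0] S by simp

lemma representable_sum:
  assumes "\<And>i. i \<in> I \<Longrightarrow> representable (F i)"
  shows "representable (\<lambda>\<phi>. \<Sum>i\<in>I. F i \<phi>)"
proof (cases "finite I")
  case True
  then show ?thesis using assms
    by (induction I rule: finite_induct) (simp_all add: representable_0 representable_add)
qed (simp add: representable_0)

lemma representable_triangle:
  "{a, b, c, d, e, f} \<subseteq> S \<Longrightarrow> representable (\<lambda>\<phi>. triangle_form \<phi> a b c d e f)"
  unfolding triangle_form_def by (intro representable_add representable_eval) auto

lemma representable_specht_form:
  assumes "\<And>a b c d. {a, b, c, d} \<subseteq> S \<Longrightarrow> representable (\<lambda>\<phi>. h \<phi> a b c d)"
  shows "representable (\<lambda>\<phi>. specht_form S l P Q R U (h \<phi>) v)"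
  unfolding specht_form_def tabloid_form_def
  by (intro representable_sum representable_smult assms) auto

text \<open>\<open>total_form\<close> is a finite linear combination of values of the form, and each
  of these is represented in \<open>V\<close>.\<close>

lemma representable_total_form: "representable (\<lambda>\<phi>. total_form \<phi> v)"
proof -
  have "representable (\<lambda>\<phi>. form1 \<phi> w)" "representable (\<lambda>\<phi>. form21 \<phi> w)"
    "representable (\<lambda>\<phi>. form22 \<phi> w)" "representable (\<lambda>\<phi>. form2 \<phi> w)" for w
    unfolding form1_def form21_def form22_def form2_def simplex_form_def pair_form_def
    by (intro representable_specht_form representable_sum representable_add representable_diff
        representable_triangle; auto)+
  then show ?thesis unfolding total_form_def by (cases v) (simp add: representable_add)
qed

text \<open>The vector is unique by \<open>pr_inj\<close>, which also makes the chosen map linear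
  and equivariant.\<close>

definition realise where
  "realise v = (SOME x. x \<in> carrier V \<and> (\<forall>\<phi>\<in>config_forms. pr x \<phi> = total_form \<phi> v))"

lemma realise: "realise v \<in> carrier V" "\<phi> \<in> config_forms \<Longrightarrow> pr (realise v) \<phi> = total_form \<phi> v"
proof -
  have "\<exists>x. x \<in> carrier V \<and> (\<forall>\<phi>\<in>config_forms. pr x \<phi> = total_form \<phi> v)"
    using representable_total_form[of v] unfolding representable_def by blast
  from someI_ex[OF this] show "realise v \<in> carrier V" "\<phi> \<in> config_forms \<Longrightarrow> pr (realise v) \<phi> = total_form \<phi> v"
    unfolding realise_def by auto
qed

lemma realise_ops:
  "realise (v \<oplus>\<^bsub>specht_sum\<^esub> w) = realise v \<oplus>\<^bsub>V\<^esub> realise w"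
  "realise (c \<odot>\<^bsub>specht_sum\<^esub> v) = c \<odot>\<^bsub>V\<^esub> realise v"
  "\<sigma> permutes S \<Longrightarrow> realise (act specht_sum \<sigma> v) = act V \<sigma> (realise v)"
proof -
  show "realise (v \<oplus>\<^bsub>specht_sum\<^esub> w) = realise v \<oplus>\<^bsub>V\<^esub> realise w"
    by (rule pr_inj) (simp_all add: realise add_closed pr_add total_form_ops)
  show "realise (c \<odot>\<^bsub>specht_sum\<^esub> v) = c \<odot>\<^bsub>V\<^esub> realise v"
    by (rule pr_inj) (simp_all add: realise smult_closed pr_smult total_form_ops)
  show "realise (act specht_sum \<sigma> v) = act V \<sigma> (realise v)" if "\<sigma> permutes S"
    by (rule pr_inj) (simp_all add: realise act_closed pr_act total_form_act pull_form_config that)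
qed

text \<open>Injectivity is the triviality of the joint kernel. A vector outside the image would be
  separated from it by a form; that form kills all realised polytabloids, hence vanishes on the
  labels in \<open>S\<close> and pairs to zero with every vector.\<close>

lemma bij_realise: "bij_betw realise (carrier specht_sum) (carrier V)"
  unfolding bij_betw_def
proof
  show "inj_on realise (carrier specht_sum)"
    by (rule inj_onI, rule total_form_inj) (auto simp: realise(2)[symmetric])
  let ?M = "realise ` carrier specht_sum"
  have sub: "?M \<subseteq> carrier V" using realise(1) by blast
  have poly: "polytabloid S T \<in> carrier (specht S l)" if "T \<in> tableaux S l" for T l
    using that by (rule polytabloid_specht)
  have zero: "(\<lambda>t. 0) \<in> carrier (specht S l)" for l by (rule specht_zero)
  have "carrier V \<subseteq> ?M"
  proof
    fix x assume x: "x \<in> carrier V"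
    show "x \<in> ?M"
    proof (rule ccontr)
      assume "x \<notin> ?M"
      have "\<exists>\<phi>\<in>config_forms. (\<forall>y\<in>?M. pr y \<phi> = 0) \<and> pr x \<phi> \<noteq> 0"
      proof (rule separation[OF sub _ _ _ x \<open>x \<notin> ?M\<close>])
        show "?M \<noteq> {}" using zero specht_sum_carrier by blast
        show "y \<oplus>\<^bsub>V\<^esub> z \<in> ?M" if yz: "y \<in> ?M" "z \<in> ?M" for y z
        proof -
          obtain v w where "v \<in> carrier specht_sum" "w \<in> carrier specht_sum" "y = realise v" "z = realise w"
            using yz by blast
          then show ?thesis
            by (intro image_eqI[of _ _ "v \<oplus>\<^bsub>specht_sum\<^esub> w"]) (simp_all add: realise_ops specht_sum_closed)
        qed
        show "c \<odot>\<^bsub>V\<^esub> y \<in> ?M" if y: "y \<in> ?M" for c y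
        proof -
          obtain v where "v \<in> carrier specht_sum" "y = realise v" using y by blast
          then show ?thesis
            by (intro image_eqI[of _ _ "c \<odot>\<^bsub>specht_sum\<^esub> v"]) (simp_all add: realise_ops specht_sum_closed)
        qed
      qed
      then obtain \<phi> where K: "\<phi> \<in> config_forms" and M: "\<forall>y\<in>?M. pr y \<phi> = 0" and nz: "pr x \<phi> \<noteq> 0" by blast
      have t: "total_form \<phi> (v1, v21, v22, v2) = 0" if "(v1, v21, v22, v2) \<in> carrier specht_sum" for v1 v21 v22 v2
        using M realise(2)[OF K] imageI[OF that, of realise] by metis
      have f0: "form1 \<phi> (\<lambda>t. 0) = 0" "form21 \<phi> (\<lambda>t. 0) = 0" "form22 \<phi> (\<lambda>t. 0) = 0" "form2 \<phi> (\<lambda>t. 0) = 0"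
        unfolding form1_def form21_def form22_def form2_def by (simp_all add: specht_form_zero)
      have "form1 \<phi> (polytabloid S T) = 0" if "T \<in> tableaux S [n - 3, 1, 1, 1, 1]" for T
        using t[of "polytabloid S T" "\<lambda>t. 0" "\<lambda>t. 0" "\<lambda>t. 0"] poly[OF that] zero f0
        by (simp add: specht_sum_carrier total_form_def)
      moreover have "form21 \<phi> (polytabloid S T) = 0" if "T \<in> tableaux S [n - 2, 2, 1]" for T
        using t[of "\<lambda>t. 0" "polytabloid S T" "\<lambda>t. 0" "\<lambda>t. 0"] poly[OF that] zero f0
        by (simp add: specht_sum_carrier total_form_def)
      moreover have "form22 \<phi> (polytabloid S T) = 0" if "T \<in> tableaux S [n - 3, 2, 2]" for T
        using t[of "\<lambda>t. 0" "\<lambda>t. 0" "polytabloid S T" "\<lambda>t. 0"] poly[OF that] zero f0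
        by (simp add: specht_sum_carrier total_form_def)
      moreover have "form2 \<phi> (polytabloid S T) = 0" if "T \<in> tableaux S [n - 1, 2]" for T
        using t[of "\<lambda>t. 0" "\<lambda>t. 0" "\<lambda>t. 0" "polytabloid S T"] poly[OF that] zero f0
        by (simp add: specht_sum_carrier total_form_def)
      ultimately have "\<phi> a b c d = 0" if "{a, b, c, d} \<subseteq> S" for a b c d
        by (rule forms_separate[OF K _ _ _ _ that])
      then have "pr x \<phi> = 0" by (rule pr_local[OF x K])
      with nz show False by simp
    qed
  qed
  with sub show "?M = carrier V" by blast
qed

lemma rep_isomorphic_specht_sum: "rep_isomorphic S V specht_sum"
proof -
  define h where "h = inv_into (carrier specht_sum) realise"
  have h: "bij_betw h (carrier V) (carrier specht_sum)"
    unfolding h_def by (rule bij_betw_inv_into[OF bij_realise])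
  have hr: "h (realise v) = v" if "v \<in> carrier specht_sum" for v
    unfolding h_def using bij_betw_inv_into_left[OF bij_realise that] .
  have surj: "\<exists>v\<in>carrier specht_sum. x = realise v" if "x \<in> carrier V" for x
    using that bij_realise unfolding bij_betw_def by blast
  show ?thesis unfolding rep_isomorphic_def
  proof (intro exI conjI allI impI ballI)
    show "bij_betw h (carrier V) (carrier specht_sum)" by (rule h)
    fix x assume "x \<in> carrier V"
    then obtain v where v: "v \<in> carrier specht_sum" "x = realise v" using surj by blast
    show "h (a \<odot>\<^bsub>V\<^esub> x) = a \<odot>\<^bsub>specht_sum\<^esub> h x" for a
      unfolding v(2) realise_ops[symmetric] by (simp add: hr v specht_sum_closed)
    show "h (act V \<sigma> x) = act specht_sum \<sigma> (h x)" if "\<sigma> permutes S" for \<sigma>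
      unfolding v(2) realise_ops(3)[OF that, symmetric] by (simp add: hr v specht_sum_closed that)
    fix y assume "y \<in> carrier V"
    then obtain w where w: "w \<in> carrier specht_sum" "y = realise w" using surj by blast
    show "h (x \<oplus>\<^bsub>V\<^esub> y) = h x \<oplus>\<^bsub>specht_sum\<^esub> h y"
      unfolding v(2) w(2) realise_ops[symmetric] by (simp add: hr v w specht_sum_closed)
  qed
qed

end

section \<open>Forms on the free algebra\<close>

lemma free_algebra_simps:
  "carrier (free_algebra I e) = {f. finite {w. f w \<noteq> 0} \<and> (\<forall>w. f w \<noteq> 0 \<longrightarrow> set w \<subseteq> I)}"
  "f \<otimes>\<^bsub>free_algebra I e\<^esub> g = (\<lambda>w. \<Sum>k\<le>length w. f (take k w) * g (drop k w))"
  "\<one>\<^bsub>free_algebra I e\<^esub> = (\<lambda>w. if w = [] then 1 else 0)"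
  "\<zero>\<^bsub>free_algebra I e\<^esub> = (\<lambda>w. 0)"
  "f \<oplus>\<^bsub>free_algebra I e\<^esub> g = (\<lambda>w. f w + g w)"
  "a \<odot>\<^bsub>free_algebra I e\<^esub> f = (\<lambda>w. a * f w)"
  "hpart (free_algebra I e) p = {f. finite {w. f w \<noteq> 0} \<and> (\<forall>w. f w \<noteq> 0 \<longrightarrow> set w \<subseteq> I \<and> e * length w = p)}"
  unfolding free_algebra_def by simp_all

lemma free_algebra_add_closed:
  assumes "f \<in> carrier (free_algebra I e)" "g \<in> carrier (free_algebra I e)"
  shows "(\<lambda>w. f w + g w) \<in> carrier (free_algebra I e)"
proof -
  have "{w. f w + g w \<noteq> 0} \<subseteq> {w. f w \<noteq> 0} \<union> {w. g w \<noteq> 0}" by auto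
  then have "finite {w. f w + g w \<noteq> 0}"
    using assms unfolding free_algebra_simps by (auto intro: finite_subset)
  moreover have "set w \<subseteq> I" if "f w + g w \<noteq> 0" for w
  proof -
    have "f w \<noteq> 0 \<or> g w \<noteq> 0" using that by auto
    then show ?thesis using assms unfolding free_algebra_simps by auto
  qed
  ultimately show ?thesis unfolding free_algebra_simps by blast
qed

lemma free_algebra_smult_closed:
  "f \<in> carrier (free_algebra I e) \<Longrightarrow> (\<lambda>w. a * f w) \<in> carrier (free_algebra I e)"
  unfolding free_algebra_simps by (auto intro: rev_finite_subset)

lemma free_algebra_mult_nonzero:
  assumes "(\<Sum>k\<le>length w. f (take k w) * g (drop k w)) \<noteq> (0 :: complex)"
  obtains u v where "w = u @ v" "f u \<noteq> 0" "g v \<noteq> 0"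
proof -
  obtain k where "f (take k w) * g (drop k w) \<noteq> 0" using assms by (meson sum.neutral)
  then show ?thesis using that[of "take k w" "drop k w"] by simp
qed

lemma free_algebra_mult_closed:
  assumes "f \<in> carrier (free_algebra I e)" "g \<in> carrier (free_algebra I e)"
  shows "f \<otimes>\<^bsub>free_algebra I e\<^esub> g \<in> carrier (free_algebra I e)"
proof -
  have "{w. (\<Sum>k\<le>length w. f (take k w) * g (drop k w)) \<noteq> 0} \<subseteq> (\<lambda>(u,v). u @ v) ` ({u. f u \<noteq> 0} \<times> {v. g v \<noteq> 0})"
    by (auto elim!: free_algebra_mult_nonzero)
  moreover have "finite ((\<lambda>(u,v). u @ v) ` ({u. f u \<noteq> 0} \<times> {v. g v \<noteq> 0}))"
    using assms unfolding free_algebra_simps by auto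
  ultimately have "finite {w. (\<Sum>k\<le>length w. f (take k w) * g (drop k w)) \<noteq> 0}" by (rule finite_subset)
  moreover have "set w \<subseteq> I" if w: "(\<Sum>k\<le>length w. f (take k w) * g (drop k w)) \<noteq> 0" for w
  proof -
    obtain u v where "w = u @ v" "f u \<noteq> 0" "g v \<noteq> 0" using w by (rule free_algebra_mult_nonzero)
    then show ?thesis using assms unfolding free_algebra_simps by auto
  qed
  ultimately show ?thesis unfolding free_algebra_simps by blast
qed

text \<open>Both sides sum over all ways to cut \<open>w\<close> into three consecutive
  words.\<close>

lemma free_algebra_mult_assoc:
  "(f \<otimes>\<^bsub>free_algebra I e\<^esub> g) \<otimes>\<^bsub>free_algebra I e\<^esub> h = f \<otimes>\<^bsub>free_algebra I e\<^esub> (g \<otimes>\<^bsub>free_algebra I e\<^esub> h)"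
proof (rule ext)
  fix w :: "'a list"
  let ?n = "length w"
  have "((f \<otimes>\<^bsub>free_algebra I e\<^esub> g) \<otimes>\<^bsub>free_algebra I e\<^esub> h) w
    = (\<Sum>k\<le>?n. \<Sum>j\<le>k. f (take j w) * g (take (k - j) (drop j w)) * h (drop k w))"
    unfolding free_algebra_simps sum_distrib_right
    by (intro sum.cong refl) (auto simp: min_def drop_take)
  also have "\<dots> = (\<Sum>(k,j)\<in>(SIGMA k:{..?n}. {..k}). f (take j w) * g (take (k - j) (drop j w)) * h (drop k w))"
    by (simp add: sum.Sigma)
  also have "\<dots> = (\<Sum>(j,i)\<in>(SIGMA j:{..?n}. {..?n - j}). f (take j w) * g (take i (drop j w)) * h (drop (j + i) w))"
    by (rule sum.reindex_bij_witness[of _ "\<lambda>(j,i). (j + i, j)" "\<lambda>(k,j). (j, k - j)"]) auto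
  also have "\<dots> = (\<Sum>j\<le>?n. \<Sum>i\<le>?n - j. f (take j w) * g (take i (drop j w)) * h (drop (j + i) w))"
    by (simp add: sum.Sigma)
  also have "\<dots> = (f \<otimes>\<^bsub>free_algebra I e\<^esub> (g \<otimes>\<^bsub>free_algebra I e\<^esub> h)) w"
    unfolding free_algebra_simps sum_distrib_left
    by (intro sum.cong refl) (simp_all add: add.commute mult.assoc)
  finally show "((f \<otimes>\<^bsub>free_algebra I e\<^esub> g) \<otimes>\<^bsub>free_algebra I e\<^esub> h) w
    = (f \<otimes>\<^bsub>free_algebra I e\<^esub> (g \<otimes>\<^bsub>free_algebra I e\<^esub> h)) w" .
qed

lemma free_algebra_one_mult: "\<one>\<^bsub>free_algebra I e\<^esub> \<otimes>\<^bsub>free_algebra I e\<^esub> f = f"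
  "f \<otimes>\<^bsub>free_algebra I e\<^esub> \<one>\<^bsub>free_algebra I e\<^esub> = f"
proof -
  have "(\<Sum>k\<le>length w. (if take k w = [] then 1 else 0) * f (drop k w)) = (\<Sum>k\<le>length w. if k = 0 then f w else 0)" for w
    by (intro sum.cong refl) auto
  moreover have "(\<Sum>k\<le>length w. f (take k w) * (if drop k w = [] then 1 else 0)) 
     = (\<Sum>k\<le>length w. if k = length w then f w else 0)" for w
    by (intro sum.cong refl) auto
  ultimately show "\<one>\<^bsub>free_algebra I e\<^esub> \<otimes>\<^bsub>free_algebra I e\<^esub> f = f" "f \<otimes>\<^bsub>free_algebra I e\<^esub> \<one>\<^bsub>free_algebra I e\<^esub> = f"
    unfolding free_algebra_simps by simp_all
qed

lemma free_algebra_ring: "ring (free_algebra I e)"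
proof (rule ringI)
  let ?F = "free_algebra I e"
  show "abelian_group ?F"
  proof (rule abelian_groupI)
    fix x assume "x \<in> carrier ?F"
    then show "\<exists>y\<in>carrier ?F. y \<oplus>\<^bsub>?F\<^esub> x = \<zero>\<^bsub>?F\<^esub>"
      using free_algebra_smult_closed[of x I e "-1"] unfolding free_algebra_simps(4,5)
      by (intro bexI[of _ "\<lambda>w. -1 * x w"]) auto
  qed (simp_all add: free_algebra_simps(4,5) free_algebra_add_closed algebra_simps, simp add: free_algebra_simps)
  show "Group.monoid ?F"
    by (rule monoidI) (simp_all add: free_algebra_mult_closed free_algebra_mult_assoc free_algebra_one_mult,
        simp add: free_algebra_simps)
qed (simp_all add: free_algebra_simps(2,5) distrib_left distrib_right sum.distrib)

lemma free_algebra_a_inv: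
  assumes "f \<in> carrier (free_algebra I e)"
  shows "\<ominus>\<^bsub>free_algebra I e\<^esub> f = (\<lambda>w. - f w)"
proof -
  interpret ring "free_algebra I e" by (rule free_algebra_ring)
  have "(\<lambda>w. - f w) \<in> carrier (free_algebra I e)" using free_algebra_smult_closed[OF assms, of "-1"] by simp
  then show ?thesis by (intro minus_equality assms) (simp_all add: free_algebra_simps(4,5))
qed

lemma free_algebra_minus:
  "g \<in> carrier (free_algebra I e) \<Longrightarrow> f \<ominus>\<^bsub>free_algebra I e\<^esub> g = (\<lambda>w. f w - g w)"
  by (simp add: a_minus_def free_algebra_a_inv free_algebra_simps(5))

definition word_fun where "word_fun u = (\<lambda>w. if w = u then 1 else 0 :: complex)"

lemma free_gen_word_fun: "free_gen g = word_fun [g]"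
  unfolding free_gen_def word_fun_def ..

lemma word_fun_closed: "set u \<subseteq> I \<Longrightarrow> word_fun u \<in> carrier (free_algebra I e)"
  unfolding free_algebra_simps word_fun_def by auto

lemma word_fun_mult: "word_fun u \<otimes>\<^bsub>free_algebra I e\<^esub> word_fun v = word_fun (u @ v)"
proof (rule ext)
  fix w :: "'a list"
  have split: "(take k w = u \<and> drop k w = v) \<longleftrightarrow> (k = length u \<and> w = u @ v)" if "k \<le> length w" for k
  proof
    assume k: "take k w = u \<and> drop k w = v"
    then have "w = u @ v" using append_take_drop_id[of k w] by simp
    moreover have "k = length u" using k that by auto
    ultimately show "k = length u \<and> w = u @ v" by simp
  qed auto
  have "(word_fun u \<otimes>\<^bsub>free_algebra I e\<^esub> word_fun v) w = 
      (\<Sum>k\<le>length w. if take k w = u \<and> drop k w = v then 1 else 0)"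
    unfolding free_algebra_simps word_fun_def by (intro sum.cong refl) simp
  also have "\<dots> = (\<Sum>k\<le>length w. if k = length u then word_fun (u @ v) w else 0)"
    unfolding word_fun_def by (intro sum.cong refl) (simp add: split)
  also have "\<dots> = word_fun (u @ v) w" by (auto simp: word_fun_def)
  finally show "(word_fun u \<otimes>\<^bsub>free_algebra I e\<^esub> word_fun v) w = word_fun (u @ v) w" .
qed

text \<open>Linear forms on a finite-dimensional space of functions separate subspaces: Gaussian elimination
  on one coordinate at a time.\<close>

lemma subspace_separation:
  fixes N :: "('b \<Rightarrow> complex) set"
  assumes "finite X"
    and "\<And>f x. f \<in> N \<Longrightarrow> x \<notin> X \<Longrightarrow> f x = 0"
    and "N \<noteq> {}" "\<And>f g. f \<in> N \<Longrightarrow> g \<in> N \<Longrightarrow> (\<lambda>x. f x + g x) \<in> N" "\<And>a f. f \<in> N \<Longrightarrow> (\<lambda>x. a * f x) \<in> N"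
    and "\<And>x. x \<notin> X \<Longrightarrow> f0 x = 0" "f0 \<notin> N"
  shows "\<exists>\<psi>. (\<forall>f\<in>N. (\<Sum>x\<in>X. f x * \<psi> x) = 0) \<and> (\<Sum>x\<in>X. f0 x * \<psi> x) \<noteq> 0"
  using assms
proof (induction X arbitrary: N f0 rule: finite_induct)
  case empty
  obtain f where "f \<in> N" using empty.prems(2) by blast
  then have "f0 = f" using empty.prems(1,5) by (intro ext) simp
  then show ?case using \<open>f \<in> N\<close> empty.prems(6) by simp
next
  case (insert i X)
  show ?case
  proof (cases "\<forall>f\<in>N. f i = 0")
    case True
    show ?thesis
    proof (cases "f0 i = 0")
      case f0i: True
      have "\<exists>\<psi>. (\<forall>f\<in>N. (\<Sum>x\<in>X. f x * \<psi> x) = 0) \<and> (\<Sum>x\<in>X. f0 x * \<psi> x) \<noteq> 0"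
      proof (rule insert.IH)
        show "f x = 0" if "f \<in> N" "x \<notin> X" for f x
          using insert.prems(1)[OF that(1), of x] True that by (cases "x = i") auto
        show "f0 x = 0" if "x \<notin> X" for x using insert.prems(5)[of x] f0i that by (cases "x = i") auto
      qed (use insert.prems in auto)
      then obtain \<psi> where "\<forall>f\<in>N. (\<Sum>x\<in>X. f x * \<psi> x) = 0" "(\<Sum>x\<in>X. f0 x * \<psi> x) \<noteq> 0" by blast
      then show ?thesis using True f0i insert.hyps by (intro exI[of _ \<psi>]) simp
    next
      case False
      \<comment> \<open>All of \<open>N\<close> vanishes at \<open>i\<close> but \<open>f0\<close>
        does not, so the coordinate functional at \<open>i\<close> separates.\<close>
      have "(\<Sum>x\<in>insert i X. f x * (if x = i then 1 else 0)) = f i" for f :: "'b \<Rightarrow> complex"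
        using insert.hyps by (auto intro!: sum.neutral)
      then show ?thesis using True False by (intro exI[of _ "\<lambda>x. if x = i then 1 else 0"]) auto
    qed
  next
    case False
    then obtain g' where g': "g' \<in> N" "g' i \<noteq> 0" by blast
    define g where "g x = inverse (g' i) * g' x" for x
    have g: "g \<in> N" "g i = 1" using insert.prems(4)[OF g'(1), of "inverse (g' i)"] g'(2) unfolding g_def by auto
    \<comment> \<open>Subtracts the multiple of the pivot \<open>g\<close> that clears coordinate
      \<open>i\<close>; since \<open>g\<close> is in \<open>N\<close>, this does not affect
      membership in \<open>N\<close>.\<close>
    define red where "red f x = f x + (- f i) * g x" for f x
    have red_i: "red f i = 0" for f unfolding red_def using g(2) by simp
    have redN: "red f \<in> N" if "f \<in> N" for f
      using insert.prems(3)[OF that insert.prems(4)[OF g(1), of "- f i"]] unfolding red_def .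
    have unred: "f \<in> N" if "red f \<in> N" for f
      using insert.prems(3)[OF that insert.prems(4)[OF g(1), of "f i"]] unfolding red_def by simp
    let ?N = "{f\<in>N. f i = 0}"
    have "\<exists>\<psi>. (\<forall>f\<in>?N. (\<Sum>x\<in>X. f x * \<psi> x) = 0) \<and> (\<Sum>x\<in>X. red f0 x * \<psi> x) \<noteq> 0"
    proof (rule insert.IH)
      show "f x = 0" if "f \<in> ?N" "x \<notin> X" for f x
        using insert.prems(1)[of f x] that by (cases "x = i") auto
      show "?N \<noteq> {}" using redN[OF g(1)] red_i by auto
      show "red f0 x = 0" if "x \<notin> X" for x
        using insert.prems(5)[of x] insert.prems(1)[OF g(1), of x] red_i that by (cases "x = i") (auto simp: red_def)
      show "red f0 \<notin> ?N" using unred insert.prems(6) by auto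
    qed (use insert.prems in auto)
    then obtain \<psi> where \<psi>: "\<And>f. f \<in> ?N \<Longrightarrow> (\<Sum>x\<in>X. f x * \<psi> x) = 0" "(\<Sum>x\<in>X. red f0 x * \<psi> x) \<noteq> 0" by blast
    \<comment> \<open>The value at \<open>i\<close> is chosen so that the extended functional kills
      the pivot \<open>g\<close>.\<close>
    define \<psi>' where "\<psi>' x = (if x = i then - (\<Sum>x\<in>X. g x * \<psi> x) else \<psi> x)" for x
    have "(\<Sum>x\<in>insert i X. f x * \<psi>' x) = (\<Sum>x\<in>X. red f x * \<psi> x)" for f
    proof -
      have "(\<Sum>x\<in>X. f x * \<psi>' x) = (\<Sum>x\<in>X. f x * \<psi> x)"
        using insert.hyps by (intro sum.cong refl) (auto simp: \<psi>'_def)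
      then have "(\<Sum>x\<in>insert i X. f x * \<psi>' x) = (\<Sum>x\<in>X. f x * \<psi> x) - f i * (\<Sum>x\<in>X. g x * \<psi> x)"
        using insert.hyps by (simp add: \<psi>'_def)
      then show ?thesis
        unfolding red_def by (simp add: distrib_right sum.distrib sum_subtractf sum_distrib_left algebra_simps)
    qed
    then show ?thesis using \<psi> redN red_i by (intro exI[of _ \<psi>']) auto
  qed
qed

declare One_nat_def [simp del]

section \<open>Forms as functionals on words of length two\<close>

definition config_pairing ::
    "nat \<Rightarrow> quad_form \<Rightarrow> ((nat \<times> nat) list \<Rightarrow> complex) \<Rightarrow> complex"
  where "config_pairing n \<phi> f = (\<Sum>u\<in>{1..n} \<times> {1..n}. \<Sum>v\<in>{1..n} \<times> {1..n}.
    f [u, v] * \<phi> (fst u) (snd u) (fst v) (snd v))"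

lemma config_pairing_add: "config_pairing n \<phi> (\<lambda>w. f w + g w) = config_pairing n \<phi> f + config_pairing n \<phi> g"
  unfolding config_pairing_def by (simp add: distrib_right sum.distrib)

lemma config_pairing_diff: "config_pairing n \<phi> (\<lambda>w. f w - g w) = config_pairing n \<phi> f - config_pairing n \<phi> g"
  unfolding config_pairing_def by (simp add: left_diff_distrib sum_subtractf)

lemma config_pairing_smult: "config_pairing n \<phi> (\<lambda>w. c * f w) = c * config_pairing n \<phi> f"
  unfolding config_pairing_def by (simp add: sum_distrib_left mult.assoc)

lemma config_pairing_word_1: "config_pairing n \<phi> (word_fun [u]) = 0"
  unfolding config_pairing_def word_fun_def by (simp add: sum.neutral)

lemma config_pairing_word:
  assumes "u \<in> {1..n} \<times> {1..n}" "v \<in> {1..n} \<times> {1..n}"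
  shows "config_pairing n \<phi> (word_fun [u, v]) = \<phi> (fst u) (snd u) (fst v) (snd v)"
proof -
  have "(\<Sum>y\<in>{1..n} \<times> {1..n}. word_fun [u, v] [x, y] * \<phi> (fst x) (snd x) (fst y) (snd y))
     = (if x = u then \<phi> (fst u) (snd u) (fst v) (snd v) else 0)" for x
  proof -
    have "(\<Sum>y\<in>{1..n} \<times> {1..n}. word_fun [u, v] [x, y] * \<phi> (fst x) (snd x) (fst y) (snd y))
      = (\<Sum>y\<in>{1..n} \<times> {1..n}. if y = v then (if x = u then \<phi> (fst u) (snd u) (fst v) (snd v) else 0) else 0)"
      unfolding word_fun_def by (intro sum.cong refl) simp
    then show ?thesis using assms(2) by simp
  qed
  then show ?thesis unfolding config_pairing_def using assms(1) by simp
qed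

text \<open>Some relators are linear, so a condition in length one is needed for an ideal. Symmetry
  of the linear part is the right one: \<open>\<phi>\<close> is antisymmetric in each edge, hence
  kills its product with any generator.\<close>

definition annihilator where
  "annihilator n e \<phi> = {f \<in> carrier (free_algebra ({1..n} \<times> {1..n}) e). f [] = 0 \<and>
    (\<forall>i\<in>{1..n}. \<forall>j\<in>{1..n}. f [(i, j)] = f [(j, i)]) \<and> config_pairing n \<phi> f = 0}"

lemma free_algebra_mult_short:
  "(f \<otimes>\<^bsub>free_algebra I e\<^esub> g) [] = f [] * g []"
  "(f \<otimes>\<^bsub>free_algebra I e\<^esub> g) [u] = f [] * g [u] + f [u] * g []"
  "(f \<otimes>\<^bsub>free_algebra I e\<^esub> g) [u, v] = f [] * g [u, v] + f [u] * g [v] + f [u, v] * g []"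
  unfolding free_algebra_simps by (simp_all add: atMost_Suc)

lemma config_form_sum_symmetric:
  assumes e: "edge_form \<phi>" and f: "\<And>i j. i \<in> {1..n} \<Longrightarrow> j \<in> {1..n} \<Longrightarrow> f (i, j) = f (j, i)"
  shows "(\<Sum>v\<in>{1..n} \<times> {1..n}. f v * \<phi> a b (fst v) (snd v)) = 0"
    "(\<Sum>v\<in>{1..n} \<times> {1..n}. f v * \<phi> (fst v) (snd v) a b) = 0"
proof -
  have "(\<Sum>v\<in>{1..n} \<times> {1..n}. f v * \<phi> a b (fst v) (snd v)) = 
      (\<Sum>v\<in>{1..n} \<times> {1..n}. - (f v * \<phi> a b (fst v) (snd v)))"
  proof (rule sum.reindex_bij_witness[of _ prod.swap prod.swap])
    fix v assume "v \<in> {1..n} \<times> {1..n}"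
    then have "f (prod.swap v) = f v" using f[of "fst v" "snd v"] by (auto simp: prod.swap_def)
    then show "- (f (prod.swap v) * \<phi> a b (fst (prod.swap v)) (snd (prod.swap v))) = f v * \<phi> a b (fst v) (snd v)"
      using edge_form_antisym2[OF e, of a b "fst v" "snd v"] by simp
  qed auto
  then show 1: "(\<Sum>v\<in>{1..n} \<times> {1..n}. f v * \<phi> a b (fst v) (snd v)) = 0" by (simp add: sum_negf)
  then show "(\<Sum>v\<in>{1..n} \<times> {1..n}. f v * \<phi> (fst v) (snd v) a b) = 0"
    using edge_form_sym[OF e, of a b] by simp
qed

text \<open>The quadratic part of a product of \<open>f\<close> with an arbitrary \<open>g\<close>
  has two pieces: \<open>g []\<close> times the quadratic part of \<open>f\<close>, and the product
  of the linear parts. The first pairs to zero by definition, the second because one factor is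
  symmetric; a third piece would carry the constant term of \<open>f\<close>, which is zero.\<close>

lemma annihilator_ideal:
  assumes e: "edge_form \<phi>"
  shows "ideal (annihilator n k \<phi>) (free_algebra ({1..n} \<times> {1..n}) k)"
proof -
  let ?F = "free_algebra ({1..n} \<times> {1..n}) k"
  interpret ring ?F by (rule free_algebra_ring)
  have c: "f \<in> carrier ?F" "f [] = 0" "i \<in> {1..n} \<Longrightarrow> j \<in> {1..n} \<Longrightarrow> f [(i, j)] = f [(j, i)]"
    "config_pairing n \<phi> f = 0" if "f \<in> annihilator n k \<phi>" for f i j
    using that unfolding annihilator_def by auto
  show ?thesis
  proof (rule idealI[OF free_algebra_ring])
    show "subgroup (annihilator n k \<phi>) (add_monoid ?F)"
    proof (rule add.subgroupI)
      show "annihilator n k \<phi> \<subseteq> carrier ?F" using c(1) by blast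
      have "\<zero>\<^bsub>?F\<^esub> \<in> annihilator n k \<phi>" using zero_closed unfolding annihilator_def
        by (simp add: free_algebra_simps(4) config_pairing_def)
      then show "annihilator n k \<phi> \<noteq> {}" by blast
    next
      fix f assume f: "f \<in> annihilator n k \<phi>"
      then show "\<ominus>\<^bsub>?F\<^esub> f \<in> annihilator n k \<phi>"
        using a_inv_closed[OF c(1)[OF f]] c[OF f] config_pairing_smult[of n \<phi> "-1" f] unfolding annihilator_def
        by (simp add: free_algebra_a_inv)
    next
      fix f g assume fg: "f \<in> annihilator n k \<phi>" "g \<in> annihilator n k \<phi>"
      then show "f \<oplus>\<^bsub>?F\<^esub> g \<in> annihilator n k \<phi>"
        using a_closed[OF c(1)[OF fg(1)] c(1)[OF fg(2)]] c[OF fg(1)] c[OF fg(2)]  unfolding annihilator_def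
        by (simp add: free_algebra_simps(5) config_pairing_add)
    qed
  next
    fix f g assume f: "f \<in> annihilator n k \<phi>" and g: "g \<in> carrier ?F"
    note cf = c[OF f]
    have "config_pairing n \<phi> (g \<otimes>\<^bsub>?F\<^esub> f) = g [] * config_pairing n \<phi> f + (\<Sum>u\<in>{1..n} \<times> {1..n}. 
        g [u] * (\<Sum>v\<in>{1..n} \<times> {1..n}. f [v] * \<phi> (fst u) (snd u) (fst v) (snd v)))"
      unfolding config_pairing_def free_algebra_mult_short
      by (simp add: cf(2) distrib_right sum.distrib sum_distrib_left mult.assoc)
    also have "\<dots> = 0" using config_form_sum_symmetric(1)[OF e, of n "\<lambda>v. f [v]"] cf by simp
    finally show "g \<otimes>\<^bsub>?F\<^esub> f \<in> annihilator n k \<phi>"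
      using m_closed[OF g cf(1)] cf unfolding annihilator_def by (simp add: free_algebra_mult_short)
    have "config_pairing n \<phi> (f \<otimes>\<^bsub>?F\<^esub> g) = g [] * config_pairing n \<phi> f + (\<Sum>v\<in>{1..n} \<times> {1..n}. 
        g [v] * (\<Sum>u\<in>{1..n} \<times> {1..n}. f [u] * \<phi> (fst u) (snd u) (fst v) (snd v)))"
    proof -
      have "config_pairing n \<phi> (f \<otimes>\<^bsub>?F\<^esub> g) = 
         (\<Sum>u\<in>{1..n} \<times> {1..n}. \<Sum>v\<in>{1..n} \<times> {1..n}. f [u] * g [v] * \<phi> (fst u) (snd u) (fst v) (snd v))
        + (\<Sum>u\<in>{1..n} \<times> {1..n}. \<Sum>v\<in>{1..n} \<times> {1..n}. f [u, v] * g [] * \<phi> (fst u) (snd u) (fst v) (snd v))"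
        unfolding config_pairing_def free_algebra_mult_short
        by (simp add: cf(2) distrib_right sum.distrib)
      moreover have "(\<Sum>u\<in>{1..n} \<times> {1..n}. \<Sum>v\<in>{1..n} \<times> {1..n}. f [u] * g [v] * \<phi> (fst u) (snd u) (fst v) (snd v))
        = (\<Sum>v\<in>{1..n} \<times> {1..n}. g [v] * (\<Sum>u\<in>{1..n} \<times> {1..n}. f [u] * \<phi> (fst u) (snd u) (fst v) (snd v)))"
        by (subst sum.swap) (simp add: sum_distrib_left mult_ac)
      moreover have "(\<Sum>u\<in>{1..n} \<times> {1..n}. \<Sum>v\<in>{1..n} \<times> {1..n}. f [u, v] * g [] * \<phi> (fst u) (snd u) (fst v) (snd v))
        = g [] * config_pairing n \<phi> f"
        unfolding config_pairing_def by (simp add: sum_distrib_left mult_ac)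
      ultimately show ?thesis by simp
    qed
    also have "\<dots> = 0" using config_form_sum_symmetric(2)[OF e, of n "\<lambda>v. f [v]"] cf by simp
    finally show "f \<otimes>\<^bsub>?F\<^esub> g \<in> annihilator n k \<phi>"
      using m_closed[OF cf(1) g] cf unfolding annihilator_def by (simp add: free_algebra_mult_short)
  qed
qed

text \<open>For odd \<open>d\<close> the sign in the first relation is \<open>-1\<close> and the
  sign in the commutation relation is \<open>1\<close>.\<close>

lemma config_relators_odd:
  assumes "odd d"
  shows "config_relators n d =
      {word_fun [(i, i)] | i. i \<in> {1..n}} \<union>
      {\<lambda>w. word_fun [(i, j)] w + word_fun [(j, i)] w | i j. i \<in> {1..n} \<and> j \<in> {1..n}} \<union>
      {\<lambda>w. word_fun [(i, j), (h, k)] w - word_fun [(h, k), (i, j)] w | i j h k.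
         i \<in> {1..n} \<and> j \<in> {1..n} \<and> h \<in> {1..n} \<and> k \<in> {1..n}} \<union>
      {\<lambda>w. word_fun [(i, j), (i, k)] w - (word_fun [(k, j), (i, k)] w - word_fun [(k, j), (i, j)] w) | i j k.
         i \<in> {1..n} \<and> j \<in> {1..n} \<and> k \<in> {1..n} \<and> j \<le> k}"
proof -
  let ?G = "{1..n} \<times> {1..n}"
  let ?F = "free_algebra ?G (d - 1)"
  interpret ring ?F by (rule free_algebra_ring)
  have g: "free_gen (i, j) \<in> carrier ?F" if "i \<in> {1..n}" "j \<in> {1..n}" for i j
    unfolding free_gen_word_fun using that by (intro word_fun_closed) auto
  have m: "free_gen u \<otimes>\<^bsub>?F\<^esub> free_gen v = word_fun [u, v]" for u v
    unfolding free_gen_word_fun word_fun_mult by simp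
  have sm: "(\<lambda>w. a * f w) \<in> carrier ?F" if "f \<in> carrier ?F" for a f by (rule free_algebra_smult_closed[OF that])
  have 2: "free_gen (i, j) \<ominus>\<^bsub>?F\<^esub> ((-1) ^ d \<odot>\<^bsub>?F\<^esub> free_gen (j, i)) = (\<lambda>w. word_fun [(i, j)] w + word_fun [(j, i)] w)"
    if "i \<in> {1..n}" "j \<in> {1..n}" for i j
    using assms free_algebra_minus[OF sm[OF g[OF that(2,1)], of "-1"]]
    by (simp add: free_algebra_simps(6) free_gen_word_fun)
  have w: "word_fun [u, v] \<in> carrier ?F" if "u \<in> ?G" "v \<in> ?G" for u v
    using that by (intro word_fun_closed) auto
  have 3: "(free_gen (i, j) \<otimes>\<^bsub>?F\<^esub> free_gen (h, k)) \<ominus>\<^bsub>?F\<^esub> 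
     ((-1) ^ (d - 1) \<odot>\<^bsub>?F\<^esub> (free_gen (h, k) \<otimes>\<^bsub>?F\<^esub> free_gen (i, j)))
    = (\<lambda>w. word_fun [(i, j), (h, k)] w - word_fun [(h, k), (i, j)] w)"
    if "i \<in> {1..n}" "j \<in> {1..n}" "h \<in> {1..n}" "k \<in> {1..n}" for i j h k
    using assms that by (simp add: free_algebra_simps(6) m free_algebra_minus[OF w])
  have 4: "(free_gen (i, j) \<otimes>\<^bsub>?F\<^esub> free_gen (i, k)) \<ominus>\<^bsub>?F\<^esub> 
     (free_gen (k, j) \<otimes>\<^bsub>?F\<^esub> (free_gen (i, k) \<ominus>\<^bsub>?F\<^esub> free_gen (i, j)))
    = (\<lambda>w. word_fun [(i, j), (i, k)] w - (word_fun [(k, j), (i, k)] w - word_fun [(k, j), (i, j)] w))"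
    if "i \<in> {1..n}" "j \<in> {1..n}" "k \<in> {1..n}" for i j k
  proof -
    have "free_gen (k, j) \<otimes>\<^bsub>?F\<^esub> (free_gen (i, k) \<ominus>\<^bsub>?F\<^esub> free_gen (i, j))
      = (free_gen (k, j) \<otimes>\<^bsub>?F\<^esub> free_gen (i, k)) \<ominus>\<^bsub>?F\<^esub> (free_gen (k, j) \<otimes>\<^bsub>?F\<^esub> free_gen (i, j))"
      using g that by (simp add: a_minus_def r_distr r_minus)
    also have "\<dots> = (\<lambda>w. word_fun [(k, j), (i, k)] w - word_fun [(k, j), (i, j)] w)"
      using that by (simp add: m free_algebra_minus[OF w])
    finally have e: "free_gen (k, j) \<otimes>\<^bsub>?F\<^esub> (free_gen (i, k) \<ominus>\<^bsub>?F\<^esub> free_gen (i, j))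
      = (\<lambda>w. word_fun [(k, j), (i, k)] w - word_fun [(k, j), (i, j)] w)" .
    have "free_gen (k, j) \<otimes>\<^bsub>?F\<^esub> (free_gen (i, k) \<ominus>\<^bsub>?F\<^esub> free_gen (i, j)) \<in> carrier ?F"
      using g that by simp
    from free_algebra_minus[OF this] show ?thesis by (simp add: m e)
  qed
  show ?thesis
    unfolding config_relators_def Let_def
    by (intro arg_cong2[of _ _ _ _ "(\<union>)"] Collect_cong ex_cong1 rev_conj_cong refl
        arg_cong2[of _ _ _ _ "(=)"] 2 3 4 free_gen_word_fun) auto
qed

lemma config_relators_carrier:
  assumes "odd d"
  shows "config_relators n d \<subseteq> carrier (free_algebra ({1..n} \<times> {1..n}) e)"
proof -
  let ?F = "free_algebra ({1..n} \<times> {1..n}) e"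
  have w: "word_fun u \<in> carrier ?F" if "set u \<subseteq> {1..n} \<times> {1..n}" for u
    using that by (rule word_fun_closed)
  have a: "(\<lambda>w. f w + g w) \<in> carrier ?F" if "f \<in> carrier ?F" "g \<in> carrier ?F" for f g
    using that by (rule free_algebra_add_closed)
  have d: "(\<lambda>w. f w - g w) \<in> carrier ?F" if "f \<in> carrier ?F" "g \<in> carrier ?F" for f g
    using a[OF that(1) free_algebra_smult_closed[OF that(2), of "-1"]] by simp
  show ?thesis unfolding config_relators_odd[OF assms] by (auto intro!: w a d)
qed

lemma config_relators_annihilator:
  assumes d: "odd d" and K: "\<phi> \<in> config_forms"
  shows "config_relators n d \<subseteq> annihilator n e \<phi>"
proof
  note ef = config_formsD(1)[OF K]
  fix r assume r: "r \<in> config_relators n d"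
  then have c: "r \<in> carrier (free_algebra ({1..n} \<times> {1..n}) e)" using config_relators_carrier[OF d] by blast
  have nil: "word_fun (u # us) [] = 0" for u :: "nat \<times> nat" and us unfolding word_fun_def by simp
  have sing: "word_fun [u] [v] = (if v = u then 1 else 0)" "word_fun (u # u' # us) [v] = 0" 
    for u u' v :: "nat \<times> nat" and us unfolding word_fun_def by simp_all
  have "r [] = 0 \<and> (\<forall>i\<in>{1..n}. \<forall>j\<in>{1..n}. r [(i, j)] = r [(j, i)]) \<and> config_pairing n \<phi> r = 0"
    using r unfolding config_relators_odd[OF d]
  proof (elim UnE CollectE exE conjE)
    fix i assume "r = word_fun [(i, i)]"
    then show ?thesis by (auto simp: nil sing config_pairing_word_1)
  next
    fix i j assume "r = (\<lambda>w. word_fun [(i, j)] w + word_fun [(j, i)] w)"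
    then show ?thesis
      by (simp add: nil sing config_pairing_add config_pairing_word_1 conj_commute add.commute)
  next
    fix i j h k assume "r = (\<lambda>w. word_fun [(i, j), (h, k)] w - word_fun [(h, k), (i, j)] w)"
      and m: "i \<in> {1..n}" "j \<in> {1..n}" "h \<in> {1..n}" "k \<in> {1..n}"
    then show ?thesis using edge_form_sym[OF ef, of i j h k]
      by (simp add: nil sing config_pairing_diff config_pairing_word)
  next
    fix i j k assume r: "r = (\<lambda>w. word_fun [(i, j), (i, k)] w - (word_fun [(k, j), (i, k)] w - word_fun [(k, j), (i, j)] w))"
      and m: "i \<in> {1..n}" "j \<in> {1..n}" "k \<in> {1..n}"
    \<comment> \<open>The edge \<open>a b\<close> is the triangle on \<open>0, a, b\<close>.\<close>
    have sq: "\<phi> a b a b = 0" for a b using config_formsD(3)[OF K, of 0 a b] triangle_form_0[OF K] by simp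
    \<comment> \<open>The square of a triangle class is twice the sum of the mixed products of its
      edges; up to sign this sum is the Arnold relator.\<close>
    have "2 * (\<phi> i j j k + \<phi> j k k i + \<phi> k i i j) = triangle_form \<phi> i j k i j k"
      unfolding triangle_form_def sq
      using edge_form_sym[OF ef, of j k i j] edge_form_sym[OF ef, of k i j k] edge_form_sym[OF ef, of k i i j] by simp
    then have "2 * (\<phi> i j j k + \<phi> j k k i + \<phi> k i i j) = 0" unfolding config_formsD(3)[OF K] .
    then have "\<phi> i j j k + \<phi> j k k i + \<phi> k i i j = 0" by (simp only: mult_eq_0_iff) simp
    moreover have f1: "\<phi> i j i k = - \<phi> k i i j"
      using edge_form_antisym2[OF ef, of i j i k] edge_form_sym[OF ef, of i j k i] by simp
    moreover have f2: "\<phi> k j i k = \<phi> j k k i"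
      using edge_form_antisym1[OF ef, of k j i k] edge_form_antisym2[OF ef, of j k i k] by simp
    moreover have f3: "\<phi> k j i j = - \<phi> i j j k"
      using edge_form_antisym1[OF ef, of k j i j] edge_form_sym[OF ef, of j k i j] by simp
    moreover have "\<phi> i j i k - (\<phi> k j i k - \<phi> k j i j) = - (\<phi> i j j k + \<phi> j k k i + \<phi> k i i j)"
      unfolding f1 f2 f3 by (simp add: algebra_simps)
    ultimately have "\<phi> i j i k - (\<phi> k j i k - \<phi> k j i j) = 0" by simp
    then show ?thesis unfolding r using m
      by (simp add: nil sing config_pairing_diff config_pairing_word)
  qed
  then show "r \<in> annihilator n e \<phi>" using c unfolding annihilator_def by blast
qed

section \<open>The cohomology algebra and its extended action\<close>

lemma coboundary_add:
  "coboundary X (\<lambda>p f. c p f + d p f) = (\<lambda>p f. coboundary X c p f + coboundary X d p f)"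
  unfolding coboundary_def by (intro ext) (simp add: distrib_left sum.distrib)

lemma coboundary_zero: "coboundary X (\<lambda>p f. 0) = (\<lambda>p f. 0)"
  unfolding coboundary_def by (intro ext) simp

lemma singular_cochains_zero: "(\<lambda>p f. 0) \<in> singular_cochains X"
  unfolding singular_cochains_def by simp

lemma singular_cochains_add:
  assumes "c \<in> singular_cochains X" "d \<in> singular_cochains X"
  shows "(\<lambda>p f. c p f + d p f) \<in> singular_cochains X"
proof -
  have "{p. (\<lambda>f. c p f + d p f) \<noteq> (\<lambda>f. 0)} \<subseteq> {p. c p \<noteq> (\<lambda>f. 0)} \<union> {p. d p \<noteq> (\<lambda>f. 0)}" by auto
  then have "finite {p. (\<lambda>f. c p f + d p f) \<noteq> (\<lambda>f. 0)}"
    by (rule finite_subset) (use assms in \<open>simp add: singular_cochains_def\<close>)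
  moreover have "singular_simplex p X f" if "c p f + d p f \<noteq> 0" for p f
  proof -
    have "c p f \<noteq> 0 \<or> d p f \<noteq> 0" using that by auto
    then show ?thesis using assms unfolding singular_cochains_def by auto
  qed
  ultimately show ?thesis unfolding singular_cochains_def by blast
qed

lemma coboundaries_zero: "(\<lambda>p f. 0) \<in> coboundaries X"
  unfolding coboundaries_def
  by (rule image_eqI[where x = "\<lambda>p f. 0"]) (simp_all add: coboundary_zero singular_cochains_zero)

lemma coboundaries_add:
  assumes "c \<in> coboundaries X" "d \<in> coboundaries X"
  shows "(\<lambda>p f. c p f + d p f) \<in> coboundaries X"
proof -
  obtain c' d' where "c' \<in> singular_cochains X" "c = coboundary X c'"
    "d' \<in> singular_cochains X" "d = coboundary X d'"
    using assms unfolding coboundaries_def by blast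
  then show ?thesis
    unfolding coboundaries_def
    by (intro image_eqI[of _ _ "\<lambda>p f. c' p f + d' p f"]) (simp_all add: coboundary_add singular_cochains_add)
qed

lemma cocycle_coset:
  "coboundaries X +>\<^bsub>cocycle_algebra X\<^esub> c = (\<lambda>b p f. b p f + c p f) ` coboundaries X"
  unfolding a_r_coset_def' UNION_singleton_eq_range by (simp add: cocycle_algebra_def)

lemma cohomology_carrier:
  "carrier (cohomology X) = (\<lambda>c. coboundaries X +>\<^bsub>cocycle_algebra X\<^esub> c) ` carrier (cocycle_algebra X)"
  unfolding cohomology_def graded_quot_def FactRing_def A_RCOSETS_def' UNION_singleton_eq_range by simp

lemma cohomology_zero: "\<zero>\<^bsub>cohomology X\<^esub> = coboundaries X"
  unfolding cohomology_def graded_quot_def FactRing_def by simp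

lemma cohomology_zero_closed: "\<zero>\<^bsub>cohomology X\<^esub> \<in> carrier (cohomology X)"
proof -
  have "coboundaries X = coboundaries X +>\<^bsub>cocycle_algebra X\<^esub> (\<lambda>p f. 0)"
    unfolding cocycle_coset by simp
  moreover have "(\<lambda>p f. 0) \<in> carrier (cocycle_algebra X)"
    unfolding cocycle_algebra_def by (simp add: singular_cochains_zero coboundary_zero)
  ultimately show ?thesis unfolding cohomology_zero cohomology_carrier by blast
qed

text \<open>The ring laws of the cohomology are transported along the isomorphism with the presented
  algebra. The transported ring has the image of zero as its zero, and this law identifies that
  element with the class of the coboundaries.\<close>

lemma cohomology_zero_add:
  assumes "C \<in> carrier (cohomology X)"
  shows "\<zero>\<^bsub>cohomology X\<^esub> \<oplus>\<^bsub>cohomology X\<^esub> C = C"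
proof -
  have add: "B \<oplus>\<^bsub>cohomology X\<^esub> C = (\<Union>b\<in>B. \<Union>c\<in>C. {\<lambda>p f. b p f + c p f})" for B C
  proof -
    have "B \<oplus>\<^bsub>cohomology X\<^esub> C = B <+>\<^bsub>cocycle_algebra X\<^esub> C"
      unfolding cohomology_def graded_quot_def FactRing_def by simp
    then show ?thesis unfolding set_add_def' by (simp add: cocycle_algebra_def)
  qed
  obtain c where C: "C = (\<lambda>b p f. b p f + c p f) ` coboundaries X"
    using assms unfolding cohomology_carrier cocycle_coset by blast
  show ?thesis
  proof
    show "\<zero>\<^bsub>cohomology X\<^esub> \<oplus>\<^bsub>cohomology X\<^esub> C \<subseteq> C"
    proof
      fix x assume "x \<in> \<zero>\<^bsub>cohomology X\<^esub> \<oplus>\<^bsub>cohomology X\<^esub> C"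
      then obtain b b' where b: "b \<in> coboundaries X" "b' \<in> coboundaries X" "x = (\<lambda>p f. b p f + (b' p f + c p f))"
        unfolding add cohomology_zero C by auto
      then show "x \<in> C" unfolding C
        by (intro image_eqI[OF _ coboundaries_add[OF b(1,2)]]) (simp add: add.assoc)
    qed
    show "C \<subseteq> \<zero>\<^bsub>cohomology X\<^esub> \<oplus>\<^bsub>cohomology X\<^esub> C"
      unfolding add cohomology_zero using coboundaries_zero by force
  qed
qed

lemma (in ideal) rcos_eq_iff:
  assumes "x \<in> carrier R" "y \<in> carrier R"
  shows "I +> x = I +> y \<longleftrightarrow> x \<ominus> y \<in> I"
proof
  assume "I +> x = I +> y"
  then have "x \<in> I +> y" using a_rcos_self assms by blast
  then obtain i where "i \<in> I" "x = i \<oplus> y" unfolding a_r_coset_def' by blast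
  then show "x \<ominus> y \<in> I" using assms(2) by (simp add: a_minus_def a_assoc r_neg)
next
  assume i: "x \<ominus> y \<in> I"
  have "x = (x \<ominus> y) \<oplus> y" using assms by (simp add: a_minus_def a_assoc l_neg)
  then have "x \<in> I +> y" using i unfolding a_r_coset_def' by blast
  then show "I +> x = I +> y" using a_repr_independence' assms(2) by metis
qed

section \<open>The cohomology as a quotient of the free algebra\<close>

locale cohomology_presentation =
  fixes n d :: nat and A \<rho> \<Phi>
  assumes d: "odd d" "d \<ge> 3"
    and alg_iso: "\<Phi> \<in> graded_algebra_iso (presented_algebra n d) (config_cohomology n d)"
    and gen: "\<And>i j. i \<in> {1..n} \<Longrightarrow> j \<in> {1..n} \<Longrightarrow> \<Phi> (presented_gen n d i j) = A i j"
    and nat_action: "\<And>\<sigma> i j. \<sigma> permutes {1..n} \<Longrightarrow> i \<in> {1..n} \<Longrightarrow> j \<in> {1..n} \<Longrightarrow>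
       natural_action n d \<sigma> (A i j) = A (\<sigma> i) (\<sigma> j)"
    and ext_action: "extended_action n d A \<rho>"
begin

abbreviation "G \<equiv> {1..n} \<times> {1..n}"
abbreviation "F \<equiv> free_algebra G (d - 1)"
abbreviation "R \<equiv> config_ideal n d"
abbreviation "H \<equiv> config_cohomology n d"

sublocale F: ring F by (rule free_algebra_ring)

sublocale R: ideal R F
  unfolding config_ideal_def by (rule F.genideal_ideal[OF config_relators_carrier[OF d(1)]])

definition L where "L f = \<Phi> (R +>\<^bsub>F\<^esub> f)"

lemma ring_iso: "\<Phi> \<in> ring_iso (F Quot R) H"
proof -
  have "\<Phi> \<in> ring_iso (graded_quot F R) H"
    using alg_iso unfolding graded_algebra_iso_def presented_algebra_def by blast
  then show ?thesis by (simp add: ring_iso_def ring_hom_def graded_quot_def)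
qed

text \<open>Membership in \<open>ring_iso\<close> does not mention zeros. The sum of the two
  candidates equals the first because \<open>\<Phi>\<close> of zero is neutral in the transported
  ring, and the second because the class of the coboundaries is neutral from the left.\<close>

lemma zero_H: "\<zero>\<^bsub>H\<^esub> = \<Phi> \<zero>\<^bsub>F Quot R\<^esub>"
proof -
  let ?H = "H\<lparr>zero := \<Phi> \<zero>\<^bsub>F Quot R\<^esub>\<rparr>"
  interpret Q: ring "F Quot R" by (rule R.quotient_is_ring)
  interpret H: ring ?H by (rule Q.ring_iso_imp_img_ring[OF ring_iso])
  have "\<zero>\<^bsub>H\<^esub> = \<zero>\<^bsub>H\<^esub> \<oplus>\<^bsub>H\<^esub> \<Phi> \<zero>\<^bsub>F Quot R\<^esub>"
    using H.r_zero[of "\<zero>\<^bsub>H\<^esub>"] cohomology_zero_closed[of "config_space n d"] by simp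
  also have "\<dots> = \<Phi> \<zero>\<^bsub>F Quot R\<^esub>"
    using H.zero_closed by (intro cohomology_zero_add) simp
  finally show ?thesis .
qed

sublocale H: ring H
proof -
  interpret Q: ring "F Quot R" by (rule R.quotient_is_ring)
  have "ring (H\<lparr>zero := \<Phi> \<zero>\<^bsub>F Quot R\<^esub>\<rparr>)" by (rule Q.ring_iso_imp_img_ring[OF ring_iso])
  then show "ring H" unfolding zero_H[symmetric] by simp
qed

lemma L_hom: "L \<in> ring_hom F H"
proof -
  have "\<Phi> \<in> ring_hom (F Quot R) H" using ring_iso by (simp add: ring_iso_def)
  then have "\<Phi> \<circ> (\<lambda>f. R +>\<^bsub>F\<^esub> f) \<in> ring_hom F H" by (rule ring_hom_trans[OF R.rcos_ring_hom])
  moreover have "L = \<Phi> \<circ> (\<lambda>f. R +>\<^bsub>F\<^esub> f)" by (rule ext) (simp add: L_def)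
  ultimately show ?thesis by simp
qed

lemma L_closed: "f \<in> carrier F \<Longrightarrow> L f \<in> carrier H"
  by (rule ring_hom_closed[OF L_hom])

lemma L_mult: "f \<in> carrier F \<Longrightarrow> g \<in> carrier F \<Longrightarrow> L (f \<otimes>\<^bsub>F\<^esub> g) = L f \<otimes>\<^bsub>H\<^esub> L g"
  by (rule ring_hom_mult[OF L_hom])

lemma L_add: "f \<in> carrier F \<Longrightarrow> g \<in> carrier F \<Longrightarrow> L (\<lambda>w. f w + g w) = L f \<oplus>\<^bsub>H\<^esub> L g"
  unfolding free_algebra_simps(5)[symmetric, of f g G "d - 1"] by (rule ring_hom_add[OF L_hom])

lemma inj_\<Phi>: "inj_on \<Phi> (carrier (F Quot R))" and surj_\<Phi>: "\<Phi> ` carrier (F Quot R) = carrier H"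
  using ring_iso unfolding ring_iso_def bij_betw_def by auto

lemma coset_closed: "f \<in> carrier F \<Longrightarrow> R +>\<^bsub>F\<^esub> f \<in> carrier (F Quot R)"
  unfolding FactRing_def A_RCOSETS_def' UNION_singleton_eq_range by simp

lemma L_eq_iff:
  assumes "f \<in> carrier F" "g \<in> carrier F"
  shows "L f = L g \<longleftrightarrow> (\<lambda>w. f w - g w) \<in> R"
proof -
  have "L f = L g \<longleftrightarrow> R +>\<^bsub>F\<^esub> f = R +>\<^bsub>F\<^esub> g"
    unfolding L_def using inj_on_eq_iff[OF inj_\<Phi>] coset_closed assms by blast
  then show ?thesis unfolding R.rcos_eq_iff[OF assms] free_algebra_minus[OF assms(2)] .
qed

lemma L_surj: "carrier H = L ` carrier F"
  unfolding surj_\<Phi>[symmetric] L_def FactRing_def A_RCOSETS_def' UNION_singleton_eq_range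
  by (simp add: image_image)

lemma L_zero: "L (\<lambda>w. 0) = \<zero>\<^bsub>H\<^esub>"
proof -
  have "L (\<lambda>w. 0) \<oplus>\<^bsub>H\<^esub> L (\<lambda>w. 0) = L (\<lambda>w. 0)" "L (\<lambda>w. 0) \<in> carrier H"
    using L_add[OF F.zero_closed F.zero_closed] L_closed[OF F.zero_closed] unfolding free_algebra_simps(4) by simp_all
  then show ?thesis using H.add.r_cancel_one' by (metis)
qed

text \<open>Ideals are ring ideals here; a scalar acts through the product with the corresponding
  multiple of the unit.\<close>

lemma ideal_smult:
  assumes "f \<in> R"
  shows "(\<lambda>w. a * f w) \<in> R"
proof -
  have f: "f \<in> carrier F" using assms R.a_subset by blast
  have "(\<lambda>w. a * \<one>\<^bsub>F\<^esub> w) \<otimes>\<^bsub>F\<^esub> f = (\<lambda>w. a * (\<one>\<^bsub>F\<^esub> \<otimes>\<^bsub>F\<^esub> f) w)"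
    unfolding free_algebra_simps(2) by (simp add: sum_distrib_left mult.assoc)
  also have "\<dots> = (\<lambda>w. a * f w)" using F.l_one[OF f] by simp
  finally show ?thesis
    using R.I_l_closed[OF assms free_algebra_smult_closed[OF F.one_closed, of a]] by simp
qed

lemma coset_image: "R +>\<^bsub>F\<^esub> f = (\<lambda>i w. i w + f w) ` R"
  unfolding a_r_coset_def' free_algebra_simps(5) by (rule UNION_singleton_eq_range)

text \<open>Scalar multiplication of a coset is a union over its representatives; all of them yield
  the same coset, which is therefore the union.\<close>

lemma coset_smult: 
  assumes "f \<in> carrier F"
  shows "a \<odot>\<^bsub>presented_algebra n d\<^esub> (R +>\<^bsub>F\<^esub> f) = R +>\<^bsub>F\<^esub> (\<lambda>w. a * f w)"
proof -
  have "R +>\<^bsub>F\<^esub> (a \<odot>\<^bsub>F\<^esub> c) = R +>\<^bsub>F\<^esub> (\<lambda>w. a * f w)" if cf: "c \<in> R +>\<^bsub>F\<^esub> f" for c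
  proof -
    obtain i where i: "i \<in> R" "c = (\<lambda>w. i w + f w)"
      using cf unfolding coset_image by (rule imageE)
    have c: "c \<in> carrier F" unfolding i(2) by (rule free_algebra_add_closed[OF subsetD[OF R.a_subset i(1)] assms])
    have "(\<lambda>w. a * c w) \<ominus>\<^bsub>F\<^esub> (\<lambda>w. a * f w) \<in> R"
      using ideal_smult[OF i(1), of a]
      unfolding free_algebra_minus[OF free_algebra_smult_closed[OF assms]] i(2) by (simp add: distrib_left)
    then show ?thesis
      unfolding free_algebra_simps(6)
      using R.rcos_eq_iff[OF free_algebra_smult_closed[OF c] free_algebra_smult_closed[OF assms]] by blast
  qed
  moreover have "f \<in> R +>\<^bsub>F\<^esub> f" by (rule R.a_rcos_self[OF assms])
  moreover have "a \<odot>\<^bsub>presented_algebra n d\<^esub> (R +>\<^bsub>F\<^esub> f) = (\<Union>c\<in>R +>\<^bsub>F\<^esub> f. R +>\<^bsub>F\<^esub> (a \<odot>\<^bsub>F\<^esub> c))"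
    unfolding presented_algebra_def graded_quot_def by simp
  ultimately show ?thesis by blast
qed

lemma L_smult:
  assumes "f \<in> carrier F"
  shows "L (\<lambda>w. a * f w) = a \<odot>\<^bsub>H\<^esub> L f"
proof -
  have "R +>\<^bsub>F\<^esub> f \<in> carrier (presented_algebra n d)"
    using coset_closed[OF assms] unfolding presented_algebra_def graded_quot_def by simp
  then have "\<Phi> (a \<odot>\<^bsub>presented_algebra n d\<^esub> (R +>\<^bsub>F\<^esub> f)) = a \<odot>\<^bsub>H\<^esub> \<Phi> (R +>\<^bsub>F\<^esub> f)"
    using alg_iso unfolding graded_algebra_iso_def by blast
  then show ?thesis unfolding L_def coset_smult[OF assms] .
qed

lemma hpart_H: "hpart H p = L ` hpart F p"
proof -
  have "hpart H p = \<Phi> ` hpart (presented_algebra n d) p"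
    using alg_iso unfolding graded_algebra_iso_def by blast
  then show ?thesis unfolding presented_algebra_def graded_quot_def L_def by (simp add: image_image)
qed

lemma gen_L: "i \<in> {1..n} \<Longrightarrow> j \<in> {1..n} \<Longrightarrow> A i j = L (word_fun [(i, j)])"
  unfolding gen[symmetric] presented_gen_def L_def free_gen_word_fun ..

end

lemma config_relators_mem:
  assumes "odd d"
  shows "i \<in> {1..n} \<Longrightarrow> word_fun [(i, i)] \<in> config_relators n d"
    "i \<in> {1..n} \<Longrightarrow> j \<in> {1..n} \<Longrightarrow> (\<lambda>w. word_fun [(i, j)] w + word_fun [(j, i)] w) \<in> config_relators n d"
    "{i, j, h, k} \<subseteq> {1..n} \<Longrightarrow>
      (\<lambda>w. word_fun [(i, j), (h, k)] w - word_fun [(h, k), (i, j)] w) \<in> config_relators n d"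
    "{i, j, k} \<subseteq> {1..n} \<Longrightarrow> j \<le> k \<Longrightarrow>
      (\<lambda>w. word_fun [(i, j), (i, k)] w - (word_fun [(k, j), (i, k)] w - word_fun [(k, j), (i, j)] w))
      \<in> config_relators n d"
proof -
  show "i \<in> {1..n} \<Longrightarrow> word_fun [(i, i)] \<in> config_relators n d"
    unfolding config_relators_odd[OF assms]
    by (rule UnI1, rule UnI1, rule UnI1, rule CollectI, intro exI[of _ i] conjI refl)
  show "i \<in> {1..n} \<Longrightarrow> j \<in> {1..n} \<Longrightarrow> (\<lambda>w. word_fun [(i, j)] w + word_fun [(j, i)] w) \<in> config_relators n d"
    unfolding config_relators_odd[OF assms]
    by (rule UnI1, rule UnI1, rule UnI2, rule CollectI, intro exI[of _ i] exI[of _ j] conjI refl)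
  show "(\<lambda>w. word_fun [(i, j), (h, k)] w - word_fun [(h, k), (i, j)] w) \<in> config_relators n d"
    if "{i, j, h, k} \<subseteq> {1..n}"
    unfolding config_relators_odd[OF assms] using that
    by - (rule UnI1, rule UnI2, rule CollectI, intro exI[of _ i] exI[of _ j] exI[of _ h] exI[of _ k] conjI refl; simp)
  show "(\<lambda>w. word_fun [(i, j), (i, k)] w - (word_fun [(k, j), (i, k)] w - word_fun [(k, j), (i, j)] w))
      \<in> config_relators n d" if "{i, j, k} \<subseteq> {1..n}" "j \<le> k"
    unfolding config_relators_odd[OF assms] using that
    by - (rule UnI2, rule CollectI, intro exI[of _ i] exI[of _ j] exI[of _ k] conjI refl; simp)
qed

section \<open>The pairing of the cohomology with forms\<close>

context cohomology_presentation begin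

lemma config_relators_ideal: "config_relators n d \<subseteq> R"
  unfolding config_ideal_def by (rule F.genideal_self[OF config_relators_carrier[OF d(1)]])

lemma ideal_annihilator: "\<phi> \<in> config_forms \<Longrightarrow> R \<subseteq> annihilator n (d - 1) \<phi>"
  unfolding config_ideal_def
  by (rule F.genideal_minimal[OF annihilator_ideal config_relators_annihilator[OF d(1)]])
    (auto dest: config_formsD)

definition pr where "pr x \<phi> = config_pairing n \<phi> (SOME f. f \<in> carrier F \<and> L f = x)"

text \<open>Two representatives differ by an element of the ideal, which every form in
  \<open>config_forms\<close> annihilates, so the choice made in \<open>pr\<close> is
  immaterial.\<close>

lemma pr_L:
  assumes f: "f \<in> carrier F" and K: "\<phi> \<in> config_forms"
  shows "pr (L f) \<phi> = config_pairing n \<phi> f"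
proof -
  define g where "g = (SOME g. g \<in> carrier F \<and> L g = L f)"
  have g: "g \<in> carrier F \<and> L g = L f" unfolding g_def by (rule someI[of _ f]) (simp add: f)
  then have "(\<lambda>w. g w - f w) \<in> R" using L_eq_iff f by blast
  then have "config_pairing n \<phi> (\<lambda>w. g w - f w) = 0"
    using ideal_annihilator[OF K] unfolding annihilator_def by blast
  then show ?thesis unfolding pr_def g_def[symmetric] config_pairing_diff by simp
qed

lemma pr_add:
  assumes "x \<in> carrier H" "y \<in> carrier H" "\<phi> \<in> config_forms"
  shows "pr (x \<oplus>\<^bsub>H\<^esub> y) \<phi> = pr x \<phi> + pr y \<phi>"
proof -
  obtain f g where fg: "f \<in> carrier F" "x = L f" "g \<in> carrier F" "y = L g" using assms unfolding L_surj by blast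
  show ?thesis
    unfolding fg(2,4) L_add[OF fg(1,3), symmetric] pr_L[OF fg(1) assms(3)] pr_L[OF fg(3) assms(3)]
      pr_L[OF free_algebra_add_closed[OF fg(1,3)] assms(3)] by (rule config_pairing_add)
qed

lemma pr_smult:
  assumes "x \<in> carrier H" "\<phi> \<in> config_forms"
  shows "pr (c \<odot>\<^bsub>H\<^esub> x) \<phi> = c * pr x \<phi>"
proof -
  obtain f where f: "f \<in> carrier F" "x = L f" using assms unfolding L_surj by blast
  show ?thesis
    unfolding f(2) L_smult[OF f(1), symmetric] pr_L[OF f(1) assms(2)]
      pr_L[OF free_algebra_smult_closed[OF f(1)] assms(2)] by (rule config_pairing_smult)
qed

lemma pr_zero: "\<phi> \<in> config_forms \<Longrightarrow> pr \<zero>\<^bsub>H\<^esub> \<phi> = 0"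
  using pr_add[OF H.zero_closed H.zero_closed] by simp

lemma smult_H_closed: "x \<in> carrier H \<Longrightarrow> c \<odot>\<^bsub>H\<^esub> x \<in> carrier H"
proof -
  assume "x \<in> carrier H"
  then obtain f where f: "f \<in> carrier F" "x = L f" unfolding L_surj by blast
  show ?thesis unfolding f(2) L_smult[OF f(1), symmetric] by (rule L_closed[OF free_algebra_smult_closed[OF f(1)]])
qed

text \<open>As \<open>d - 1\<close> is positive, the degree of a word determines its length.\<close>

lemma hpart_F: "hpart F (2 * (d - 1)) = {f \<in> carrier F. \<forall>w. f w \<noteq> 0 \<longrightarrow> length w = 2}"
  using d(2) unfolding free_algebra_simps by auto

lemma hpart_F_nonzero:
  assumes "f \<in> hpart F (2 * (d - 1))" "f w \<noteq> 0"
  shows "w \<in> (\<lambda>(u, v). [u, v]) ` (G \<times> G)"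
proof -
  have "length w = 2" "set w \<subseteq> G" using assms unfolding hpart_F by (auto simp: free_algebra_simps(1))
  then obtain u v where "w = [u, v]" by (auto simp: numeral_2_eq_2 length_Suc_conv)
  with \<open>set w \<subseteq> G\<close> show ?thesis by (auto intro!: image_eqI[of _ _ "(u, v)"])
qed

lemma hpart_F_expand:
  assumes "f \<in> hpart F (2 * (d - 1))"
  shows "f = (\<lambda>w. \<Sum>x\<in>G \<times> G. f [fst x, snd x] * word_fun [fst x, snd x] w)"
proof (rule HOL.ext)
  fix w
  show "f w = (\<Sum>x\<in>G \<times> G. f [fst x, snd x] * word_fun [fst x, snd x] w)"
  proof (cases "w \<in> (\<lambda>(u, v). [u, v]) ` (G \<times> G)")
    case True
    then obtain u v where w: "w = [u, v]" "(u, v) \<in> G \<times> G" by auto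
    have "(\<Sum>x\<in>G \<times> G. f [fst x, snd x] * word_fun [fst x, snd x] w) = (\<Sum>x\<in>G \<times> G. if x = (u, v) then f w else 0)"
      unfolding w(1) word_fun_def by (intro sum.cong refl) auto
    also have "\<dots> = f w" using w(2) by simp
    finally show ?thesis ..
  next
    case False
    then have "f w = 0" using hpart_F_nonzero[OF assms] by blast
    moreover have "(\<Sum>x\<in>G \<times> G. f [fst x, snd x] * word_fun [fst x, snd x] w) = 0"
      using False by (intro sum.neutral) (auto simp: word_fun_def)
    ultimately show ?thesis by simp
  qed
qed

lemma word_fun_hpart: "u \<in> G \<Longrightarrow> v \<in> G \<Longrightarrow> word_fun [u, v] \<in> hpart F (2 * (d - 1))"
  unfolding hpart_F by (auto intro!: word_fun_closed) (auto simp: word_fun_def split: if_splits)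

lemma hpart_F_zero: "(\<lambda>w. 0) \<in> hpart F (2 * (d - 1))"
  unfolding hpart_F using F.zero_closed by (simp add: free_algebra_simps(4))

lemma hpart_F_add:
  assumes "f \<in> hpart F (2 * (d - 1))" "g \<in> hpart F (2 * (d - 1))"
  shows "(\<lambda>w. f w + g w) \<in> hpart F (2 * (d - 1))"
proof -
  have "length w = 2" if "f w + g w \<noteq> 0" for w
  proof -
    have "f w \<noteq> 0 \<or> g w \<noteq> 0" using that by auto
    then show ?thesis using assms unfolding hpart_F by blast
  qed
  then show ?thesis using assms free_algebra_add_closed unfolding hpart_F by blast
qed

lemma hpart_F_smult: "f \<in> hpart F (2 * (d - 1)) \<Longrightarrow> (\<lambda>w. c * f w) \<in> hpart F (2 * (d - 1))"
  unfolding hpart_F using free_algebra_smult_closed[of f G "d - 1" c] by simp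

text \<open>Elements of this degree are images of combinations of words of length two, and such a
  word is a product of two generators.\<close>

lemma hpart_H_induct [consumes 1, case_names zero gen add smult]:
  assumes x: "x \<in> hpart H (2 * (d - 1))"
    and zero: "P \<zero>\<^bsub>H\<^esub>"
    and gen: "\<And>i j k l. {i, j, k, l} \<subseteq> {1..n} \<Longrightarrow> P (A i j \<otimes>\<^bsub>H\<^esub> A k l)"
    and add: "\<And>x y. x \<in> carrier H \<Longrightarrow> y \<in> carrier H \<Longrightarrow> P x \<Longrightarrow> P y \<Longrightarrow> P (x \<oplus>\<^bsub>H\<^esub> y)"
    and smult: "\<And>c x. x \<in> carrier H \<Longrightarrow> P x \<Longrightarrow> P (c \<odot>\<^bsub>H\<^esub> x)"
  shows "P x"
proof -
  obtain f where f: "f \<in> hpart F (2 * (d - 1))" "x = L f" using x unfolding hpart_H by blast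
  have word: "P (L (word_fun [u, v])) \<and> word_fun [u, v] \<in> carrier F" if uv: "u \<in> G" "v \<in> G" for u v
  proof -
    have c: "word_fun [u] \<in> carrier F" "word_fun [v] \<in> carrier F" "word_fun [u, v] \<in> carrier F"
      using uv by (auto intro!: word_fun_closed)
    have "L (word_fun [u, v]) = L (word_fun [u]) \<otimes>\<^bsub>H\<^esub> L (word_fun [v])"
      unfolding L_mult[OF c(1,2), symmetric] word_fun_mult by simp
    also have "\<dots> = A (fst u) (snd u) \<otimes>\<^bsub>H\<^esub> A (fst v) (snd v)"
      using uv gen_L[of "fst u" "snd u"] gen_L[of "fst v" "snd v"] by auto
    finally show ?thesis using gen[of "fst u" "snd u" "fst v" "snd v"] uv c(3) by auto
  qed
  have "P (L (\<lambda>w. \<Sum>x\<in>X. f [fst x, snd x] * word_fun [fst x, snd x] w)) \<and>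
     (\<lambda>w. \<Sum>x\<in>X. f [fst x, snd x] * word_fun [fst x, snd x] w) \<in> carrier F" if "finite X" "X \<subseteq> G \<times> G" for X
    using that
  proof (induction X rule: finite_induct)
    case empty
    then show ?case using zero L_zero F.zero_closed by (simp add: free_algebra_simps(4))
  next
    case (insert x X)
    define h where "h = (\<lambda>w. \<Sum>x\<in>X. f [fst x, snd x] * word_fun [fst x, snd x] w)"
    define k where "k = (\<lambda>w. f [fst x, snd x] * word_fun [fst x, snd x] w)"
    have h: "P (L h)" "h \<in> carrier F" using insert unfolding h_def by auto
    have wc: "P (L (word_fun [fst x, snd x]))" "word_fun [fst x, snd x] \<in> carrier F"
      using word[of "fst x" "snd x"] insert.prems by auto
    have k: "k \<in> carrier F" unfolding k_def by (rule free_algebra_smult_closed[OF wc(2)])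
    have "P (L k)" unfolding k_def L_smult[OF wc(2)] by (rule smult[OF L_closed[OF wc(2)] wc(1)])
    then have "P (L (\<lambda>w. k w + h w))"
      unfolding L_add[OF k h(2)] by (intro add L_closed k h)
    moreover have "(\<lambda>w. k w + h w) \<in> carrier F" by (rule free_algebra_add_closed[OF k h(2)])
    moreover have "(\<lambda>w. k w + h w) = (\<lambda>w. \<Sum>x\<in>insert x X. f [fst x, snd x] * word_fun [fst x, snd x] w)"
      unfolding h_def k_def using insert.hyps by simp
    ultimately show ?case by simp
  qed
  from this[of "G \<times> G"] have "P (L (\<lambda>w. \<Sum>x\<in>G \<times> G. f [fst x, snd x] * word_fun [fst x, snd x] w))" by simp
  then show ?thesis unfolding f(2) hpart_F_expand[OF f(1), symmetric] .
qed

lemma hpart_carrier: "hpart H (2 * (d - 1)) \<subseteq> carrier H"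
  unfolding hpart_H L_surj hpart_F by blast

lemma hpart_H_add:
  assumes "x \<in> hpart H (2 * (d - 1))" "y \<in> hpart H (2 * (d - 1))"
  shows "x \<oplus>\<^bsub>H\<^esub> y \<in> hpart H (2 * (d - 1))"
proof -
  obtain f g where fg: "f \<in> hpart F (2 * (d - 1))" "x = L f" "g \<in> hpart F (2 * (d - 1))" "y = L g"
    using assms unfolding hpart_H by blast
  have "f \<in> carrier F" "g \<in> carrier F" using fg unfolding hpart_F by auto
  then have "x \<oplus>\<^bsub>H\<^esub> y = L (\<lambda>w. f w + g w)" unfolding fg by (simp add: L_add)
  then show ?thesis unfolding hpart_H using hpart_F_add[OF fg(1,3)] by blast
qed

lemma hpart_H_smult:
  assumes "x \<in> hpart H (2 * (d - 1))"
  shows "c \<odot>\<^bsub>H\<^esub> x \<in> hpart H (2 * (d - 1))"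
proof -
  obtain f where f: "f \<in> hpart F (2 * (d - 1))" "x = L f"
    using assms unfolding hpart_H by blast
  have "f \<in> carrier F" using f unfolding hpart_F by auto
  then have "c \<odot>\<^bsub>H\<^esub> x = L (\<lambda>w. c * f w)" unfolding f by (simp add: L_smult)
  then show ?thesis unfolding hpart_H using hpart_F_smult[OF f(1)] by blast
qed

lemma hpart_H_zero: "\<zero>\<^bsub>H\<^esub> \<in> hpart H (2 * (d - 1))"
  unfolding hpart_H L_zero[symmetric] using hpart_F_zero by blast

text \<open>\<open>M\<close> is lifted to a space \<open>N\<close> of functions on words of length
  two, where a separating functional \<open>\<psi>\<close> exists. As \<open>N\<close> contains all
  relations of this degree, evaluating \<open>\<psi>\<close> on them shows that its values on words,
  extended by zero, form an element of \<open>config_forms\<close>.\<close>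

lemma separation:
  assumes M: "M \<subseteq> hpart H (2 * (d - 1))" "M \<noteq> {}" "\<And>x y. x \<in> M \<Longrightarrow> y \<in> M \<Longrightarrow> x \<oplus>\<^bsub>H\<^esub> y \<in> M"
    "\<And>c x. x \<in> M \<Longrightarrow> c \<odot>\<^bsub>H\<^esub> x \<in> M"
    and x: "x \<in> hpart H (2 * (d - 1))" "x \<notin> M"
  shows "\<exists>\<phi>\<in>config_forms. (\<forall>y\<in>M. pr y \<phi> = 0) \<and> pr x \<phi> \<noteq> 0"
proof -
  obtain f0 where f0: "f0 \<in> hpart F (2 * (d - 1))" "x = L f0" using x unfolding hpart_H by blast
  define N where "N = {f \<in> hpart F (2 * (d - 1)). L f \<in> M}"
  have carr: "f \<in> carrier F" if "f \<in> hpart F (2 * (d - 1))" for f using that unfolding hpart_F by auto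
  let ?X = "(\<lambda>(u, v). [u, v]) ` (G \<times> G)"
  have Nadd: "(\<lambda>w. f w + g w) \<in> N" if "f \<in> N" "g \<in> N" for f g
    using that M(3) carr unfolding N_def by (simp add: hpart_F_add L_add)
  have Nsmult: "(\<lambda>w. c * f w) \<in> N" if "f \<in> N" for c f
    using that M(4) carr unfolding N_def by (simp add: hpart_F_smult L_smult)
  have "\<exists>\<psi>. (\<forall>f\<in>N. (\<Sum>w\<in>?X. f w * \<psi> w) = 0) \<and> (\<Sum>w\<in>?X. f0 w * \<psi> w) \<noteq> 0"
  proof (rule subspace_separation)
    show "finite ?X" by simp
    show "f w = 0" if "f \<in> N" "w \<notin> ?X" for f w
      using that hpart_F_nonzero unfolding N_def by blast
    show "f0 w = 0" if "w \<notin> ?X" for w using that hpart_F_nonzero[OF f0(1)] by blast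
    obtain y where "y \<in> M" using M(2) by blast
    then obtain f where "f \<in> hpart F (2 * (d - 1))" "y = L f" using M(1) unfolding hpart_H by blast
    then show "N \<noteq> {}" using \<open>y \<in> M\<close> unfolding N_def by blast
    show "f0 \<notin> N" using x(2) f0 unfolding N_def by simp
  qed (rule Nadd Nsmult; assumption)+
  then obtain \<psi> where \<psi>: "\<And>f. f \<in> N \<Longrightarrow> (\<Sum>w\<in>?X. f w * \<psi> w) = 0" "(\<Sum>w\<in>?X. f0 w * \<psi> w) \<noteq> 0" by blast
  define \<phi> where "\<phi> i j k l = (if {i, j, k, l} \<subseteq> {1..n} then \<psi> [(i, j), (k, l)] else 0)" for i j k l
  have pair: "(\<Sum>w\<in>?X. f w * \<psi> w) = config_pairing n \<phi> f" for f
  proof -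
    have "inj_on (\<lambda>(u, v). [u, v]) (G \<times> G)" by (auto simp: inj_on_def)
    then have "(\<Sum>w\<in>?X. f w * \<psi> w) = (\<Sum>(u, v)\<in>G \<times> G. f [u, v] * \<psi> [u, v])"
      by (subst sum.reindex) (auto simp: comp_def split_beta)
    also have "\<dots> = (\<Sum>(u, v)\<in>G \<times> G. f [u, v] * \<phi> (fst u) (snd u) (fst v) (snd v))"
      unfolding \<phi>_def by (intro sum.cong refl) auto
    finally show ?thesis unfolding config_pairing_def by (simp add: sum.cartesian_product)
  qed
  \<comment> \<open>Relations map to zero, which lies in every nonempty set closed under
    scalars.\<close>
  have zeroN: "f \<in> N" if "f \<in> R" "f \<in> hpart F (2 * (d - 1))" for f
  proof -
    obtain y where y: "y \<in> M" using M(2) by blast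
    then obtain g where g: "g \<in> hpart F (2 * (d - 1))" "y = L g" using M(1) unfolding hpart_H by blast
    have "(\<lambda>w. 0 * g w) \<in> N" using Nsmult g y unfolding N_def by blast
    then have "\<zero>\<^bsub>H\<^esub> \<in> M" unfolding N_def by (simp add: L_zero)
    moreover have "L f = \<zero>\<^bsub>H\<^esub>"
      unfolding L_zero[symmetric] using L_eq_iff[OF carr[OF that(2)] carr[OF hpart_F_zero]] that(1) by simp
    ultimately show ?thesis using that unfolding N_def by simp
  qed
  have wp: "config_pairing n \<phi> (word_fun [(i, j), (k, l)]) = \<phi> i j k l" if "{i, j, k, l} \<subseteq> {1..n}" for i j k l
    using config_pairing_word[of "(i, j)" n "(k, l)" \<phi>] that by simp
  have wh: "word_fun [(i, j), (k, l)] \<in> hpart F (2 * (d - 1))" if "{i, j, k, l} \<subseteq> {1..n}" for i j k l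
    using that by (intro word_fun_hpart) auto
  have Rc: "word_fun [(i, i)] \<in> R" "(\<lambda>w. word_fun [(i, j)] w + word_fun [(j, i)] w) \<in> R"
    if "i \<in> {1..n}" "j \<in> {1..n}" for i j
    using that by (intro subsetD[OF config_relators_ideal] config_relators_mem[OF d(1)]; simp)+
  \<comment> \<open>The linear relator reaches length two after multiplication by a
    generator.\<close>
  have ant: "\<phi> i j k l = - \<phi> j i k l" if m: "{i, j, k, l} \<subseteq> {1..n}" for i j k l
  proof -
    have "(\<lambda>w. word_fun [(i, j)] w + word_fun [(j, i)] w) \<otimes>\<^bsub>F\<^esub> word_fun [(k, l)] \<in> R"
      using Rc(2)[of i j] m by (intro R.I_r_closed word_fun_closed) auto
    moreover have "(\<lambda>w. word_fun [(i, j)] w + word_fun [(j, i)] w) \<otimes>\<^bsub>F\<^esub> word_fun [(k, l)]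
       = (\<lambda>w. word_fun [(i, j), (k, l)] w + word_fun [(j, i), (k, l)] w)"
    proof -
      have "(\<lambda>w. word_fun [(i, j)] w + word_fun [(j, i)] w) \<otimes>\<^bsub>F\<^esub> word_fun [(k, l)]
        = word_fun [(i, j)] \<otimes>\<^bsub>F\<^esub> word_fun [(k, l)] \<oplus>\<^bsub>F\<^esub> word_fun [(j, i)] \<otimes>\<^bsub>F\<^esub> word_fun [(k, l)]"
        unfolding free_algebra_simps(2,5) by (simp add: distrib_right sum.distrib)
      then show ?thesis unfolding word_fun_mult free_algebra_simps(5) by simp
    qed
    ultimately have "(\<lambda>w. word_fun [(i, j), (k, l)] w + word_fun [(j, i), (k, l)] w) \<in> N"
      using m by (intro zeroN hpart_F_add wh) auto
    from \<psi>(1)[OF this] have "\<phi> i j k l + \<phi> j i k l = 0"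
      unfolding pair config_pairing_add using wp[of i j k l] wp[of j i k l] m by simp
    then show ?thesis by (simp add: eq_neg_iff_add_eq_0)
  qed
  have sym: "\<phi> i j k l = \<phi> k l i j" if m: "{i, j, k, l} \<subseteq> {1..n}" for i j k l
  proof -
    have "(\<lambda>w. word_fun [(i, j), (k, l)] w - word_fun [(k, l), (i, j)] w) \<in> R"
      by (intro subsetD[OF config_relators_ideal] config_relators_mem[OF d(1)] m)
    moreover have "(\<lambda>w. word_fun [(i, j), (k, l)] w - word_fun [(k, l), (i, j)] w) \<in> hpart F (2 * (d - 1))"
      using hpart_F_add[OF wh[of i j k l] hpart_F_smult[OF wh[of k l i j], of "-1"]] m by simp
    ultimately have "(\<lambda>w. word_fun [(i, j), (k, l)] w - word_fun [(k, l), (i, j)] w) \<in> N" by (rule zeroN)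
    from \<psi>(1)[OF this] have "\<phi> i j k l - \<phi> k l i j = 0"
      unfolding pair config_pairing_diff using wp[of i j k l] wp[of k l i j] m by simp
    then show ?thesis by simp
  qed
  have arn: "\<phi> i j i k = \<phi> k j i k - \<phi> k j i j" if m: "{i, j, k} \<subseteq> {1..n}" "j \<le> k" for i j k
  proof -
    let ?f = "\<lambda>w. word_fun [(i, j), (i, k)] w - (word_fun [(k, j), (i, k)] w - word_fun [(k, j), (i, j)] w)"
    have "?f \<in> R" by (intro subsetD[OF config_relators_ideal] config_relators_mem[OF d(1)] m)
    moreover have "?f \<in> hpart F (2 * (d - 1))"
    proof -
      have "?f = (\<lambda>w. word_fun [(i, j), (i, k)] w + (- 1 * word_fun [(k, j), (i, k)] w + word_fun [(k, j), (i, j)] w))"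
        by (rule HOL.ext) (simp add: algebra_simps)
      then show ?thesis
        using hpart_F_add[OF wh[of i j i k] hpart_F_add[OF hpart_F_smult[OF wh[of k j i k], of "-1"] wh[of k j i j]]] m
        by (simp only: insert_subset empty_subsetI simp_thms)
    qed
    ultimately have "?f \<in> N" by (rule zeroN)
    from \<psi>(1)[OF this] have "\<phi> i j i k - (\<phi> k j i k - \<phi> k j i j) = 0"
      unfolding pair config_pairing_diff using wp[of i j i k] wp[of k j i k] wp[of k j i j] m by simp
    then show ?thesis by simp
  qed
  have out: "\<phi> i j k l = 0" if "\<not> {i, j, k, l} \<subseteq> {1..n}" for i j k l
    unfolding \<phi>_def by (rule if_not_P[OF that])
  have e: "edge_form \<phi>"
    unfolding edge_form_def
  proof (intro conjI allI)
    fix i j k l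
    show "\<phi> i j k l = - \<phi> j i k l"
      proof (cases "{i, j, k, l} \<subseteq> {1..n}")
      case True
      then show ?thesis by (rule ant)
    next
      case False
      then have "\<not> {j, i, k, l} \<subseteq> {1..n}" by blast
      then show ?thesis using out False by simp
    qed
    show "\<phi> i j k l = \<phi> k l i j"
      proof (cases "{i, j, k, l} \<subseteq> {1..n}")
      case True
      then show ?thesis by (rule sym)
    next
      case False
      then have "\<not> {k, l, i, j} \<subseteq> {1..n}" by blast
      then show ?thesis using out False by simp
    qed
  qed
  note e1 = edge_form_antisym1[OF e] and e2 = edge_form_antisym2[OF e] and e3 = edge_form_sym[OF e]
  \<comment> \<open>For \<open>j = k\<close> the Arnold relator is the square of a
    generator.\<close>
  have sq: "\<phi> i j i j = 0" for i j
  proof (cases "{i, j} \<subseteq> {1..n}")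
    case True
    then show ?thesis using arn[of i j j] edge_form_refl1[OF e] by simp
  next
    case False
    then show ?thesis by (intro out) blast
  qed
  have arnold: "\<phi> a b b c + \<phi> b c c a + \<phi> c a a b = 0" if m: "{a, b, c} \<subseteq> {1..n}" "b \<le> c" for a b c
  proof -
    have f1: "\<phi> a b a c = - \<phi> c a a b" using e2[of a b a c] e3[of a b c a] by simp
    have f2: "\<phi> c b a c = \<phi> b c c a" using e1[of c b a c] e2[of b c a c] by simp
    have f3: "\<phi> c b a b = - \<phi> a b b c" using e1[of c b a b] e3[of b c a b] by simp
    have "- \<phi> c a a b = \<phi> b c c a - - \<phi> a b b c" using arn[OF m] unfolding f1 f2 f3 .
    then show ?thesis by (simp add: neg_eq_iff_add_eq_0 algebra_simps)
  qed
  have tri: "triangle_form \<phi> a b c a b c = 0" for a b c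
  proof -
    have t: "triangle_form \<phi> a b c a b c = 2 * (\<phi> a b b c + \<phi> b c c a + \<phi> c a a b)" for a b c
      unfolding triangle_form_def sq
      using e3[of b c a b] e3[of c a b c] e3[of c a a b] by simp
    show ?thesis
    proof (cases "{a, b, c} \<subseteq> {1..n}")
      case True
      show ?thesis
      \<comment> \<open>The relators have ordered indices; exchanging two vertices changes the sign
        of the triangle class and leaves its square alone.\<close>
      proof (cases "b \<le> c")
        case True
        show ?thesis unfolding t arnold[OF \<open>{a, b, c} \<subseteq> {1..n}\<close> True] by simp
      next
        case False
        have "triangle_form \<phi> a b c a b c = triangle_form \<phi> a c b a c b"
          using triangle_form_swap23[OF e, of a b c a b c] triangle_form_swap56[OF e, of a c b a b c] by simp
        moreover have "{a, c, b} \<subseteq> {1..n}" "c \<le> b" using \<open>{a, b, c} \<subseteq> {1..n}\<close> False by auto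
        ultimately show ?thesis unfolding t arnold[OF \<open>{a, c, b} \<subseteq> {1..n}\<close> \<open>c \<le> b\<close>] by simp
      qed
    next
      case False
      then have "\<phi> a b b c = 0" "\<phi> b c c a = 0" "\<phi> c a a b = 0" by (intro out, blast)+
      then show ?thesis unfolding t by simp
    qed
  qed
  have K: "\<phi> \<in> config_forms"
    unfolding config_forms_def by (intro CollectI conjI allI e tri out) simp
  have "pr y \<phi> = 0" if y: "y \<in> M" for y
  proof -
    obtain f where f: "f \<in> hpart F (2 * (d - 1))" "y = L f" using y M(1) unfolding hpart_H by blast
    then have "f \<in> N" using y unfolding N_def by simp
    then show ?thesis unfolding f(2) pr_L[OF carr[OF f(1)] K] pair[symmetric] by (rule \<psi>(1))
  qed
  moreover have "pr x \<phi> \<noteq> 0" unfolding f0(2) pr_L[OF carr[OF f0(1)] K] pair[symmetric] by (rule \<psi>(2))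
  ultimately show ?thesis using K by blast
qed

end

section \<open>The extended action as adjoint of \<open>pull_form\<close>\<close>

context cohomology_presentation begin

definition relative_gen where "relative_gen a b = (if a = 0 \<or> b = 0 then \<zero>\<^bsub>H\<^esub> else A a b)"

lemma A_closed: "i \<in> {1..n} \<Longrightarrow> j \<in> {1..n} \<Longrightarrow> A i j \<in> carrier H"
  by (simp add: gen_L L_closed word_fun_closed)

lemma L_ideal:
  assumes "f \<in> R"
  shows "L f = \<zero>\<^bsub>H\<^esub>"
proof -
  have "f \<in> carrier F" using assms R.a_subset by blast
  from L_eq_iff[OF this F.zero_closed] show ?thesis
    using assms unfolding free_algebra_simps(4) L_zero by simp
qed

lemma A_refl:
  assumes "i \<in> {1..n}"
  shows "A i i = \<zero>\<^bsub>H\<^esub>"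
  unfolding gen_L[OF assms assms]
  by (rule L_ideal[OF subsetD[OF config_relators_ideal config_relators_mem(1)[OF d(1) assms]]])

lemma A_swap:
  assumes "i \<in> {1..n}" "j \<in> {1..n}"
  shows "A j i = \<ominus>\<^bsub>H\<^esub> A i j"
proof -
  have c: "word_fun [(i, j)] \<in> carrier F" "word_fun [(j, i)] \<in> carrier F"
    using assms by (auto intro!: word_fun_closed)
  have "A j i \<oplus>\<^bsub>H\<^esub> A i j = \<zero>\<^bsub>H\<^esub>"
    using L_ideal[OF subsetD[OF config_relators_ideal config_relators_mem(2)[OF d(1) assms(2,1)]]]
    unfolding L_add[OF c(2,1)] gen_L[OF assms] gen_L[OF assms(2,1)] .
  then show ?thesis by (rule H.minus_equality[symmetric, OF _ A_closed A_closed]) (rule assms)+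
qed

lemma relative_gen_closed:
  assumes "a \<le> n" "b \<le> n"
  shows "relative_gen a b \<in> carrier H"
proof (cases "a = 0 \<or> b = 0")
  case True
  then show ?thesis unfolding relative_gen_def using H.zero_closed by (simp only: if_True)
next
  case False
  then have "a \<in> {1..n}" "b \<in> {1..n}" using assms by auto
  then show ?thesis using False A_closed unfolding relative_gen_def by (simp only: if_False)
qed

lemma pr_product:
  assumes "a \<le> n" "b \<le> n" "c \<le> n" "e \<le> n" "\<phi> \<in> config_forms"
  shows "pr (relative_gen a b \<otimes>\<^bsub>H\<^esub> relative_gen c e) \<phi> = \<phi> a b c e"
proof (cases "a = 0 \<or> b = 0 \<or> c = 0 \<or> e = 0")
  case True
  then have "relative_gen a b \<otimes>\<^bsub>H\<^esub> relative_gen c e = \<zero>\<^bsub>H\<^esub>"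
    using relative_gen_closed[OF assms(1,2)] relative_gen_closed[OF assms(3,4)]
    unfolding relative_gen_def by (auto split: if_splits)
  then show ?thesis using True pr_zero[OF assms(5)] config_forms_zero[OF assms(5)] by auto
next
  case False
  then have m: "a \<in> {1..n}" "b \<in> {1..n}" "c \<in> {1..n}" "e \<in> {1..n}" using assms by auto
  have cl: "word_fun [(a, b)] \<in> carrier F" "word_fun [(c, e)] \<in> carrier F" "word_fun [(a, b), (c, e)] \<in> carrier F"
    using m by (auto intro!: word_fun_closed)
  have "relative_gen a b \<otimes>\<^bsub>H\<^esub> relative_gen c e = L (word_fun [(a, b), (c, e)])"
    using False L_mult[OF cl(1,2)] unfolding relative_gen_def word_fun_mult
    by (simp add: gen_L[OF m(1,2)] gen_L[OF m(3,4)])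
  then show ?thesis
    using pr_L[OF cl(3) assms(5)] config_pairing_word[of "(a, b)" n "(c, e)" \<phi>] m by simp
qed

lemmas action_spec = ext_action[unfolded extended_action_def Let_def]

lemma action_iso: "\<sigma> permutes {0..n} \<Longrightarrow> \<rho> \<sigma> \<in> graded_algebra_iso H H"
  by (rule action_spec[THEN conjunct1, rule_format])

lemma action_hom: "\<sigma> permutes {0..n} \<Longrightarrow> ring_hom_ring H H (\<rho> \<sigma>)"
proof (rule ring_hom_ringI2[OF H.ring_axioms H.ring_axioms])
  assume "\<sigma> permutes {0..n}"
  from action_iso[OF this] show "\<rho> \<sigma> \<in> ring_hom H H"
    unfolding graded_algebra_iso_def ring_iso_def by blast
qed

lemma action_smult: "\<sigma> permutes {0..n} \<Longrightarrow> x \<in> carrier H \<Longrightarrow> \<rho> \<sigma> (c \<odot>\<^bsub>H\<^esub> x) = c \<odot>\<^bsub>H\<^esub> \<rho> \<sigma> x"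
  by (drule action_iso) (unfold graded_algebra_iso_def, blast)

lemma action_hpart: "\<sigma> permutes {0..n} \<Longrightarrow> \<rho> \<sigma> ` hpart H p = hpart H p"
  by (drule action_iso) (unfold graded_algebra_iso_def, blast)

lemma action_comp: "\<sigma> permutes {0..n} \<Longrightarrow> \<tau> permutes {0..n} \<Longrightarrow> x \<in> carrier H \<Longrightarrow> \<rho> (\<sigma> \<circ> \<tau>) x = \<rho> \<sigma> (\<rho> \<tau> x)"
  by (rule action_spec[THEN conjunct2, THEN conjunct1, rule_format])

lemma action_natural:
  assumes "\<sigma> permutes {1..n}" "i \<in> {1..n}" "j \<in> {1..n}"
  shows "\<rho> \<sigma> (A i j) = A (\<sigma> i) (\<sigma> j)"
proof -
  have "\<rho> \<sigma> (A i j) = natural_action n d \<sigma> (A i j)"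
    by (rule action_spec[THEN conjunct2, THEN conjunct2, THEN conjunct1, rule_format,
          OF assms(1) A_closed[OF assms(2,3)]])
  then show ?thesis unfolding nat_action[OF assms] .
qed

lemma action_transpose:
  assumes "1 < j" "j \<le> n"
  shows "\<rho> (Transposition.transpose 0 1) (A 1 j) = \<ominus>\<^bsub>H\<^esub> A 1 j"
    "1 < i \<Longrightarrow> i < j \<Longrightarrow> \<rho> (Transposition.transpose 0 1) (A i j) = (A i j \<ominus>\<^bsub>H\<^esub> A 1 j) \<oplus>\<^bsub>H\<^esub> A 1 i"
  by (rule action_spec[THEN conjunct2, THEN conjunct2, THEN conjunct2, THEN conjunct2, rule_format],
      intro conjI assms)
    (rule action_spec[THEN conjunct2, THEN conjunct2, THEN conjunct2, THEN conjunct1, rule_format],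
      intro conjI assms)

text \<open>A condition on a single permutation that is closed under composition, so that it has to
  be verified only on generators of the group.\<close>

definition "adjoint_pull \<sigma> \<longleftrightarrow> \<sigma> permutes {0..n} \<and>
  (\<forall>x\<in>hpart H (2 * (d - 1)). \<forall>\<phi>\<in>config_forms. pr (\<rho> \<sigma> x) \<phi> = pr x (pull_form \<sigma> \<phi>))"

definition "relative_triangle a b c = relative_gen a b \<oplus>\<^bsub>H\<^esub> (relative_gen b c \<oplus>\<^bsub>H\<^esub> relative_gen c a)"

lemma relative_triangle_swap:
  assumes "a \<le> n" "b \<le> n" "c \<le> n"
  shows "relative_triangle a c b = \<ominus>\<^bsub>H\<^esub> relative_triangle a b c"
proof -
  have sw: "relative_gen j i = \<ominus>\<^bsub>H\<^esub> relative_gen i j" if "i \<le> n" "j \<le> n" for i j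
    using that A_swap[of i j] unfolding relative_gen_def by auto
  show ?thesis
    unfolding relative_triangle_def
    using assms sw[of c a] sw[of b c] sw[of a b]
    by (simp add: relative_gen_closed H.minus_add H.a_ac)
qed

text \<open>Since the action is linear and multiplicative, products of two generators suffice. Their
  images are products of two triangles with first vertex \<open>\<sigma> 0\<close>, and pairing
  these with \<open>\<phi>\<close> is the definition of \<open>pull_form\<close>.\<close>

lemma adjoint_pullI:
  assumes \<sigma>: "\<sigma> permutes {0..n}"
    and act: "\<And>i j. i \<in> {1..n} \<Longrightarrow> j \<in> {1..n} \<Longrightarrow> \<rho> \<sigma> (A i j) = relative_triangle (\<sigma> 0) (\<sigma> i) (\<sigma> j)"
  shows "adjoint_pull \<sigma>"
  unfolding adjoint_pull_def
proof (intro conjI ballI \<sigma>)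
  interpret hom: ring_hom_ring H H "\<rho> \<sigma>" by (rule action_hom[OF \<sigma>])
  fix x \<phi> assume "x \<in> hpart H (2 * (d - 1))" and K: "\<phi> \<in> config_forms"
  note K' = pull_form_config[OF K, of \<sigma>]
  show "pr (\<rho> \<sigma> x) \<phi> = pr x (pull_form \<sigma> \<phi>)"
    using \<open>x \<in> hpart H (2 * (d - 1))\<close>
  proof (induction x rule: hpart_H_induct)
    case zero
    then show ?case using pr_zero[OF K] pr_zero[OF K'] by simp
  next
    case (gen i j k l)
    then have m: "i \<in> {1..n}" "j \<in> {1..n}" "k \<in> {1..n}" "l \<in> {1..n}" by auto
    have le: "\<sigma> a \<le> n" if "a \<le> n" for a using permutes_in_image[OF \<sigma>, of a] that by simp
    have le': "\<sigma> 0 \<le> n" "\<sigma> i \<le> n" "\<sigma> j \<le> n" "\<sigma> k \<le> n" "\<sigma> l \<le> n" using le m by auto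
    have c: "relative_gen (\<sigma> a) (\<sigma> b) \<in> carrier H" if "a \<le> n" "b \<le> n" for a b
      using relative_gen_closed le that by blast
    have "\<rho> \<sigma> (A i j \<otimes>\<^bsub>H\<^esub> A k l) = relative_triangle (\<sigma> 0) (\<sigma> i) (\<sigma> j) \<otimes>\<^bsub>H\<^esub> relative_triangle (\<sigma> 0) (\<sigma> k) (\<sigma> l)"
      using hom.hom_mult[OF A_closed A_closed] act m by simp
    moreover have "pr \<dots> \<phi> = triangle_form \<phi> (\<sigma> 0) (\<sigma> i) (\<sigma> j) (\<sigma> 0) (\<sigma> k) (\<sigma> l)"
      unfolding relative_triangle_def triangle_form_def
      using le' K by (simp add: H.l_distr H.r_distr relative_gen_closed pr_add pr_product)
    moreover have "pr (A i j \<otimes>\<^bsub>H\<^esub> A k l) (pull_form \<sigma> \<phi>) = pull_form \<sigma> \<phi> i j k l"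
      using pr_product[of i j k l, OF _ _ _ _ K'] m unfolding relative_gen_def by auto
    ultimately show ?case unfolding pull_form_def by simp
  next
    case (add x y)
    then show ?case using K K' by (simp add: pr_add)
  next
    case (smult c x)
    then show ?case using K K' \<sigma> by (simp add: action_smult pr_smult)
  qed
qed

lemma adjoint_pull_natural:
  assumes "\<sigma> permutes {1..n}"
  shows "adjoint_pull \<sigma>"
proof (rule adjoint_pullI)
  show "\<sigma> permutes {0..n}" by (rule permutes_subset[OF assms]) auto
  fix i j assume m: "i \<in> {1..n}" "j \<in> {1..n}"
  have "\<sigma> 0 = 0" using permutes_not_in[OF assms] by simp
  moreover have "\<sigma> i \<in> {1..n}" "\<sigma> j \<in> {1..n}" using permutes_in_image[OF assms] m by blast+
  ultimately show "\<rho> \<sigma> (A i j) = relative_triangle (\<sigma> 0) (\<sigma> i) (\<sigma> j)"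
    using action_natural[OF assms m] A_closed[of "\<sigma> i" "\<sigma> j"]
    unfolding relative_triangle_def relative_gen_def by simp
qed

text \<open>For \<open>1 < i < j\<close> the triangle on \<open>1, i, j\<close> is
  \<open>A i j - A 1 j + A 1 i\<close>, and for \<open>i = 1\<close> the triangle on
  \<open>1, 0, j\<close> is \<open>A j 1\<close>, that is \<open>- A 1 j\<close>; these are the
  prescribed images. The other pairs follow from antisymmetry.\<close>

lemma adjoint_pull_transpose:
  assumes n: "n \<ge> 1"
  shows "adjoint_pull (Transposition.transpose 0 1)"
proof (rule adjoint_pullI)
  let ?t = "Transposition.transpose (0::nat) 1"
  show t: "?t permutes {0..n}" using n by (intro permutes_swap_id) auto
  interpret hom: ring_hom_ring H H "\<rho> ?t" by (rule action_hom[OF t])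
  have ti: "?t i = i" if "1 < i" for i using that by (simp add: transpose_def)
  have t0: "?t 0 = 1" "?t 1 = 0" by simp_all
  have ord: "\<rho> ?t (A i j) = relative_triangle 1 (?t i) (?t j)" if "i \<in> {1..n}" "j \<in> {1..n}" "i < j" for i j
  proof (cases "i = 1")
    case True
    then show ?thesis
      using that action_transpose(1)[of j] A_swap[of 1 j] A_closed[of j 1] A_closed[of 1 j] ti[of j] t0
      unfolding relative_triangle_def relative_gen_def by simp
  next
    case False
    then have i: "1 < i" "1 < j" using that by auto
    have c: "A i j \<in> carrier H" "A 1 j \<in> carrier H" "A 1 i \<in> carrier H" using that n by (auto intro!: A_closed)
    show ?thesis
      using that action_transpose(2)[of j i] A_swap[of 1 j] c ti[of i] ti[of j] i n
      unfolding relative_triangle_def relative_gen_def by (simp add: a_minus_def H.a_ac)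
  qed
  fix i j assume m: "i \<in> {1..n}" "j \<in> {1..n}"
  have le: "?t i \<le> n" "?t j \<le> n" using permutes_in_image[OF t, of i] permutes_in_image[OF t, of j] m by auto
  consider "i < j" | "i = j" | "j < i" by linarith
  then show "\<rho> ?t (A i j) = relative_triangle (?t 0) (?t i) (?t j)"
  proof cases
    case 1
    then show ?thesis using ord m t0 by simp
  next
    case 2
    have "relative_triangle 1 (?t i) (?t i) = \<zero>\<^bsub>H\<^esub>"
    proof (cases "i = 1")
      case True
      then show ?thesis unfolding relative_triangle_def relative_gen_def by simp
    next
      case False
      then have "?t i = i" using ti m by simp
      then show ?thesis
        using m A_refl[of i] A_swap[of 1 i] A_closed[of 1 i] n H.r_neg[of "A 1 i"]
        unfolding relative_triangle_def relative_gen_def by simp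
    qed
    then show ?thesis using 2 A_refl m t0 by simp
  next
    case 3
    have "\<rho> ?t (A i j) = \<ominus>\<^bsub>H\<^esub> \<rho> ?t (A j i)" using A_swap[OF m(2,1)] A_closed[OF m(2,1)] by simp
    then show ?thesis using ord[OF m(2,1) 3] relative_triangle_swap[OF n le(2,1)] t0 by simp
  qed
qed

lemma adjoint_pull_comp:
  assumes \<sigma>: "adjoint_pull \<sigma>" and \<tau>: "adjoint_pull \<tau>"
  shows "adjoint_pull (\<sigma> \<circ> \<tau>)"
  unfolding adjoint_pull_def
proof (intro conjI ballI)
  have p: "\<sigma> permutes {0..n}" "\<tau> permutes {0..n}" using assms unfolding adjoint_pull_def by blast+
  show "\<sigma> \<circ> \<tau> permutes {0..n}" by (rule permutes_compose[OF p(2,1)])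
  fix x \<phi> assume x: "x \<in> hpart H (2 * (d - 1))" and K: "\<phi> \<in> config_forms"
  have y: "\<rho> \<tau> x \<in> hpart H (2 * (d - 1))" using action_hpart[OF p(2)] x by blast
  have "pr (\<rho> (\<sigma> \<circ> \<tau>) x) \<phi> = pr (\<rho> \<sigma> (\<rho> \<tau> x)) \<phi>"
    using action_comp[OF p] hpart_carrier x by auto
  also have "\<dots> = pr (\<rho> \<tau> x) (pull_form \<sigma> \<phi>)" using \<sigma> y K unfolding adjoint_pull_def by blast
  also have "\<dots> = pr x (pull_form \<tau> (pull_form \<sigma> \<phi>))"
    using \<tau> x pull_form_config[OF K] unfolding adjoint_pull_def by blast
  finally show "pr (\<rho> (\<sigma> \<circ> \<tau>) x) \<phi> = pr x (pull_form (\<sigma> \<circ> \<tau>) \<phi>)"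
    unfolding pull_form_comp[OF config_formsD(1)[OF K]] .
qed

lemma adjoint_pull_permutes:
  assumes n: "n \<ge> 1" and \<sigma>: "\<sigma> permutes {0..n}"
  shows "adjoint_pull \<sigma>"
proof -
  have stab: "adjoint_pull \<tau>" if "\<tau> permutes {0..n}" "\<tau> 0 = 0" for \<tau>
  proof (rule adjoint_pull_natural, rule permutes_superset[OF that(1)])
    fix x assume "x \<in> {0..n} - {1..n}"
    then have "x = 0" by auto
    then show "\<tau> x = x" using that by simp
  qed
  show ?thesis
  proof (cases "\<sigma> 0 = 0")
    case True
    then show ?thesis using stab \<sigma> by blast
  next
    case False
    define a where "a = \<sigma> 0"
    have "a \<le> n" using permutes_in_image[OF \<sigma>, of 0] unfolding a_def by simp
    then have a: "a \<in> {1..n}" using False unfolding a_def by simp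
    \<comment> \<open>Moving \<open>\<sigma> 0\<close> to \<open>1\<close> and then to
      \<open>0\<close> leaves a permutation that fixes \<open>0\<close>; undoing the two moves
      writes \<open>\<sigma>\<close> as a product of permutations already treated.\<close>
    let ?s = "Transposition.transpose (0::nat) 1" and ?t = "Transposition.transpose 1 a"
    have t: "?t permutes {1..n}" using a n by (intro permutes_swap_id) auto
    have perm: "?s permutes {0..n}" "?t permutes {0..n}"
      using a n by (auto intro!: permutes_swap_id)
    have "?s \<circ> (?t \<circ> \<sigma>) permutes {0..n}" by (intro permutes_compose perm \<sigma>)
    moreover have "(?s \<circ> (?t \<circ> \<sigma>)) 0 = 0" unfolding comp_def a_def by simp
    ultimately have "adjoint_pull (?s \<circ> (?t \<circ> \<sigma>))" by (rule stab)
    then have "adjoint_pull (?t \<circ> (?s \<circ> (?s \<circ> (?t \<circ> \<sigma>))))"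
      by (rule adjoint_pull_comp[OF adjoint_pull_natural[OF t] adjoint_pull_comp[OF adjoint_pull_transpose[OF n]]])
    moreover have "?t \<circ> (?s \<circ> (?s \<circ> (?t \<circ> \<sigma>))) = \<sigma>" by (simp add: fun_eq_iff)
    ultimately show ?thesis by (simp only:)
  qed
qed

lemma pr_local:
  assumes "x \<in> carrier H" "\<phi> \<in> config_forms" "\<And>a b c e. {a, b, c, e} \<subseteq> {0..n} \<Longrightarrow> \<phi> a b c e = 0"
  shows "pr x \<phi> = 0"
proof -
  obtain f where f: "f \<in> carrier F" "x = L f" using assms(1) unfolding L_surj by blast
  show ?thesis
    unfolding f(2) pr_L[OF f(1) assms(2)] config_pairing_def
    by (intro sum.neutral ballI) (use assms(3) in auto)
qed

text \<open>If the difference of \<open>x\<close> and \<open>y\<close> were nonzero, a form would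
  separate it from the zero subspace. It is written with the scalar \<open>-1\<close> so that
  linearity of the pairing applies directly.\<close>

lemma pr_inj:
  assumes x: "x \<in> hpart H (2 * (d - 1))" and y: "y \<in> hpart H (2 * (d - 1))"
    and eq: "\<And>\<phi>. \<phi> \<in> config_forms \<Longrightarrow> pr x \<phi> = pr y \<phi>"
  shows "x = y"
proof (rule ccontr)
  assume "x \<noteq> y"
  have c: "x \<in> carrier H" "y \<in> carrier H" using x y hpart_carrier by auto
  let ?y = "(- 1) \<odot>\<^bsub>H\<^esub> y"
  obtain f where f: "f \<in> carrier F" "y = L f" using c(2) unfolding L_surj by blast
  have cy: "?y \<in> carrier H" by (rule smult_H_closed[OF c(2)])
  have "?y \<oplus>\<^bsub>H\<^esub> y = L (\<lambda>w. - 1 * f w + f w)"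
    unfolding f(2) L_smult[OF f(1), symmetric] L_add[OF free_algebra_smult_closed[OF f(1)] f(1)] ..
  then have y0: "?y \<oplus>\<^bsub>H\<^esub> y = \<zero>\<^bsub>H\<^esub>" by (simp add: L_zero)
  have "x \<oplus>\<^bsub>H\<^esub> ?y \<noteq> \<zero>\<^bsub>H\<^esub>"
  proof
    assume "x \<oplus>\<^bsub>H\<^esub> ?y = \<zero>\<^bsub>H\<^esub>"
    moreover have "(x \<oplus>\<^bsub>H\<^esub> ?y) \<oplus>\<^bsub>H\<^esub> y = x" using H.a_assoc[OF c(1) cy c(2)] y0 c by simp
    ultimately show False using c \<open>x \<noteq> y\<close> by simp
  qed
  moreover have "c \<odot>\<^bsub>H\<^esub> \<zero>\<^bsub>H\<^esub> = \<zero>\<^bsub>H\<^esub>" for c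
    using L_smult[of "\<lambda>w. 0" c] F.zero_closed by (simp add: free_algebra_simps(4) L_zero)
  ultimately have "\<exists>\<phi>\<in>config_forms. (\<forall>z\<in>{\<zero>\<^bsub>H\<^esub>}. pr z \<phi> = 0) \<and> pr (x \<oplus>\<^bsub>H\<^esub> ?y) \<phi> \<noteq> 0"
    by (intro separation hpart_H_add hpart_H_smult x y) (auto simp: hpart_H_zero)
  then show False using eq c cy by (auto simp: pr_add pr_smult)
qed

lemma pr_eval:
  assumes "{a, b, c, e} \<subseteq> {0..n}"
  shows "\<exists>x\<in>hpart H (2 * (d - 1)). \<forall>\<phi>\<in>config_forms. pr x \<phi> = \<phi> a b c e"
proof (cases "a = 0 \<or> b = 0 \<or> c = 0 \<or> e = 0")
  case True
  then show ?thesis by (intro bexI[OF _ hpart_H_zero]) (auto simp: pr_zero config_forms_zero)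
next
  case False
  then have m: "(a, b) \<in> G" "(c, e) \<in> G" using assms by auto
  have w: "word_fun [(a, b), (c, e)] \<in> hpart F (2 * (d - 1))" by (rule word_fun_hpart[OF m])
  then have "word_fun [(a, b), (c, e)] \<in> carrier F" unfolding hpart_F by blast
  then have "\<forall>\<phi>\<in>config_forms. pr (L (word_fun [(a, b), (c, e)])) \<phi> = \<phi> a b c e"
    using pr_L config_pairing_word[OF m] by simp
  moreover have "L (word_fun [(a, b), (c, e)]) \<in> hpart H (2 * (d - 1))" unfolding hpart_H using w by blast
  ultimately show ?thesis by blast
qed

lemma form_pairing_hpart:
  assumes "n \<ge> 5"
  shows "form_pairing n {0..n} (hpart_rep H (2 * (d - 1)) \<rho>) pr"
proof
  have c: "x \<in> carrier H" if "x \<in> hpart H (2 * (d - 1))" for x using that hpart_carrier by blast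
  let ?V = "hpart_rep H (2 * (d - 1)) \<rho>"
  have V: "carrier ?V = hpart H (2 * (d - 1))" "(\<oplus>\<^bsub>?V\<^esub>) = (\<oplus>\<^bsub>H\<^esub>)" "(\<odot>\<^bsub>?V\<^esub>) = (\<odot>\<^bsub>H\<^esub>)" "act ?V = \<rho>"
    unfolding hpart_rep_def by simp_all
  show "n \<ge> 5" "{0..n} = {0..n}" by (rule assms refl)+
  show "x \<oplus>\<^bsub>?V\<^esub> y \<in> carrier ?V" if "x \<in> carrier ?V" "y \<in> carrier ?V" for x y
    using that hpart_H_add unfolding V by blast
  show "k \<odot>\<^bsub>?V\<^esub> x \<in> carrier ?V" if "x \<in> carrier ?V" for x k using that hpart_H_smult unfolding V by blast
  show "act ?V \<sigma> x \<in> carrier ?V" if "x \<in> carrier ?V" "\<sigma> permutes {0..n}" for x \<sigma>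
    using that action_hpart unfolding V by blast
  show "pr (x \<oplus>\<^bsub>?V\<^esub> y) \<phi> = pr x \<phi> + pr y \<phi>"
    if "x \<in> carrier ?V" "y \<in> carrier ?V" "\<phi> \<in> config_forms" for x y \<phi>
    using that pr_add c unfolding V by blast
  show "pr (k \<odot>\<^bsub>?V\<^esub> x) \<phi> = k * pr x \<phi>" if "x \<in> carrier ?V" "\<phi> \<in> config_forms" for x k \<phi>
    using that pr_smult c unfolding V by blast
  show "pr (act ?V \<sigma> x) \<phi> = pr x (pull_form \<sigma> \<phi>)"
    if "x \<in> carrier ?V" "\<sigma> permutes {0..n}" "\<phi> \<in> config_forms" for x \<sigma> \<phi>
    using that(1,3) adjoint_pull_permutes[OF _ that(2)] assms unfolding V adjoint_pull_def by (meson dual_order.trans one_le_numeral)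
  show "\<exists>x\<in>carrier ?V. \<forall>\<phi>\<in>config_forms. pr x \<phi> = \<phi> a b c e" if "{a, b, c, e} \<subseteq> {0..n}" for a b c e
    unfolding V by (rule pr_eval[OF that])
  show "pr x \<phi> = 0" if "x \<in> carrier ?V" "\<phi> \<in> config_forms"
    "\<And>a b c e. {a, b, c, e} \<subseteq> {0..n} \<Longrightarrow> \<phi> a b c e = 0" for x \<phi>
    using that(1) unfolding V by (rule pr_local[OF c that(2,3)])
  show "x = y" if "x \<in> carrier ?V" "y \<in> carrier ?V" "\<And>\<phi>. \<phi> \<in> config_forms \<Longrightarrow> pr x \<phi> = pr y \<phi>" for x y
    using that unfolding V by (rule pr_inj)
  show "\<exists>\<phi>\<in>config_forms. (\<forall>y\<in>M. pr y \<phi> = 0) \<and> pr x \<phi> \<noteq> 0"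
    if "M \<subseteq> carrier ?V" "M \<noteq> {}" "\<And>x y. x \<in> M \<Longrightarrow> y \<in> M \<Longrightarrow> x \<oplus>\<^bsub>?V\<^esub> y \<in> M"
      "\<And>k x. x \<in> M \<Longrightarrow> k \<odot>\<^bsub>?V\<^esub> x \<in> M" "x \<in> carrier ?V" "x \<notin> M" for M x
    using that unfolding V by (rule separation)
qed

end

theorem theorem13:
  fixes n d :: nat
    and A :: "nat \<Rightarrow> nat \<Rightarrow> config cochain set"
    and \<rho> :: "(nat \<Rightarrow> nat) \<Rightarrow> config cochain set \<Rightarrow> config cochain set"
  assumes "n \<ge> 5" and "odd d" and "d \<ge> 3"
    and "standard_generators n d A"
    and "extended_action n d A \<rho>"
  shows "rep_isomorphic {0..n} (hpart_rep (config_cohomology n d) (2 * (d - 1)) \<rho>)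
    (specht {0..n} [n - 3, 1, 1, 1, 1] \<oplus>\<^sub>R specht {0..n} [n - 2, 2, 1] \<oplus>\<^sub>R
     specht {0..n} [n - 3, 2, 2] \<oplus>\<^sub>R specht {0..n} [n - 1, 2])"
proof -
  obtain \<Phi> where \<Phi>: "\<Phi> \<in> graded_algebra_iso (presented_algebra n d) (config_cohomology n d)"
    "\<forall>i\<in>{1..n}. \<forall>j\<in>{1..n}. \<Phi> (presented_gen n d i j) = A i j"
    using assms(4) unfolding standard_generators_def by blast
  interpret cohomology_presentation n d A \<rho> \<Phi>
    using assms \<Phi> unfolding standard_generators_def by unfold_locales blast+
  interpret form_pairing n "{0..n}" "hpart_rep (config_cohomology n d) (2 * (d - 1)) \<rho>" pr
    by (rule form_pairing_hpart[OF assms(1)])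
  show ?thesis using rep_isomorphic_specht_sum unfolding specht_sum_def .
qed

end
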